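(* Let $n\ge2$ and let $m_1,\dots,m_n>0$ with $m_1$ the smallest mass. For any $c\in(0,\frac{m_1}{2})$, counted up to the action of $S^1=SO(2)$, there are exactly $n!/2$ geodesic ordinary central configurations on $\mathcal{M}_c$, one for each ordering of the masses (an ordering and its reverse being identified by the rotation by $\pi$). Provided that $0<c<\frac{m_1}{4}$, at each of them the Hessian of the function induced by $U_1$ on the quotient manifold $\mathcal{M}_c/S^1$ has inertia $(n_0,n_+,n_-)=(0,n,n-2)$.
   Context: $\mathbb{S}^2$ is the unit sphere in $\mathbb{R}^3$ with coordinates $(x,y,z)$; the distance $d_{ij}\in[0,\pi]$ is given by $\cos d_{ij}=\mathbf q_i\cdot\mathbf q_j$. $\mathbb{S}^1$ as a geodesic denotes $\{(x,y,z)\in\mathbb{S}^2:y=0\}$. Configurations are $\mathbf q=(\mathbf q_1,\dots,\mathbf q_n)\in(\mathbb{S}^2)^n$, $\mathbf q_i=(x_i,y_i,z_i)$; $\Delta_+=\bigcup_{i<j}\{\mathbf q:\mathbf q_i=\pm\mathbf q_j\}$; $U_1(\mathbf q)=\sum_{i<j}m_im_j\cot d_{ij}$ on $(\mathbb{S}^2)^n\setminus\Delta_+$; $I_1(\mathbf q)=\sum_im_i(x_i^2+y_i^2)$. For $0<c<m_1$, $\mathcal{M}_c=\{\mathbf q\in(\mathbb{S}^2)^n\setminus\Delta_+: I_1(\mathbf q)=c,\ z_i>0 \text{ for } i=1,\dots,n\}$. The group $S^1=SO(2)$ acts by rotating all $(x_i,y_i)$ simultaneously; it preserves $U_1$, $I_1$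 and $\mathcal{M}_c$, and $\mathcal{M}_c/S^1$ is a smooth manifold of dimension $2n-2$. A central configuration is a critical point of $U_1-\lambda I_1$ for some $\lambda\in\mathbb{R}$; it is ordinary if it is not a critical point of $U_1$. It is geodesic if all particles lie on one great circle; every geodesic ordinary central configuration in $\mathcal{M}_c$ is $S^1$-equivalent to one with all particles on $\{y=0\}$. The inertia $(n_0,n_+,n_-)$ of a quadratic form is the triple of its nullity, positive index and negative index. *)

theory Defs
  imports "HOL-Analysis.Analysis" "HOL-Combinatorics.Multiset_Permutations"
begin

text \<open>Curves of class \<open>C\<^sup>2\<close>, defined near 0, that lie in \<open>M\<close>, start at \<open>p\<close> and have
  initial velocity \<open>v\<close>.\<close>

definition C2_curve_in :: "'a::real_normed_vector set \<Rightarrow> 'a \<Rightarrow> 'a \<Rightarrow> (real \<Rightarrow> 'a) \<Rightarrow> bool" where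
  "C2_curve_in M p v g \<longleftrightarrow> g 0 = p \<and>
     (\<exists>e>0. \<exists>g' g''. g' 0 = v \<and> continuous_on {-e<..<e} g'' \<and>
        (\<forall>t\<in>{-e<..<e}. g t \<in> M \<and> (g has_vector_derivative g' t) (at t) \<and>
                        (g' has_vector_derivative g'' t) (at t)))"

definition tangent_space :: "'a::real_normed_vector set \<Rightarrow> 'a \<Rightarrow> 'a set" where
  "tangent_space M p = {v. \<exists>g. C2_curve_in M p v g}"

text \<open>Critical points of the restriction of \<open>f\<close> to \<open>M\<close>: the differential vanishes on every
  tangent vector.\<close>

definition critical_point_on :: "'a::real_normed_vector set \<Rightarrow> ('a \<Rightarrow> real) \<Rightarrow> 'a \<Rightarrow> bool" where
  "critical_point_on M f p \<longleftrightarrow> p \<in> M \<and>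
     (\<forall>v g. C2_curve_in M p v g \<longrightarrow> ((\<lambda>t. f (g t)) has_real_derivative 0) (at 0))"

definition has_second_derivative :: "(real \<Rightarrow> real) \<Rightarrow> real \<Rightarrow> real \<Rightarrow> bool" where
  "has_second_derivative f h t \<longleftrightarrow>
     (\<exists>f'. (\<forall>\<^sub>F s in nhds t. (f has_real_derivative f' s) (at s)) \<and> (f' has_real_derivative h) (at t))"

definition polar_form :: "('a::real_vector \<Rightarrow> real) \<Rightarrow> 'a \<Rightarrow> 'a \<Rightarrow> real" where
  "polar_form Q v w = (Q (v + w) - Q v - Q w) / 2"

text \<open>The triple (nullity, positive index, negative index) of a quadratic form on the quotient
  space \<open>V / L\<close>. The form is given as a function \<open>Q\<close> on \<open>V\<close> that is constant on the cosets of \<open>L\<close>,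
  and a subspace of \<open>V / L\<close> is given as \<open>S / L\<close> for a subspace \<open>S\<close> with \<open>L \<subseteq> S \<subseteq> V\<close>. The positive
  (negative) index is the largest dimension of a subspace on which the form is positive
  (negative) definite.\<close>

definition quotient_inertia ::
    "'a::euclidean_space set \<Rightarrow> 'a set \<Rightarrow> ('a \<Rightarrow> real) \<Rightarrow> nat \<times> nat \<times> nat" where
  "quotient_inertia V L Q =
     (dim {v\<in>V. \<forall>w\<in>V. polar_form Q v w = 0} - dim L,
      Max {dim S - dim L | S. subspace S \<and> L \<subseteq> S \<and> S \<subseteq> V \<and> (\<forall>v\<in>S - L. Q v > 0)},
      Max {dim S - dim L | S. subspace S \<and> L \<subseteq> S \<and> S \<subseteq> V \<and> (\<forall>v\<in>S - L. Q v < 0)})"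

text \<open>The particles are labelled by a finite linearly ordered type; the order only serves to list each
  pair of particles once. The numbers \<open>q $ i $ 1\<close>, \<open>q $ i $ 2\<close>, \<open>q $ i $ 3\<close> are the
  coordinates \<open>x\<close>, \<open>y\<close>, \<open>z\<close> of particle \<open>i\<close>.\<close>

type_synonym 'n config = "(real^3)^'n"

definition sphere_configs :: "'n::finite config set" where
  "sphere_configs = {q. \<forall>i. q $ i \<in> sphere 0 1}"

definition singular_configs :: "'n::{finite,linorder} config set" where
  "singular_configs = {q. \<exists>i j. i < j \<and> (q $ i = q $ j \<or> q $ i = - q $ j)}"

definition sdist :: "real^3 \<Rightarrow> real^3 \<Rightarrow> real" where
  "sdist p r = arccos (p \<bullet> r)"

definition U1 :: "('n::{finite,linorder} \<Rightarrow> real) \<Rightarrow> 'n config \<Rightarrow> real" where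
  "U1 m q = (\<Sum>(i, j)\<in>{(i, j). i < j}. m i * m j * cot (sdist (q $ i) (q $ j)))"

definition I1 :: "('n::finite \<Rightarrow> real) \<Rightarrow> 'n config \<Rightarrow> real" where
  "I1 m q = (\<Sum>i\<in>UNIV. m i * ((q $ i $ 1)\<^sup>2 + (q $ i $ 2)\<^sup>2))"

definition M_set :: "('n::{finite,linorder} \<Rightarrow> real) \<Rightarrow> real \<Rightarrow> 'n config set" where
  "M_set m c = {q \<in> sphere_configs - singular_configs. I1 m q = c \<and> (\<forall>i. q $ i $ 3 > 0)}"

definition rotate_z :: "real \<Rightarrow> 'n::finite config \<Rightarrow> 'n config" where
  "rotate_z a q = (\<chi> i. vector [cos a * q $ i $ 1 - sin a * q $ i $ 2,
                                 sin a * q $ i $ 1 + cos a * q $ i $ 2,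
                                 q $ i $ 3])"

definition orbit_z :: "'n::finite config \<Rightarrow> 'n config set" where
  "orbit_z q = range (\<lambda>a. rotate_z a q)"

definition central_config :: "('n::{finite,linorder} \<Rightarrow> real) \<Rightarrow> 'n config \<Rightarrow> bool" where
  "central_config m q \<longleftrightarrow>
     (\<exists>l. critical_point_on (sphere_configs - singular_configs) (\<lambda>p. U1 m p - l * I1 m p) q)"

definition ordinary_central_config :: "('n::{finite,linorder} \<Rightarrow> real) \<Rightarrow> 'n config \<Rightarrow> bool" where
  "ordinary_central_config m q \<longleftrightarrow> central_config m q \<and>
     \<not> critical_point_on (sphere_configs - singular_configs) (U1 m) q"

definition great_circle :: "(real^3) set \<Rightarrow> bool" where
  "great_circle C \<longleftrightarrow> (\<exists>w. w \<noteq> 0 \<and> C = {p \<in> sphere 0 1. w \<bullet> p = 0})"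

definition geodesic_config :: "'n::finite config \<Rightarrow> bool" where
  "geodesic_config q \<longleftrightarrow> (\<exists>C. great_circle C \<and> (\<forall>i. q $ i \<in> C))"

definition geodesic_occs :: "('n::{finite,linorder} \<Rightarrow> real) \<Rightarrow> real \<Rightarrow> 'n config set" where
  "geodesic_occs m c = {q \<in> M_set m c. ordinary_central_config m q \<and> geodesic_config q}"

text \<open>An ordering of the particles is a list that contains each label exactly once. An orbit has
  the ordering \<open>xs\<close> if it contains a configuration on the circle \<open>y = 0\<close> whose particles, listed by
  increasing \<open>x\<close>, are \<open>xs\<close>. (All particles have \<open>z > 0\<close>, so this is their order along the circle.)\<close>

definition orbit_has_ordering :: "'n::finite config set \<Rightarrow> 'n list \<Rightarrow> bool" where
  "orbit_has_ordering X xs \<longleftrightarrow>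
     (\<exists>q\<in>X. (\<forall>i. q $ i $ 2 = 0) \<and> sorted_wrt (\<lambda>i j. q $ i $ 1 < q $ j $ 1) xs)"

text \<open>The value at an orbit of the function induced by a rotation invariant function.\<close>

definition induced_fun :: "('n::finite config \<Rightarrow> real) \<Rightarrow> 'n config set \<Rightarrow> real" where
  "induced_fun f X = the_elem (f ` X)"

definition orbit_tangent :: "'n::finite config \<Rightarrow> 'n config set" where
  "orbit_tangent q = span {vector_derivative (\<lambda>a. rotate_z a q) (at 0)}"

text \<open>The tangent space of the quotient of \<open>M_set m c\<close> at the orbit of \<open>q\<close> is
  \<open>tangent_space (M_set m c) q / orbit_tangent q\<close>, and the curves in the quotient that start at this
  orbit are locally the projections of the curves in \<open>M_set m c\<close> that start at \<open>q\<close>. At a critical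
  point, the Hessian of a function \<open>f\<close> on a manifold is the quadratic form that sends the
  initial velocity of a curve \<open>g\<close> to the second derivative of \<open>f \<circ> g\<close> at 0; the next
  definition is this form for the function induced by \<open>U1\<close>, evaluated at the class of \<open>v\<close>.\<close>

definition quotient_hessian ::
    "('n::{finite,linorder} \<Rightarrow> real) \<Rightarrow> real \<Rightarrow> 'n config \<Rightarrow> 'n config \<Rightarrow> real" where
  "quotient_hessian m c q v =
     (THE h. \<forall>g. C2_curve_in (M_set m c) q v g \<longrightarrow>
        has_second_derivative (\<lambda>t. induced_fun (U1 m) (orbit_z (g t))) h 0)"

definition hessian_inertia ::
    "('n::{finite,linorder} \<Rightarrow> real) \<Rightarrow> real \<Rightarrow> 'n config \<Rightarrow> nat \<times> nat \<times> nat" where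
  "hessian_inertia m c q =
     quotient_inertia (tangent_space (M_set m c) q) (orbit_tangent q) (quotient_hessian m c q)"

end

theory Submission imports Defs
begin

text \<open>
  Why the theorem holds. Moving one particle normally to the great circle that carries a geodesic
  central configuration changes \<open>U1\<close> only to second order; if the multiplier is not zero, \<open>I1\<close> is then
  unchanged to first order as well, and this forces the circle to pass through the north pole
  (\<open>geodesic_occ_vertical\<close>). So, up to rotation, the particles have angles \<open>th i\<close> on one half circle, and
  the problem is to find the critical points of the sum of the \<open>m i * m j * cot \<bar>th i - th j\<bar>\<close> on the level
  \<open>c\<close> of the sum of the \<open>m i * (sin (th i))\<^sup>2\<close> (\<open>geodesic_occs_eq\<close>).

  If \<open>c < m i / 2\<close> for all \<open>i\<close>, all angles are below \<open>\<pi>/4\<close>. There the potential is convex for each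
  ordering, the moment is strictly convex, and the multiplier is negative, because the
  forces are repulsive. Hence each ordering has at most one equilibrium (\<open>line_balanced_unique\<close>); one exists
  because the potential is infinite at collisions (\<open>exists_balanced\<close>). Rotation by \<open>\<pi>\<close> reverses the ordering
  and no other rotation maps the half circle to its own great circle, which gives \<open>n! / 2\<close> orbits.

  At such a configuration the Hessian splits. The part tangential to the circle is positive definite, by the
  same convexity, on a space of dimension \<open>n - 1\<close>. In the normal part, gnomonic projection to the
  tangent line at the pole yields a graph Laplacian: the form is \<open>\<kappa>\<close> times the mass form minus the Dirichlet form,
  and the equilibrium condition says that the vector of positions is an eigenvector with eigenvalue
  \<open>\<kappa> > 0\<close>. It is the infinitesimal rotation and is divided out in the quotient; the constant vector is a
  positive direction. For \<open>c < m i / 4\<close> the angles are below \<open>\<pi>/6\<close>, and then the influence of one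
  vertex on another decreases with the distance. The heat flow of such a Laplacian preserves monotone vectors, so an
  increasing eigenvector belongs to the smallest nonzero eigenvalue, which is simple (\<open>spectral_gap\<close>).
  Hence all remaining \<open>n - 2\<close> normal directions are negative (\<open>line_hessian_inertia\<close>).
\<close>

section \<open>Inertia of a form that splits orthogonally\<close>

text \<open>Sylvester's argument on a quotient: a subspace on which the form is definite of one sign meets
  the summand of the other sign only in \<open>L\<close>, so \<open>dim V + dim L = dim P + dim N\<close> bounds its dimension by that
  of the summand of its own sign. The radical is \<open>L\<close> because both components of a radical vector are isotropic.\<close>

lemma quotient_inertia_orthogonal_splitting:
  fixes B :: "'a::euclidean_space \<Rightarrow> 'a \<Rightarrow> real"
  assumes P: "subspace P" and N: "subspace N"
    and V: "V = {p + n | p n. p \<in> P \<and> n \<in> N}" and L: "P \<inter> N = L"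
    and B: "bilinear B" "\<And>v w. B v w = B w v" and Q: "\<And>v. v \<in> V \<Longrightarrow> Q v = B v v"
    and orth: "\<And>p n. p \<in> P \<Longrightarrow> n \<in> N \<Longrightarrow> B p n = 0"
    and pos: "\<And>p. p \<in> P - L \<Longrightarrow> B p p > 0"
    and neg: "\<And>n. n \<in> N - L \<Longrightarrow> B n n < 0"
  shows "quotient_inertia V L Q = (0, dim P - dim L, dim N - dim L)"
proof -
  let ?dims = "\<lambda>R. {dim S - dim L | S. subspace S \<and> L \<subseteq> S \<and> S \<subseteq> V \<and> (\<forall>v\<in>S - L. R (Q v))}"
  have sV: "subspace V" unfolding V using P N by (rule subspace_sums)
  have LP: "L \<subseteq> P" and LN: "L \<subseteq> N" using L by auto
  have PV: "P \<subseteq> V" unfolding V using subspace_0[OF N] by force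
  have NV: "N \<subseteq> V" unfolding V using subspace_0[OF P] by force
  have dimV: "dim V + dim L = dim P + dim N"
    using dim_sums_Int[OF P N] unfolding V L .
  have polar: "polar_form Q v w = B v w" if "v \<in> V" "w \<in> V" for v w
    using that subspace_add[OF sV that] B(2)[of w v]
    by (simp add: polar_form_def Q bilinear_ladd[OF B(1)] bilinear_radd[OF B(1)])
  have rad: "{v\<in>V. \<forall>w\<in>V. polar_form Q v w = 0} = L"
  proof (intro set_eqI iffI)
    fix v assume "v \<in> {v\<in>V. \<forall>w\<in>V. polar_form Q v w = 0}"
    then have v: "v \<in> V" "\<And>w. w \<in> V \<Longrightarrow> B v w = 0" using polar by auto
    obtain p n where pn: "v = p + n" "p \<in> P" "n \<in> N" using v(1) V by blast
    have "B p p = 0" using v(2)[of p] pn PV orth[of p n] B(2)[of n p]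
      by (auto simp: bilinear_ladd[OF B(1)])
    then have p: "p \<in> L" using pos[of p] pn by force
    have "B n n = 0" using v(2)[of n] pn NV orth[of p n]
      by (auto simp: bilinear_ladd[OF B(1)])
    then have "n \<in> L" using neg[of n] pn by force
    then show "v \<in> L" using p pn subspace_add[OF subspace_inter[OF P N]] L by auto
  next
    fix v assume v: "v \<in> L"
    have "B v w = 0" if w: "w \<in> V" for w
    proof -
      obtain p n where pn: "w = p + n" "p \<in> P" "n \<in> N" using w V by blast
      moreover have "v \<in> P" "v \<in> N" using v LP LN by auto
      ultimately show ?thesis using orth[of v n] orth[of p v] B(2)[of v p]
        by (simp add: bilinear_radd[OF B(1)])
    qed
    then show "v \<in> {v\<in>V. \<forall>w\<in>V. polar_form Q v w = 0}" using v LP PV polar by auto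
  qed
  have bound: "dim S - dim L \<le> dim T' - dim L"
    if S: "subspace S" "S \<subseteq> V" and T: "subspace T" "T \<subseteq> V" "S \<inter> T \<subseteq> L"
      and d: "dim V + dim L = dim T + dim T'" for S T T'
  proof -
    have "{x + y | x y. x \<in> S \<and> y \<in> T} \<subseteq> V"
      using S(2) T(2) subspace_add[OF sV] by blast
    then have "dim {x + y | x y. x \<in> S \<and> y \<in> T} \<le> dim V" by (rule dim_subset)
    moreover have "dim (S \<inter> T) \<le> dim L" using T(3) by (rule dim_subset)
    ultimately show ?thesis using dim_sums_Int[OF S(1) T(1)] d by linarith
  qed
  have index_eq: "Max (?dims R) = dim T' - dim L"
    if T: "subspace T" "T \<subseteq> V" "\<And>v. v \<in> T \<Longrightarrow> v \<in> L \<or> \<not> R (B v v)"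
      and T': "subspace T'" "L \<subseteq> T'" "T' \<subseteq> V" "\<And>v. v \<in> T' - L \<Longrightarrow> R (B v v)"
      and d: "dim V + dim L = dim T + dim T'" for T T' :: "'a set" and R :: "real \<Rightarrow> bool"
  proof (rule Max_eqI)
    show "finite (?dims R)"
      by (rule finite_subset[of _ "{..DIM('a)}"])
         (auto intro: order_trans[OF diff_le_self dim_subset_UNIV])
    show "dim T' - dim L \<in> ?dims R"
      using T' Q by (intro CollectI exI[of _ T']) auto
    fix y assume "y \<in> ?dims R"
    then obtain S where S: "y = dim S - dim L" "subspace S" "S \<subseteq> V" "\<And>v. v \<in> S - L \<Longrightarrow> R (Q v)"
      by auto
    have "S \<inter> T \<subseteq> L" using S(3,4) T(3) Q by force
    then show "y \<le> dim T' - dim L" using bound[OF S(2,3) T(1,2) _ d] S(1) by simp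
  qed

  have "Max (?dims (\<lambda>x. x > 0)) = dim P - dim L"
    by (rule index_eq[of N "\<lambda>x. x > 0" P]) (use N NV neg P LP PV pos dimV in \<open>force+\<close>)
  moreover have "Max (?dims (\<lambda>x. x < 0)) = dim N - dim L"
    by (rule index_eq[of P "\<lambda>x. x < 0" N]) (use N NV neg P LN PV pos dimV in \<open>force+\<close>)
  ultimately show ?thesis unfolding quotient_inertia_def rad by simp
qed

section \<open>Spectral gap of a Laplacian with monotone weights\<close>

text \<open>The operator \<open>(\<Delta> u) i = (\<Sum>j. W i j * (u i - u j)) / M i\<close> of a weighted graph whose vertices are points
  \<open>t i\<close> of the line. Two things are known about it: the positions \<open>t\<close> themselves are an eigenvector, and the
  influence \<open>W i k / M i\<close> of a vertex \<open>k\<close> grows as \<open>i\<close> approaches \<open>k\<close> from either side. The result is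
  that \<open>\<kappa>\<close> is the smallest nonzero eigenvalue and that it is simple.\<close>

locale monotone_laplacian =
  fixes W :: "'n::finite \<Rightarrow> 'n \<Rightarrow> real" and M t :: "'n \<Rightarrow> real" and \<kappa> :: real
  assumes M_pos: "\<And>i. M i > 0" and W_sym: "\<And>i j. W i j = W j i" and inj_t: "inj t"
    and kappa_pos: "\<kappa> > 0"
    and eigen_t: "\<And>i. (\<Sum>j\<in>UNIV. W i j * (t i - t j)) = \<kappa> * M i * t i"
    and W_mono: "\<And>i j k. t i < t j \<Longrightarrow> t j < t k \<Longrightarrow> W i k / M i < W j k / M j"
                "\<And>i j k. t k < t i \<Longrightarrow> t i < t j \<Longrightarrow> W j k / M j < W i k / M i"
begin

definition ip :: "('n \<Rightarrow> real) \<Rightarrow> ('n \<Rightarrow> real) \<Rightarrow> real" where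
  "ip u v = (\<Sum>i\<in>UNIV. M i * u i * v i)"

definition dirichlet :: "('n \<Rightarrow> real) \<Rightarrow> ('n \<Rightarrow> real) \<Rightarrow> real" where
  "dirichlet u v = (\<Sum>i\<in>UNIV. \<Sum>j\<in>UNIV. W i j * (u i - u j) * (v i - v j)) / 2"

lemma ip_commute: "ip u v = ip v u" by (simp add: ip_def ac_simps)

lemma ip_pos: "u \<noteq> (\<lambda>_. 0) \<Longrightarrow> ip u u > 0"
proof -
  assume "u \<noteq> (\<lambda>_. 0)"
  then obtain k where k: "u k \<noteq> 0" by auto
  show ?thesis unfolding ip_def
    by (rule sum_pos2[of _ k]) (use M_pos k in \<open>auto simp: mult.assoc less_imp_le zero_less_mult_iff not_less\<close>)
qed

lemma dirichlet_by_parts: "dirichlet u v = (\<Sum>i\<in>UNIV. v i * (\<Sum>j\<in>UNIV. W i j * (u i - u j)))"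
proof -
  have "(\<Sum>i\<in>UNIV. \<Sum>j\<in>UNIV. W i j * (u i - u j) * (v i - v j))
      = (\<Sum>i\<in>UNIV. \<Sum>j\<in>UNIV. v i * (W i j * (u i - u j)))
        + (\<Sum>i\<in>UNIV. \<Sum>j\<in>UNIV. v j * (W i j * (u j - u i)))"
    by (simp add: sum.distrib[symmetric] algebra_simps)
  also have "(\<Sum>i\<in>UNIV. \<Sum>j\<in>UNIV. v j * (W i j * (u j - u i)))
      = (\<Sum>i\<in>UNIV. \<Sum>j\<in>UNIV. v i * (W i j * (u i - u j)))"
    by (subst sum.swap) (simp add: W_sym)
  finally show ?thesis unfolding dirichlet_def sum_distrib_left by linarith
qed

lemma dirichlet_commute: "dirichlet u v = dirichlet v u" by (simp add: dirichlet_def ac_simps)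

lemma dirichlet_t: "dirichlet t v = \<kappa> * ip t v"
  unfolding dirichlet_by_parts eigen_t ip_def by (simp add: sum_distrib_left mult_ac)

lemma dirichlet_const: "dirichlet (\<lambda>_. a) v = 0" by (simp add: dirichlet_def)

lemma ip_t_const: "ip t (\<lambda>_. 1) = 0"
  using dirichlet_t[of "\<lambda>_. 1"] dirichlet_const[of 1 t] kappa_pos by (simp add: dirichlet_commute)

lemma dirichlet_add: "dirichlet (\<lambda>i. u i + v i) w = dirichlet u w + dirichlet v w"
  by (simp add: dirichlet_def add_divide_distrib[symmetric] sum.distrib[symmetric] algebra_simps)
lemma dirichlet_scale: "dirichlet (\<lambda>i. a * u i) w = a * dirichlet u w"
  by (simp add: dirichlet_def sum_distrib_left algebra_simps)
lemma ip_add: "ip (\<lambda>i. u i + v i) w = ip u w + ip v w"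
  by (simp add: ip_def sum.distrib[symmetric] algebra_simps)
lemma ip_scale: "ip (\<lambda>i. a * u i) w = a * ip u w"
  by (simp add: ip_def sum_distrib_left algebra_simps)
lemmas linear_left = dirichlet_add dirichlet_scale ip_add ip_scale
lemma linear_right:
  "dirichlet w (\<lambda>i. u i + v i) = dirichlet w u + dirichlet w v"
  "dirichlet w (\<lambda>i. a * u i) = a * dirichlet w u"
  "ip w (\<lambda>i. u i + v i) = ip w u + ip w v"
  "ip w (\<lambda>i. a * u i) = a * ip w u"
  using dirichlet_add[of u v w] dirichlet_scale[of a u w] ip_add[of u v w] ip_scale[of a u w]
  by (simp_all only: dirichlet_commute[of w] ip_commute[of w])

text \<open>Compare \<open>u\<close> with the increasing vector \<open>t\<close>. Let \<open>\<rho>\<close> be the largest slope of \<open>u\<close> with respect to \<open>t\<close>.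
  Then \<open>p = \<rho> t - u\<close> is still weakly increasing along the line, but it takes equal values at the two vertices
  \<open>a\<close>, \<open>b\<close> where the slope is attained. The flow \<open>- \<Delta>\<close> keeps increasing vectors increasing: by the
  monotonicity of the weights it pulls \<open>p a\<close> and \<open>p b\<close> strictly apart. Expressed by the eigenvalues, this
  says \<open>(\<nu> - \<kappa>) * (u b - u a) > 0\<close>, where \<open>u b > u a\<close> because \<open>\<rho> > 0\<close>.\<close>

lemma eigenvalue_gt:
  assumes u: "u \<noteq> (\<lambda>_. 0)" "ip u (\<lambda>_. 1) = 0" "ip u t = 0"
    and eig: "\<And>i. (\<Sum>j\<in>UNIV. W i j * (u i - u j)) = \<nu> * M i * u i"
  shows "\<nu> > \<kappa>"
proof -
  define r where "r = (\<lambda>(i, j). (u j - u i) / (t j - t i))"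
  define A where "A = {(i, j). t i < t j}"
  have covariance: "(\<Sum>i\<in>UNIV. \<Sum>j\<in>UNIV. M i * M j * ((u j - u i) * (t j - t i))) = 0"
  proof -
    have s: "(\<Sum>i\<in>UNIV. M i * u i) = 0" "(\<Sum>i\<in>UNIV. M i * u i * t i) = 0"
      using u by (simp_all add: ip_def)
    have "(\<Sum>i\<in>UNIV. \<Sum>j\<in>UNIV. M i * M j * ((u j - u i) * (t j - t i)))
      = (\<Sum>i\<in>UNIV. \<Sum>j\<in>UNIV. M i * (M j * u j * t j)) - (\<Sum>i\<in>UNIV. \<Sum>j\<in>UNIV. M i * t i * (M j * u j))
       - (\<Sum>i\<in>UNIV. \<Sum>j\<in>UNIV. (M i * u i) * (M j * t j)) + (\<Sum>i\<in>UNIV. \<Sum>j\<in>UNIV. (M i * u i * t i) * M j)"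
      by (simp add: sum_subtractf[symmetric] sum.distrib[symmetric] algebra_simps)
    also have "\<dots> = 0"
      by (simp add: sum_distrib_left[symmetric] sum_distrib_right[symmetric] s)
    finally show ?thesis .
  qed
  have nonconst: "\<exists>i j. p i \<noteq> p j" if "p \<noteq> (\<lambda>_. 0)" "ip p (\<lambda>_. 1) = 0" for p
  proof (rule ccontr)
    assume "\<not> ?thesis"
    then have c: "p = (\<lambda>_. p undefined)" by auto
    have "ip p p = p undefined * ip p (\<lambda>_. 1)"
      by (subst (2) c) (simp add: ip_def sum_distrib_left mult_ac)
    then show False using ip_pos[OF that(1)] that(2) by simp
  qed
  \<comment> \<open>Some slope is positive, since the slopes have weighted mean zero; so \<open>\<rho> > 0\<close>.\<close>
  have "\<exists>i j. (u j - u i) * (t j - t i) > 0"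
  proof (rule ccontr)
    assume "\<not> ?thesis"
    then have le: "(u j - u i) * (t j - t i) \<le> 0" for i j by (meson not_le)
    have le2: "0 \<le> - (M i * M j * ((u j - u i) * (t j - t i)))" for i j
      using mult_nonneg_nonpos[OF _ le, of "M i * M j" j i] M_pos
      by (simp add: less_imp_le)
    define f where "f = (\<lambda>(i, j). - (M i * M j * ((u j - u i) * (t j - t i))))"
    have "sum f (UNIV \<times> UNIV) = 0"
      using covariance unfolding f_def by (simp only: sum.cartesian_product[symmetric] sum_negf)
    then have f0: "f (i, j) = 0" for i j
      using le2 by (intro sum_nonneg_0[of "UNIV \<times> UNIV" f]) (simp_all add: f_def split_beta)
    have "(u j - u i) * (t j - t i) = 0" for i j
      using f0[of i j] M_pos[of i] M_pos[of j] by (simp add: f_def)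
    then have "u i = u j" for i j using inj_t by (cases "i = j") (auto simp: inj_def)
    then show False using nonconst[OF u(1,2)] by auto
  qed
  then obtain i0 j0 where ij0: "(u j0 - u i0) * (t j0 - t i0) > 0" by blast
  define e where "e = (if t i0 < t j0 then (i0, j0) else (j0, i0))"
  have e: "e \<in> A" "r e > 0"
    using ij0 by (auto simp: e_def A_def r_def zero_less_mult_iff zero_less_divide_iff divide_less_0_iff)
  define \<rho> where "\<rho> = Max (r ` A)"
  have fin: "finite (r ` A)" by simp
  have "\<rho> \<in> r ` A" unfolding \<rho>_def by (rule Max_in) (use e in auto)
  then obtain x where x: "x \<in> A" "\<rho> = r x" by blast
  obtain a b where "x = (a, b)" by fastforce
  with x have ab: "t a < t b" "\<rho> = (u b - u a) / (t b - t a)" by (simp_all add: A_def r_def)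
  have \<rho>: "\<rho> > 0" using Max_ge[OF fin imageI[OF e(1)]] e(2) unfolding \<rho>_def by linarith
  define p where "p = (\<lambda>i. \<rho> * t i + (-1) * u i)"
  have p_mono: "p i \<le> p j" if "t i < t j" for i j
  proof -
    have "(u j - u i) / (t j - t i) \<le> \<rho>"
      unfolding \<rho>_def by (rule Max_ge[OF fin]) (use that in \<open>force simp: A_def r_def\<close>)
    then have "u j - u i \<le> \<rho> * (t j - t i)" using that by (simp add: field_simps)
    then show ?thesis by (simp add: p_def algebra_simps)
  qed
  have p_mono': "p i \<le> p j" if "t i \<le> t j" for i j
    using p_mono that inj_t by (metis inj_eq order.order_iff_strict)
  have pab: "p a = p b" using ab by (simp add: p_def field_simps)
  have "ip p t = \<rho> * ip t t" unfolding p_def ip_add ip_scale using u by simp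
  moreover have "t \<noteq> (\<lambda>_. 0)" using ab by (metis less_irrefl)
  ultimately have "ip p t > 0" using \<rho> ip_pos[of t] by simp
  then have "p \<noteq> (\<lambda>_. 0)" by (auto simp: ip_def)
  moreover have "ip p (\<lambda>_. 1) = 0" unfolding p_def ip_add ip_scale using u ip_t_const by simp
  ultimately obtain k where k: "p k \<noteq> p a" using nonconst by metis
  define Lp where "Lp i = (\<Sum>j\<in>UNIV. W i j / M i * (p j - p i))" for i
  have Lp_eq: "Lp i = - \<rho> * \<kappa> * t i + \<nu> * u i" for i
  proof -
    have "M i * Lp i = - (\<rho> * (\<Sum>j\<in>UNIV. W i j * (t i - t j))) + (\<Sum>j\<in>UNIV. W i j * (u i - u j))"
      unfolding Lp_def sum_distrib_left sum_negf[symmetric] sum.distrib[symmetric]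
      by (rule sum.cong) (use M_pos[of i] in \<open>auto simp: p_def field_simps\<close>)
    also have "\<dots> = M i * (- \<rho> * \<kappa> * t i + \<nu> * u i)" unfolding eigen_t eig by (simp add: algebra_simps)
    finally show ?thesis using M_pos[of i] by simp
  qed
  \<comment> \<open>Vertices between \<open>a\<close> and \<open>b\<close> contribute nothing, because \<open>p\<close> is constant there.\<close>
  have term_nonneg: "(W b j / M b - W a j / M a) * (p j - p a) \<ge> 0" for j
  proof (cases "p j = p a")
    case False
    then consider "t j < t a" | "t b < t j"
      using p_mono'[of a j] p_mono'[of j b] pab by linarith
    then show ?thesis
    proof cases
      case 1
      then show ?thesis using W_mono(2)[OF 1 ab(1)] p_mono[OF 1] by (intro mult_nonpos_nonpos) auto
    next
      case 2
      then show ?thesis using W_mono(1)[OF ab(1) 2] p_mono[OF 2] pab by (intro mult_nonneg_nonneg) auto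
    qed
  qed simp
  moreover have "(W b k / M b - W a k / M a) * (p k - p a) > 0"
  proof -
    consider "t k < t a" | "t b < t k"
      using k p_mono'[of a k] p_mono'[of k b] pab by linarith
    then show ?thesis
    proof cases
      case 1
      then show ?thesis using W_mono(2)[OF 1 ab(1)] p_mono[OF 1] k by (intro mult_neg_neg) auto
    next
      case 2
      then show ?thesis using W_mono(1)[OF ab(1) 2] p_mono[OF 2] k pab by (intro mult_pos_pos) auto
    qed
  qed
  ultimately have "0 < (\<Sum>j\<in>UNIV. (W b j / M b - W a j / M a) * (p j - p a))"
    by (intro sum_pos2[of _ k]) auto
  also have "\<dots> = Lp b - Lp a"
    unfolding Lp_def by (simp add: sum_subtractf[symmetric] left_diff_distrib pab)
  also have "\<dots> = (\<nu> - \<kappa>) * (u b - u a)"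
  proof -
    have "u b - u a = \<rho> * (t b - t a)" using ab by simp
    then have "\<rho> * t b = \<rho> * t a + u b - u a" by (simp add: algebra_simps)
    then have "\<kappa> * (\<rho> * t b) = \<kappa> * (\<rho> * t a + u b - u a)" by simp
    then show ?thesis unfolding Lp_eq by (simp add: algebra_simps)
  qed
  finally have "0 < (\<nu> - \<kappa>) * (u b - u a)" .
  moreover have "u b - u a > 0" using ab \<rho> by (simp add: zero_less_divide_iff)
  ultimately show ?thesis by (simp add: zero_less_mult_iff)
qed

text \<open>A minimizer of \<open>dirichlet\<close> on the unit sphere of the orthogonal complement of \<open>1\<close> and \<open>t\<close> is an
  eigenvector, because that complement is invariant; so the bound on eigenvalues bounds the form.\<close>

lemma spectral_gap:
  assumes u: "u \<noteq> (\<lambda>_. 0)" "ip u (\<lambda>_. 1) = 0" "ip u t = 0"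
  shows "dirichlet u u > \<kappa> * ip u u"
proof -
  define S where "S = {x :: real^'n. ip (($) x) (\<lambda>_. 1) = 0 \<and> ip (($) x) t = 0 \<and> ip (($) x) (($) x) = 1}"
  have cont: "continuous_on T (\<lambda>x. ip (($) x) v)" "continuous_on T (\<lambda>x. ip (($) x) (($) x))"
    "continuous_on T (\<lambda>x. dirichlet (($) x) (($) x))" for v and T :: "(real^'n) set"
    unfolding ip_def dirichlet_def by (intro continuous_intros)+ simp_all
  have cl: "closed S"
    unfolding S_def
    by (intro closed_Collect_conj closed_Collect_eq cont continuous_on_const)
  have bd: "bounded S"
  proof -
    define mm where "mm = Min (range M)"
    have mm: "mm > 0" "\<And>i. mm \<le> M i" unfolding mm_def using M_pos by auto
    have "norm x \<le> sqrt (1 / mm)" if "x \<in> S" for x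
    proof -
      have "mm * (norm x)\<^sup>2 = (\<Sum>i\<in>UNIV. mm * (x $ i)\<^sup>2)"
        by (simp add: power2_norm_eq_inner inner_vec_def sum_distrib_left flip: power2_eq_square)
      also have "\<dots> \<le> (\<Sum>i\<in>UNIV. M i * (x $ i)\<^sup>2)"
        by (intro sum_mono mult_right_mono mm) auto
      also have "\<dots> = 1" using that by (simp add: S_def ip_def power2_eq_square mult.assoc)
      finally show ?thesis using mm by (intro real_le_rsqrt) (simp add: field_simps)
    qed
    then show ?thesis unfolding bounded_iff by blast
  qed
  have nz: "ip u u > 0" by (rule ip_pos[OF u(1)])
  define x1 where "x1 = (\<chi> i. (1 / sqrt (ip u u)) * u i)"
  have x1: "(($) x1) = (\<lambda>i. (1 / sqrt (ip u u)) * u i)" by (simp add: x1_def fun_eq_iff)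
  have ipx1: "ip (\<lambda>i. (1 / sqrt (ip u u)) * u i) (\<lambda>i. (1 / sqrt (ip u u)) * u i) = 1"
    unfolding ip_scale linear_right using nz by (simp add: divide_simps)
  have "x1 \<in> S" unfolding S_def mem_Collect_eq x1 ipx1 unfolding ip_scale using u by simp
  then have ne: "S \<noteq> {}" by auto
  have "compact S" using cl bd by (simp add: compact_eq_bounded_closed)
  from continuous_attains_inf[OF this ne cont(3)] obtain y where y: "y \<in> S"
    and ymin: "\<And>x. x \<in> S \<Longrightarrow> dirichlet (($) y) (($) y) \<le> dirichlet (($) x) (($) x)"
    by blast
  define v where "v = (($) y)"
  define \<nu> where "\<nu> = dirichlet v v"
  have v: "ip v (\<lambda>_. 1) = 0" "ip v t = 0" "ip v v = 1" using y by (simp_all add: S_def v_def)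
  have homog: "\<nu> * ip w w \<le> dirichlet w w" if w: "ip w (\<lambda>_. 1) = 0" "ip w t = 0" for w
  proof (cases "w = (\<lambda>_. 0)")
    case True
    then show ?thesis by (simp add: ip_def dirichlet_def)
  next
    case False
    then have wp: "ip w w > 0" by (rule ip_pos)
    define s where "s = 1 / sqrt (ip w w)"
    define x where "x = (\<chi> i. s * w i)"
    have x: "(($) x) = (\<lambda>i. s * w i)" by (simp add: x_def fun_eq_iff)
    have ss: "s * (s * ip w w) = 1" unfolding s_def using wp by (simp add: divide_simps)
    have "x \<in> S" unfolding S_def mem_Collect_eq x ip_scale linear_right using w ss by simp
    from ymin[OF this] have "\<nu> \<le> s * (s * dirichlet w w)"
      unfolding x dirichlet_scale linear_right by (simp add: \<nu>_def v_def)
    then have "\<nu> * ip w w \<le> s * (s * dirichlet w w) * ip w w" using wp by (intro mult_right_mono) auto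
    also have "\<dots> = dirichlet w w * (s * (s * ip w w))" by (simp only: mult_ac)
    also have "\<dots> = dirichlet w w" unfolding ss by simp
    finally show ?thesis .
  qed
  have polar: "dirichlet v w = \<nu> * ip v w" if w: "ip w (\<lambda>_. 1) = 0" "ip w t = 0" for w
  proof -
    define A where "A = dirichlet v w - \<nu> * ip v w"
    define C where "C = dirichlet w w - \<nu> * ip w w"
    have quad: "0 \<le> 2 * s * A + s\<^sup>2 * C" for s
    proof -
      have "ip (\<lambda>i. v i + s * w i) (\<lambda>_. 1) = 0" "ip (\<lambda>i. v i + s * w i) t = 0"
        unfolding ip_add ip_scale using v w by simp_all
      from homog[OF this] have "\<nu> * (ip v v + 2 * s * ip v w + s\<^sup>2 * ip w w)
          \<le> \<nu> + 2 * s * dirichlet v w + s\<^sup>2 * dirichlet w w"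
        unfolding linear_left linear_right
        by (simp add: ip_commute[of w v] dirichlet_commute[of w v] \<nu>_def algebra_simps power2_eq_square)
      then show ?thesis using v by (simp add: A_def C_def algebra_simps)
    qed
    have "A = 0"
    proof (rule ccontr)
      assume A: "A \<noteq> 0"
      \<comment> \<open>For this \<open>s\<close> the linear term of the quadratic polynomial outweighs the quadratic one.\<close>
      define s where "s = - A / (\<bar>C\<bar> + 1)"
      have "0 < A\<^sup>2 / (\<bar>C\<bar> + 1)" using A by (intro divide_pos_pos) auto
      then have "s * A < 0" by (simp add: s_def power2_eq_square)
      have "s\<^sup>2 * C \<le> s\<^sup>2 * (\<bar>C\<bar> + 1)" by (intro mult_left_mono) auto
      also have "\<dots> = s * (s * (\<bar>C\<bar> + 1))" by (simp only: power2_eq_square mult.assoc)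
      also have "s * (\<bar>C\<bar> + 1) = - A" by (simp add: s_def)
      finally show False using quad[of s] \<open>s * A < 0\<close> by simp
    qed
    then show ?thesis by (simp add: A_def)
  qed
  have tt: "ip t t > 0 \<or> t = (\<lambda>_. 0)" using ip_pos by blast
  have one: "ip (\<lambda>_. 1) (\<lambda>_. 1) > 0" by (rule ip_pos) (auto simp: fun_eq_iff)
  have full: "dirichlet v w = \<nu> * ip v w" for w
  proof -
    define a where "a = - ip w (\<lambda>_. 1) / ip (\<lambda>_. 1) (\<lambda>_. 1)"
    define b where "b = - ip w t / ip t t"
    define w' where "w' = (\<lambda>i. w i + (a * 1 + b * t i))"
    have 1: "ip w' (\<lambda>_. 1) = 0"
      unfolding w'_def linear_left using ip_t_const one by (simp add: a_def)
    have 2: "ip w' t = 0"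
    proof -
      have "ip t t = 0 \<Longrightarrow> ip w t = 0" using tt by (auto simp: ip_def)
      then show ?thesis
        unfolding w'_def linear_left using ip_t_const by (simp add: b_def ip_commute[of "\<lambda>_. 1" t])
    qed
    have 3: "dirichlet v w' = dirichlet v w"
      unfolding w'_def linear_right
      using dirichlet_const[of 1 v] dirichlet_t[of v] v(2)
      by (simp add: ip_commute[of t v] dirichlet_commute[of v t] dirichlet_commute[of v "\<lambda>_. 1"])
    have 4: "ip v w' = ip v w"
      unfolding w'_def linear_right using v(1,2) by simp
    show ?thesis using polar[OF 1 2] 3 4 by simp
  qed
  have "(\<Sum>j\<in>UNIV. W i j * (v i - v j)) = \<nu> * M i * v i" for i
    using full[of "\<lambda>k. if k = i then 1 else 0"]
    unfolding dirichlet_by_parts ip_def by (simp add: if_distrib if_distribR mult_ac cong: if_cong)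
  moreover have "v \<noteq> (\<lambda>_. 0)" using v(3) by (auto simp: ip_def)
  ultimately have "\<nu> > \<kappa>" using eigenvalue_gt[of v \<nu>] v by blast
  then show ?thesis using homog[OF u(2,3)] nz by (smt (verit, best) mult_strict_right_mono)
qed

end

section \<open>Curves of class C2\<close>

lemma has_vector_derivative_vec:
  fixes f :: "real \<Rightarrow> 'a::real_normed_vector^'n::finite"
  assumes "\<And>i. ((\<lambda>t. f t $ i) has_vector_derivative f' $ i) (at x)"
  shows "(f has_vector_derivative f') (at x)"
  unfolding has_vector_derivative_def has_derivative_within
proof (intro conjI bounded_linear_scaleR_left vec_tendstoI)
  fix i
  show "((\<lambda>y. ((1 / norm (y - x)) *\<^sub>R (f y - (f x + (y - x) *\<^sub>R f'))) $ i) \<longlongrightarrow> (0 :: 'a^'n) $ i) (at x)"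
    using assms[of i] unfolding has_vector_derivative_def has_derivative_within by simp
qed

lemma has_vector_derivative_vec_nth:
  "(f has_vector_derivative f') F \<Longrightarrow> ((\<lambda>t. f t $ i) has_vector_derivative f' $ i) F"
  by (rule bounded_linear.has_vector_derivative[OF bounded_linear_vec_nth])

lemma has_real_derivative_inner:
  "(f has_vector_derivative f') (at x) \<Longrightarrow> (g has_vector_derivative g') (at x)
    \<Longrightarrow> ((\<lambda>t. f t \<bullet> g t) has_real_derivative (f x \<bullet> g' + f' \<bullet> g x)) (at x)"
  unfolding has_real_derivative_iff_has_vector_derivative
  by (rule bounded_bilinear.has_vector_derivative[OF bounded_bilinear_inner])

lemma C2_curve_in_isCont: "C2_curve_in M p v g \<Longrightarrow> isCont g 0"
  unfolding C2_curve_in_def using has_vector_derivative_continuous by fastforce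

lemma C2_curve_inI:
  assumes "e > 0" "g 0 = p" "g' 0 = v" "continuous_on {-e<..<e} g''"
    and "\<And>t. t \<in> {-e<..<e} \<Longrightarrow> g t \<in> M"
    and "\<And>t. t \<in> {-e<..<e} \<Longrightarrow> (g has_vector_derivative g' t) (at t)"
    and "\<And>t. t \<in> {-e<..<e} \<Longrightarrow> (g' has_vector_derivative g'' t) (at t)"
  shows "C2_curve_in M p v g"
  unfolding C2_curve_in_def using assms by blast

text \<open>Curves are built coordinate by coordinate from polynomials, products and square roots without
  regard to the constraint set; membership near 0 is added at the end.\<close>

lemma C2_curve_in_eventually:
  assumes g: "C2_curve_in UNIV p v g" and M: "eventually (\<lambda>t. g t \<in> M) (nhds 0)"
  shows "C2_curve_in M p v g"
proof -
  from g obtain e g' g'' where e: "e > 0" "g 0 = p" "g' 0 = v" "continuous_on {-e<..<e} g''"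
    "\<forall>t\<in>{-e<..<e}. (g has_vector_derivative g' t) (at t) \<and> (g' has_vector_derivative g'' t) (at t)"
    unfolding C2_curve_in_def by auto
  from M obtain d where d: "d > 0" "\<And>t. \<bar>t\<bar> < d \<Longrightarrow> g t \<in> M"
    unfolding eventually_nhds_metric by (auto simp: dist_real_def)
  have "{- min e d<..<min e d} \<subseteq> {-e<..<e}" by auto
  then have "continuous_on {- min e d<..<min e d} g''" using e(4) continuous_on_subset by blast
  then show ?thesis
    by (rule C2_curve_inI[of "min e d" _ _ g', rotated 3]) (use e d in \<open>auto simp: abs_less_iff\<close>)
qed

lemma C2_curve_in_vec:
  fixes g :: "real \<Rightarrow> 'a::real_normed_vector^'n::finite"
  assumes "\<And>i. C2_curve_in UNIV (p $ i) (v $ i) (\<lambda>t. g t $ i)"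
  shows "C2_curve_in UNIV p v g"
proof -
  have "\<forall>i. \<exists>e g' g''. e > 0 \<and> g 0 $ i = p $ i \<and> g' 0 = v $ i \<and> continuous_on {-e<..<e} g'' \<and>
      (\<forall>t\<in>{-e<..<e}. ((\<lambda>t. g t $ i) has_vector_derivative g' t) (at t) \<and> (g' has_vector_derivative g'' t) (at t))"
    using assms unfolding C2_curve_in_def by blast
  then obtain e g' g'' where e: "\<And>i. e i > 0" "\<And>i. g 0 $ i = p $ i" "\<And>i. g' i 0 = v $ i"
    "\<And>i. continuous_on {-e i<..<e i} (g'' i)"
    "\<And>i t. t \<in> {-e i<..<e i} \<Longrightarrow> ((\<lambda>t. g t $ i) has_vector_derivative g' i t) (at t)"
    "\<And>i t. t \<in> {-e i<..<e i} \<Longrightarrow> (g' i has_vector_derivative g'' i t) (at t)"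
    by metis
  define d where "d = Min (range e)"
  have d: "d > 0" "\<And>i. d \<le> e i" unfolding d_def using e(1) by auto
  have sub: "{-d<..<d} \<subseteq> {-e i<..<e i}" for i using d(2)[of i] by auto
  show ?thesis
  proof (rule C2_curve_inI[of d _ _ "\<lambda>t. \<chi> i. g' i t" _ "\<lambda>t. \<chi> i. g'' i t"])
    show "continuous_on {-d<..<d} (\<lambda>t. \<chi> i. g'' i t)"
      using e(4) sub by (intro continuous_intros) (blast intro: continuous_on_subset)
    fix t assume "t \<in> {-d<..<d}"
    then have t: "t \<in> {-e i<..<e i}" for i using sub by blast
    show "(g has_vector_derivative (\<chi> i. g' i t)) (at t)"
      by (rule has_vector_derivative_vec) (simp add: e(5)[OF t])
    show "((\<lambda>t. \<chi> i. g' i t) has_vector_derivative (\<chi> i. g'' i t)) (at t)"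
      by (rule has_vector_derivative_vec) (simp add: e(6)[OF t])
  qed (use d e in \<open>simp_all add: vec_eq_iff\<close>)
qed

lemma C2_curve_in_polynomial: "C2_curve_in UNIV a b (\<lambda>t. a + t * b + t\<^sup>2 * c)" for a b c :: real
  by (rule C2_curve_inI[of 1 _ _ "\<lambda>t. b + 2 * t * c" _ "\<lambda>t. 2 * c"])
     (auto intro!: derivative_eq_intros simp: has_real_derivative_iff_has_vector_derivative[symmetric])

lemma C2_curve_in_linear: "C2_curve_in UNIV a b (\<lambda>t. a + t * b)" for a b :: real
  using C2_curve_in_polynomial[of a b 0] by simp

lemma C2_curve_in_mult:
  fixes f g :: "real \<Rightarrow> real"
  assumes f: "C2_curve_in UNIV p v f" and g: "C2_curve_in UNIV q w g"
  shows "C2_curve_in UNIV (p * q) (p * w + v * q) (\<lambda>t. f t * g t)"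
proof -
  from f obtain d f' f'' where d: "d > 0" "f 0 = p" "f' 0 = v" "continuous_on {-d<..<d} f''"
    "\<And>t. t \<in> {-d<..<d} \<Longrightarrow> (f has_vector_derivative f' t) (at t) \<and> (f' has_vector_derivative f'' t) (at t)"
    unfolding C2_curve_in_def by auto
  from g obtain e g' g'' where e: "e > 0" "g 0 = q" "g' 0 = w" "continuous_on {-e<..<e} g''"
    "\<And>t. t \<in> {-e<..<e} \<Longrightarrow> (g has_vector_derivative g' t) (at t) \<and> (g' has_vector_derivative g'' t) (at t)"
    unfolding C2_curve_in_def by auto
  define c where "c = min d e"
  have sub: "{-c<..<c} \<subseteq> {-d<..<d}" "{-c<..<c} \<subseteq> {-e<..<e}" by (auto simp: c_def)
  have cf: "continuous_on {-c<..<c} f''" "continuous_on {-c<..<c} g''"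
    using d(4) e(4) sub by (blast intro: continuous_on_subset)+
  have D: "(f has_vector_derivative f' t) (at t)" "(f' has_vector_derivative f'' t) (at t)"
    "(g has_vector_derivative g' t) (at t)" "(g' has_vector_derivative g'' t) (at t)"
    if "t \<in> {-c<..<c}" for t using d(5) e(5) sub that by blast+
  have cc: "continuous_on {-c<..<c} h" if "\<And>t. t \<in> {-c<..<c} \<Longrightarrow> (h has_vector_derivative h' t) (at t)"
    for h h' :: "real \<Rightarrow> real"
    using that has_vector_derivative_continuous continuous_at_imp_continuous_on by blast
  show ?thesis
  proof (rule C2_curve_inI[of c _ _ "\<lambda>t. f t * g' t + f' t * g t" _
      "\<lambda>t. (f t * g'' t + f' t * g' t) + (f' t * g' t + f'' t * g t)"])
    show "continuous_on {-c<..<c} (\<lambda>t. (f t * g'' t + f' t * g' t) + (f' t * g' t + f'' t * g t))"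
      by (intro continuous_intros cf cc[OF D(1)] cc[OF D(2)] cc[OF D(3)] cc[OF D(4)])
    fix t assume t: "t \<in> {-c<..<c}"
    show "((\<lambda>t. f t * g t) has_vector_derivative f t * g' t + f' t * g t) (at t)"
      by (intro has_vector_derivative_mult D t)
    show "((\<lambda>t. f t * g' t + f' t * g t) has_vector_derivative
        (f t * g'' t + f' t * g' t) + (f' t * g' t + f'' t * g t)) (at t)"
      by (intro has_vector_derivative_add has_vector_derivative_mult D t)
  qed (use d e in \<open>auto simp: c_def\<close>)
qed

lemma C2_curve_in_compose:
  fixes f h :: "real \<Rightarrow> real"
  assumes f: "C2_curve_in UNIV p v f" and S: "open S" "p \<in> S"
    and h: "\<And>y. y \<in> S \<Longrightarrow> (h has_real_derivative h' y) (at y)"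
      "\<And>y. y \<in> S \<Longrightarrow> (h' has_real_derivative h'' y) (at y)" "continuous_on S h''"
  shows "C2_curve_in UNIV (h p) (h' p * v) (\<lambda>t. h (f t))"
proof -
  from f obtain d f' f'' where d: "d > 0" "f 0 = p" "f' 0 = v" "continuous_on {-d<..<d} f''"
    "\<And>t. t \<in> {-d<..<d} \<Longrightarrow> (f has_real_derivative f' t) (at t) \<and> (f' has_real_derivative f'' t) (at t)"
    unfolding C2_curve_in_def has_real_derivative_iff_has_vector_derivative by auto
  have "(f \<longlongrightarrow> f 0) (nhds 0)"
    using C2_curve_in_isCont[OF f] by (metis isCont_def tendsto_at_iff_tendsto_nhds)
  then have "eventually (\<lambda>t. f t \<in> S) (nhds 0)" using topological_tendstoD S d(2) by blast
  then obtain e where e: "e > 0" "\<And>t. \<bar>t\<bar> < e \<Longrightarrow> f t \<in> S"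
    unfolding eventually_nhds_metric by (auto simp: dist_real_def)
  define c where "c = min d e"
  have sub: "{-c<..<c} \<subseteq> {-d<..<d}" by (auto simp: c_def)
  have fS: "f t \<in> S" if "t \<in> {-c<..<c}" for t using e(2)[of t] that by (auto simp: c_def)
  have D: "(f has_real_derivative f' t) (at t)" "(f' has_real_derivative f'' t) (at t)"
    if "t \<in> {-c<..<c}" for t using d(5) sub that by blast+
  have cc: "continuous_on {-c<..<c} k" if "\<And>t. t \<in> {-c<..<c} \<Longrightarrow> (k has_real_derivative k' t) (at t)"
    for k k' :: "real \<Rightarrow> real"
    using that DERIV_isCont continuous_at_imp_continuous_on by blast
  have ch: "continuous_on {-c<..<c} (\<lambda>t. h'' (f t))"
    by (rule continuous_on_compose2[OF h(3) cc[OF D(1)]]) (use fS in auto)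
  have ch': "continuous_on {-c<..<c} (\<lambda>t. h' (f t))"
    by (rule cc) (use DERIV_chain2[OF h(2)[OF fS] D(1)] in blast)
  have cf: "continuous_on {-c<..<c} f''" using d(4) sub continuous_on_subset by blast
  show ?thesis
  proof (rule C2_curve_inI[of c _ _ "\<lambda>t. h' (f t) * f' t" _
      "\<lambda>t. h'' (f t) * f' t * f' t + f'' t * h' (f t)"],
      unfold has_real_derivative_iff_has_vector_derivative[symmetric])
    show "continuous_on {-c<..<c} (\<lambda>t. h'' (f t) * f' t * f' t + f'' t * h' (f t))"
      by (intro continuous_intros cf ch ch' cc[OF D(2)])
    fix t assume t: "t \<in> {-c<..<c}"
    show "((\<lambda>t. h (f t)) has_real_derivative h' (f t) * f' t) (at t)"
      by (rule DERIV_chain2[OF h(1)[OF fS[OF t]] D(1)[OF t]])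
    show "((\<lambda>t. h' (f t) * f' t) has_real_derivative h'' (f t) * f' t * f' t + f'' t * h' (f t)) (at t)"
      by (rule DERIV_mult[OF DERIV_chain2[OF h(2)[OF fS[OF t]] D(1)[OF t]] D(2)[OF t]])
  qed (use d e in \<open>auto simp: c_def\<close>)
qed

lemma C2_curve_in_inverse:
  fixes f :: "real \<Rightarrow> real"
  assumes f: "C2_curve_in UNIV p v f" and p: "p \<noteq> 0"
  shows "C2_curve_in UNIV (1 / p) (- v / p\<^sup>2) (\<lambda>t. 1 / f t)"
proof -
  have "C2_curve_in UNIV (1 / p) ((- 1 / p\<^sup>2) * v) (\<lambda>t. 1 / f t)"
  proof (rule C2_curve_in_compose[OF f, of "- {0}" _ _ "\<lambda>y. 2 / y ^ 3"])
    show "continuous_on (- {0}) (\<lambda>y. 2 / y ^ 3 :: real)" by (intro continuous_intros) auto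
  next
    fix y :: real assume "y \<in> - {0}"
    then have y: "y \<noteq> 0" by simp
    show "((\<lambda>y. 1 / y) has_real_derivative - 1 / y\<^sup>2) (at y)"
      using DERIV_divide[OF DERIV_const DERIV_ident y, of 1] by (simp add: power2_eq_square)
    have "((\<lambda>y. y\<^sup>2) has_real_derivative 2 * y) (at y)" by (auto intro!: derivative_eq_intros)
    from DERIV_divide[OF DERIV_const this, of "- 1"] y
    show "((\<lambda>y. - 1 / y\<^sup>2) has_real_derivative 2 / y ^ 3) (at y)"
      by (simp add: power2_eq_square power3_eq_cube mult.assoc)
  qed (use p in auto)
  then show ?thesis by simp
qed

lemma DERIV_sqrt: "y > 0 \<Longrightarrow> (sqrt has_real_derivative 1 / (2 * sqrt y)) (at y)"
  using DERIV_real_sqrt[of y] by (simp add: field_simps)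

lemma C2_curve_in_sqrt:
  fixes f :: "real \<Rightarrow> real"
  assumes f: "C2_curve_in UNIV p v f" and p: "p > 0"
  shows "C2_curve_in UNIV (sqrt p) (v / (2 * sqrt p)) (\<lambda>t. sqrt (f t))"
proof -
  have "C2_curve_in UNIV (sqrt p) (1 / (2 * sqrt p) * v) (\<lambda>t. sqrt (f t))"
  proof (rule C2_curve_in_compose[OF f, of "{0<..}" _ _ "\<lambda>y. - (1 / sqrt y) / (2 * sqrt y)\<^sup>2"])
    show "continuous_on {0<..} (\<lambda>y. - (1 / sqrt y) / (2 * sqrt y)\<^sup>2)" by (intro continuous_intros) auto
  next
    fix y :: real assume "y \<in> {0<..}"
    then have y: "y > 0" by simp
    show "(sqrt has_real_derivative 1 / (2 * sqrt y)) (at y)" by (rule DERIV_sqrt[OF y])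
    have "((\<lambda>y. 2 * sqrt y) has_real_derivative 1 / sqrt y) (at y)"
      using DERIV_cmult[OF DERIV_sqrt[OF y], of 2] by simp
    from DERIV_divide[OF DERIV_const this, of 1] y
    show "((\<lambda>y. 1 / (2 * sqrt y)) has_real_derivative - (1 / sqrt y) / (2 * sqrt y)\<^sup>2) (at y)"
      by (simp add: power2_eq_square)
  qed (use p in auto)
  then show ?thesis by simp
qed

text \<open>The factor that rescales a straight line \<open>p + t x\<close> to constant norm, when \<open>x\<close> is orthogonal to \<open>p\<close>.
  Its velocity at 0 vanishes, so the rescaling does not change the initial velocity.\<close>

lemma C2_curve_in_inv_sqrt:
  "C2_curve_in UNIV 1 0 (\<lambda>t. 1 / sqrt (1 + t\<^sup>2 * k))"
  using C2_curve_in_inverse[OF C2_curve_in_sqrt[OF C2_curve_in_polynomial[of 1 0 k]]] by simp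

section \<open>The potential on the sphere and its critical points\<close>

lemma DERIV_inverse_cube:
  fixes f :: "real \<Rightarrow> real"
  assumes f: "(f has_real_derivative D) (at x)" and nz: "f x \<noteq> 0"
  shows "((\<lambda>t. 1 / f t ^ 3) has_real_derivative - 3 * D / f x ^ 4) (at x)"
proof -
  have "((\<lambda>t. f t ^ 3) has_real_derivative 3 * f x ^ 2 * D) (at x)"
    using DERIV_power[OF f, of 3] by (simp add: mult_ac)
  from DERIV_divide[OF DERIV_const[of 1] this] nz
  have "((\<lambda>t. 1 / f t ^ 3) has_real_derivative - (3 * f x ^ 2 * D) / (f x ^ 3 * f x ^ 3)) (at x)"
    by simp
  moreover have "- (3 * f x ^ 2 * D) / (f x ^ 3 * f x ^ 3) = - 3 * D / f x ^ 4"
    using nz by (simp add: divide_simps eval_nat_numeral)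
  ultimately show ?thesis by simp
qed

abbreviation regular_configs :: "'n::{finite,linorder} config set" where
  "regular_configs \<equiv> sphere_configs - singular_configs"

lemma singular_configs_closed: "closed (singular_configs :: 'n::{finite,linorder} config set)"
proof -
  have "singular_configs = (\<Union>(i, j)\<in>{(i::'n, j). i < j}. {q. q $ i = q $ j} \<union> {q. q $ i = - q $ j})"
    by (auto simp: singular_configs_def)
  moreover have "closed \<dots>"
  proof (rule closed_UN)
    show "\<forall>x\<in>{(i::'n, j). i < j}. closed (case x of (i, j) \<Rightarrow> {q :: 'n config. q $ i = q $ j} \<union> {q. q $ i = - q $ j})"
      by (auto intro!: closed_Un closed_Collect_eq continuous_intros)
  qed simp
  ultimately show ?thesis by simp
qed

lemma eventually_not_singular:
  assumes "isCont g 0" "g 0 \<notin> singular_configs"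
  shows "eventually (\<lambda>t::real. g t \<notin> (singular_configs :: 'n::{finite,linorder} config set)) (nhds 0)"
proof -
  have "(g \<longlongrightarrow> g 0) (nhds 0)"
    using assms(1) by (metis isCont_def tendsto_at_iff_tendsto_nhds)
  from topological_tendstoD[OF this, of "- singular_configs"] show ?thesis
    using singular_configs_closed assms(2) by (auto simp: open_Compl)
qed

text \<open>On the sphere \<open>U1\<close> depends on the inner products \<open>q $ i \<bullet> q $ j\<close> only. At \<open>s = 1\<close> the two derivatives
  have the value 0 (division by 0), so that sums may run over all pairs of indices, equal ones included.\<close>

definition cot_arccos :: "real \<Rightarrow> real" where "cot_arccos s = s / sqrt (1 - s\<^sup>2)"
definition cot_arccos' :: "real \<Rightarrow> real" where "cot_arccos' s = 1 / sqrt (1 - s\<^sup>2) ^ 3"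
definition cot_arccos'' :: "real \<Rightarrow> real" where "cot_arccos'' s = 3 * s / sqrt (1 - s\<^sup>2) ^ 5"

lemma cot_arccos: "\<bar>s\<bar> \<le> 1 \<Longrightarrow> cot (arccos s) = cot_arccos s"
  by (simp add: cot_def cot_arccos_def sin_arccos_abs cos_arccos_abs)

lemma cot_arccos_derivs:
  assumes "\<bar>s\<bar> < 1"
  shows "(cot_arccos has_real_derivative cot_arccos' s) (at s)"
    "(cot_arccos' has_real_derivative cot_arccos'' s) (at s)"
proof -
  have p: "1 - s\<^sup>2 > 0" using assms by (simp add: abs_square_less_1)
  define r where "r = sqrt (1 - s\<^sup>2)"
  have r: "r > 0" "s\<^sup>2 = 1 - r\<^sup>2" using p by (simp_all add: r_def)
  have dr: "((\<lambda>s. sqrt (1 - s\<^sup>2)) has_real_derivative - s / r) (at s)"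
  proof -
    have "((\<lambda>s. 1 - s\<^sup>2) has_real_derivative - 2 * s) (at s)"
      by (auto intro!: derivative_eq_intros)
    from DERIV_chain2[OF DERIV_real_sqrt[OF p] this] show ?thesis by (simp add: r_def divide_simps)
  qed
  have "((\<lambda>s. s / sqrt (1 - s\<^sup>2)) has_real_derivative (1 * r - s * (- s / r)) / (r * r)) (at s)"
    using DERIV_divide[OF DERIV_ident dr] r(1) unfolding r_def by simp
  moreover have "(1 * r - s * (- s / r)) / (r * r) = 1 / r ^ 3"
    using r by (simp add: field_simps eval_nat_numeral)
  ultimately show "(cot_arccos has_real_derivative cot_arccos' s) (at s)"
    unfolding cot_arccos_def cot_arccos'_def r_def by simp
  show "(cot_arccos' has_real_derivative cot_arccos'' s) (at s)"
    unfolding cot_arccos'_def cot_arccos''_def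
    using DERIV_inverse_cube[OF dr] r(1) unfolding r_def[symmetric]
    by (simp add: eval_nat_numeral)
qed

lemma sum_pairs:
  fixes f :: "'n::{finite,linorder} \<Rightarrow> 'n \<Rightarrow> real"
  assumes "\<And>i j. f i j = f j i" "\<And>i. f i i = 0"
  shows "(\<Sum>(i, j)\<in>{(i, j). i < j}. f i j) = (\<Sum>i\<in>UNIV. \<Sum>j\<in>UNIV. f i j) / 2"
proof -
  have "(\<Sum>i\<in>UNIV. \<Sum>j\<in>UNIV. f i j) = (\<Sum>(i, j)\<in>UNIV. f i j)"
    by (simp add: sum.cartesian_product)
  also have "UNIV = {(i::'n, j). i < j} \<union> {(i, j). j < i} \<union> {(i, j). i = j}" by auto
  also have "(\<Sum>(i, j)\<in>\<dots>. f i j) = (\<Sum>(i, j)\<in>{(i, j). i < j}. f i j)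
      + (\<Sum>(i, j)\<in>{(i, j). j < i}. f i j) + (\<Sum>(i, j)\<in>{(i, j). i = j}. f i j)"
    by (subst sum.union_disjoint, simp, simp, force)+ simp
  also have "(\<Sum>(i, j)\<in>{(i, j). i = j}. f i j) = 0" by (rule sum.neutral) (use assms in auto)
  also have "(\<Sum>(i, j)\<in>{(i, j). j < i}. f i j) = (\<Sum>(i, j)\<in>{(i, j). i < j}. f i j)"
    by (rule sum.reindex_bij_witness[of _ prod.swap prod.swap]) (use assms in auto)
  finally show ?thesis by simp
qed

lemma inner_abs_less_1:
  fixes p r :: "'a::real_inner"
  assumes "p \<in> sphere 0 1" "r \<in> sphere 0 1" "p \<noteq> r" "p \<noteq> - r"
  shows "\<bar>p \<bullet> r\<bar> < 1"
proof -
  have n: "p \<bullet> p = 1" "r \<bullet> r = 1" using assms by (simp_all add: dot_square_norm)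
  have "(p - r) \<bullet> (p - r) > 0" "(p + r) \<bullet> (p + r) > 0"
    using assms by (auto simp: eq_neg_iff_add_eq_0)
  then show ?thesis using n by (simp add: inner_diff inner_add inner_commute)
qed

lemma nonsingular_inner:
  assumes "q \<in> regular_configs" "i \<noteq> j"
  shows "\<bar>q $ i \<bullet> q $ j\<bar> < 1"
proof -
  have "q $ i \<noteq> q $ j \<and> q $ i \<noteq> - q $ j" 
    using assms unfolding singular_configs_def
    by (cases i j rule: linorder_cases) (auto, (metis minus_equation_iff)+)
  then show ?thesis using assms by (intro inner_abs_less_1) (auto simp: sphere_configs_def)
qed

lemma U1_eq:
  assumes "q \<in> sphere_configs"
  shows "U1 m q = (\<Sum>(i, j)\<in>{(i, j). i < j}. m i * m j * cot_arccos (q $ i \<bullet> q $ j))"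
proof -
  have "cot (arccos (q $ i \<bullet> q $ j)) = cot_arccos (q $ i \<bullet> q $ j)" for i j
    using Cauchy_Schwarz_ineq2[of "q $ i" "q $ j"] assms
    by (intro cot_arccos) (auto simp: sphere_configs_def)
  then show ?thesis by (simp add: U1_def sdist_def)
qed

text \<open>The first two derivatives of \<open>U1\<close> along a curve, as forms in the velocity \<open>x\<close>; \<open>dI\<close> is the first
  derivative of \<open>I1\<close>, written as the sum of the \<open>m i * (1 - z\<^sup>2)\<close>, which equals \<open>I1\<close> on the sphere.\<close>

definition dU :: "('n::{finite,linorder} \<Rightarrow> real) \<Rightarrow> 'n config \<Rightarrow> 'n config \<Rightarrow> real" where
  "dU m q x = (\<Sum>i\<in>UNIV. \<Sum>j\<in>UNIV. m i * m j * cot_arccos' (q $ i \<bullet> q $ j) * (x $ i \<bullet> q $ j))"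

definition d2U :: "('n::{finite,linorder} \<Rightarrow> real) \<Rightarrow> 'n config \<Rightarrow> 'n config \<Rightarrow> real" where
  "d2U m q x = (\<Sum>i\<in>UNIV. \<Sum>j\<in>UNIV. m i * m j *
     (cot_arccos'' (q $ i \<bullet> q $ j) * (x $ i \<bullet> q $ j + q $ i \<bullet> x $ j)\<^sup>2
      + 2 * cot_arccos' (q $ i \<bullet> q $ j) * (x $ i \<bullet> x $ j))) / 2"

definition dI :: "('n::finite \<Rightarrow> real) \<Rightarrow> 'n config \<Rightarrow> 'n config \<Rightarrow> real" where
  "dI m q x = - 2 * (\<Sum>i\<in>UNIV. m i * q $ i $ 3 * x $ i $ 3)"

lemma cot_arccos'_1 [simp]: "cot_arccos' 1 = 0" "cot_arccos'' 1 = 0"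
  by (simp_all add: cot_arccos'_def cot_arccos''_def)

lemma sphere_configs_inner_self: "q \<in> sphere_configs \<Longrightarrow> q $ i \<bullet> q $ i = 1"
  by (simp add: sphere_configs_def dot_square_norm)

lemma dU_pairs:
  assumes "q \<in> sphere_configs"
  shows "dU m q x = (\<Sum>(i, j)\<in>{(i, j). i < j}. m i * m j * (cot_arccos' (q $ i \<bullet> q $ j) * (q $ i \<bullet> x $ j + x $ i \<bullet> q $ j)))"
proof -
  let ?f = "\<lambda>i j. m i * m j * (cot_arccos' (q $ i \<bullet> q $ j) * (q $ i \<bullet> x $ j + x $ i \<bullet> q $ j))"
    and ?g = "\<lambda>i j. m i * m j * cot_arccos' (q $ i \<bullet> q $ j) * (q $ i \<bullet> x $ j)"
  have "(\<Sum>(i, j)\<in>{(i, j). i < j}. ?f i j)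
    = (\<Sum>i\<in>UNIV. \<Sum>j\<in>UNIV. ?f i j) / 2"
    by (rule sum_pairs) (use sphere_configs_inner_self[OF assms] in \<open>auto simp: inner_commute mult_ac\<close>)
  also have "(\<Sum>i\<in>UNIV. \<Sum>j\<in>UNIV. ?f i j)
    = dU m q x + (\<Sum>i\<in>UNIV. \<Sum>j\<in>UNIV. ?g i j)"
    unfolding dU_def by (simp add: sum.distrib[symmetric] algebra_simps)
  also have "(\<Sum>i\<in>UNIV. \<Sum>j\<in>UNIV. ?g i j) = dU m q x"
    unfolding dU_def by (subst sum.swap) (simp add: inner_commute mult_ac)
  finally show ?thesis by simp
qed

lemma U1_has_derivative:
  assumes g: "(g has_vector_derivative v) (at t)"
    and ev: "eventually (\<lambda>s. g s \<in> regular_configs) (nhds t)"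
  shows "((\<lambda>s. U1 m (g s)) has_real_derivative dU m (g t) v) (at t)"
proof -
  have gt: "g t \<in> regular_configs" using ev by (rule eventually_nhds_x_imp_x)
  have pair: "((\<lambda>s. cot_arccos (g s $ i \<bullet> g s $ j)) has_real_derivative
        cot_arccos' (g t $ i \<bullet> g t $ j) * (g t $ i \<bullet> v $ j + v $ i \<bullet> g t $ j)) (at t)" if "i < j" for i j
    by (rule DERIV_chain2[OF cot_arccos_derivs(1) has_real_derivative_inner])
       (use that nonsingular_inner[OF gt, of i j] g in \<open>auto intro: has_vector_derivative_vec_nth\<close>)
  have "((\<lambda>s. \<Sum>(i, j)\<in>{(i, j). i < j}. m i * m j * cot_arccos (g s $ i \<bullet> g s $ j)) has_real_derivative
      dU m (g t) v) (at t)"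
    unfolding dU_pairs[OF DiffD1[OF gt]] split_beta
    by (intro DERIV_sum DERIV_cmult pair) auto
  moreover have "eventually (\<lambda>s. U1 m (g s) = (\<Sum>(i, j)\<in>{(i, j). i < j}. m i * m j * cot_arccos (g s $ i \<bullet> g s $ j))) (nhds t)"
    using ev by eventually_elim (simp add: U1_eq)
  ultimately show ?thesis by (subst DERIV_cong_ev[OF refl _ refl])
qed

lemma dU_has_derivative:
  assumes g: "\<And>s. \<bar>s - t\<bar> < e \<Longrightarrow> (g has_vector_derivative v s) (at s)" and v: "(v has_vector_derivative a) (at t)"
    and e: "e > 0"
    and ev: "\<And>s. \<bar>s - t\<bar> < e \<Longrightarrow> g s \<in> regular_configs"
  shows "((\<lambda>s. dU m (g s) (v s)) has_real_derivative d2U m (g t) (v t) + dU m (g t) a) (at t)"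
proof -
  have gt: "g t \<in> regular_configs" and gt1: "g t \<in> sphere_configs" and dg: "(g has_vector_derivative v t) (at t)"
    using ev[of t] g[of t] e by auto
  let ?s = "\<lambda>i j. g t $ i \<bullet> g t $ j"
  let ?D = "\<lambda>i j. cot_arccos' (?s i j) * ((g t $ i \<bullet> a $ j + v t $ i \<bullet> v t $ j) + (v t $ i \<bullet> v t $ j + a $ i \<bullet> g t $ j))
     + cot_arccos'' (?s i j) * (g t $ i \<bullet> v t $ j + v t $ i \<bullet> g t $ j) * (g t $ i \<bullet> v t $ j + v t $ i \<bullet> g t $ j)"
  let ?Q = "\<lambda>i j. m i * m j * (cot_arccos'' (?s i j) * (v t $ i \<bullet> g t $ j + g t $ i \<bullet> v t $ j)\<^sup>2
      + 2 * cot_arccos' (?s i j) * (v t $ i \<bullet> v t $ j))"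
    and ?d = "\<lambda>s i j. cot_arccos' (g s $ i \<bullet> g s $ j) * (g s $ i \<bullet> v s $ j + v s $ i \<bullet> g s $ j)"
  have pair: "((\<lambda>s. ?d s i j) has_real_derivative
        ?D i j) (at t)" if "i < j" for i j
    by (rule DERIV_cong[OF DERIV_mult[OF DERIV_chain2[OF cot_arccos_derivs(2) has_real_derivative_inner] DERIV_add[OF has_real_derivative_inner has_real_derivative_inner]]])
       (use that nonsingular_inner[OF gt, of i j] dg v in \<open>auto intro!: has_vector_derivative_vec_nth simp: algebra_simps\<close>)
  have "((\<lambda>s. \<Sum>(i, j)\<in>{(i, j). i < j}. m i * m j * (?d s i j)) has_real_derivative
      (\<Sum>(i, j)\<in>{(i, j). i < j}. m i * m j * ?D i j)) (at t)"
    unfolding split_beta by (intro DERIV_sum DERIV_cmult pair) auto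
  moreover have "eventually (\<lambda>s. dU m (g s) (v s) = (\<Sum>(i, j)\<in>{(i, j). i < j}. m i * m j * (?d s i j))) (nhds t)"
    unfolding eventually_nhds_metric using e ev by (auto simp: dist_real_def dU_pairs intro!: exI[of _ e])
  moreover have "(\<Sum>(i, j)\<in>{(i, j). i < j}. m i * m j * ?D i j) = d2U m (g t) (v t) + dU m (g t) a"
  proof -
    have "(\<Sum>(i, j)\<in>{(i, j). i < j}. m i * m j * ?D i j)
      = (\<Sum>(i, j)\<in>{(i, j). i < j}. ?Q i j) + dU m (g t) a"
      unfolding dU_pairs[OF gt1] sum.distrib[symmetric]
      by (rule sum.cong) (auto simp: algebra_simps power2_eq_square)
    also have "(\<Sum>(i, j)\<in>{(i, j). i < j}. ?Q i j) = d2U m (g t) (v t)"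
      unfolding d2U_def
      by (rule sum_pairs) (use sphere_configs_inner_self[OF gt1] in \<open>auto simp: inner_commute mult_ac add_ac\<close>)
    finally show ?thesis .
  qed
  ultimately show ?thesis by (simp add: DERIV_cong_ev)
qed

lemma I1_sphere:
  assumes "q \<in> sphere_configs"
  shows "I1 m q = (\<Sum>i\<in>UNIV. m i * (1 - (q $ i $ 3)\<^sup>2))"
proof -
  have "(q $ i $ 1)\<^sup>2 + (q $ i $ 2)\<^sup>2 = 1 - (q $ i $ 3)\<^sup>2" for i
    using sphere_configs_inner_self[OF assms, of i] by (simp add: inner_vec_def sum_3 power2_eq_square)
  then show ?thesis by (simp add: I1_def)
qed

lemma I1_has_derivative:
  assumes g: "(g has_vector_derivative v) (at t)"
    and ev: "eventually (\<lambda>s. g s \<in> sphere_configs) (nhds t)"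
  shows "((\<lambda>s. I1 m (g s)) has_real_derivative dI m (g t) v) (at t)"
proof -
  have z: "((\<lambda>s. g s $ i $ 3) has_real_derivative v $ i $ 3) (at t)" for i
    unfolding has_real_derivative_iff_has_vector_derivative by (intro has_vector_derivative_vec_nth g)
  have "((\<lambda>s. \<Sum>i\<in>UNIV. m i * (1 - (g s $ i $ 3)\<^sup>2)) has_real_derivative dI m (g t) v) (at t)"
    unfolding dI_def by (auto intro!: derivative_eq_intros z simp: sum_distrib_left mult_ac)
  moreover have "eventually (\<lambda>s. I1 m (g s) = (\<Sum>i\<in>UNIV. m i * (1 - (g s $ i $ 3)\<^sup>2))) (nhds t)"
    using ev by eventually_elim (rule I1_sphere)
  ultimately show ?thesis by (simp add: DERIV_cong_ev)
qed

lemma C2_curve_in_tangent_sphere: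
  assumes g: "C2_curve_in M p v g" and M: "M \<subseteq> sphere_configs"
  shows "v $ i \<bullet> p $ i = 0"
proof -
  from g obtain e g' where e: "e > 0"
    and g': "(g has_vector_derivative g' 0) (at 0)" "g' 0 = v" "g 0 = p"
    and S: "\<And>t. \<bar>t\<bar> < e \<Longrightarrow> g t \<in> M"
    unfolding C2_curve_in_def by (auto simp: abs_less_iff)
  have S': "g t \<in> sphere_configs" if "\<bar>t\<bar> < e" for t using S[OF that] M by blast
  have "((\<lambda>t. g t $ i \<bullet> g t $ i) has_real_derivative (p $ i \<bullet> v $ i + v $ i \<bullet> p $ i)) (at 0)"
    using has_real_derivative_inner[OF has_vector_derivative_vec_nth[OF g'(1)] has_vector_derivative_vec_nth[OF g'(1)]] g' by simp
  moreover have "eventually (\<lambda>t. g t $ i \<bullet> g t $ i = 1) (nhds 0)"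
    unfolding eventually_nhds_metric using e S'
    by (auto simp: dist_real_def sphere_configs_inner_self intro!: exI[of _ e])
  then have "((\<lambda>t. g t $ i \<bullet> g t $ i) has_real_derivative 0) (at 0)" by (simp add: DERIV_cong_ev)
  ultimately show ?thesis using DERIV_unique by (fastforce simp: inner_commute)
qed

text \<open>Every vector with \<open>x $ i\<close> orthogonal to \<open>q $ i\<close> is the velocity of a curve, namely of
  \<open>(q $ i + t x $ i) / \<parallel>q $ i + t x $ i\<parallel>\<close>, so criticality is the linear condition on the right.\<close>

lemma critical_point_on_sphere_iff:
  "critical_point_on regular_configs (\<lambda>p. U1 m p - l * I1 m p) q \<longleftrightarrow>
    q \<in> regular_configs \<and> (\<forall>x. (\<forall>i. x $ i \<bullet> q $ i = 0) \<longrightarrow> dU m q x = l * dI m q x)"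
  (is "?L \<longleftrightarrow> ?q \<and> ?R")
proof -
  have deriv: "((\<lambda>t. U1 m (g t) - l * I1 m (g t)) has_real_derivative (dU m q x - l * dI m q x)) (at 0)"
    if g: "C2_curve_in regular_configs q x g" for x g
  proof -
    from g obtain e g' where e: "e > 0"
      and g': "(g has_vector_derivative g' 0) (at 0)" "g' 0 = x" "g 0 = q"
      and S: "\<And>t. \<bar>t\<bar> < e \<Longrightarrow> g t \<in> regular_configs"
      unfolding C2_curve_in_def by (auto simp: abs_less_iff)
    have ev: "eventually (\<lambda>t. g t \<in> regular_configs) (nhds 0)"
      unfolding eventually_nhds_metric using e S by (auto simp: dist_real_def)
    then have "eventually (\<lambda>t. g t \<in> sphere_configs) (nhds 0)" by eventually_elim simp
    from I1_has_derivative[OF g'(1) this] U1_has_derivative[OF g'(1) ev] show ?thesis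
      unfolding g' by (intro DERIV_diff DERIV_cmult)
  qed
  have curve: "\<exists>g. C2_curve_in regular_configs q x g"
    if q: "?q" and x: "\<forall>i. x $ i \<bullet> q $ i = 0" for x
  proof -
    let ?k = "\<lambda>i. (norm (x $ i))\<^sup>2"
    let ?g = "\<lambda>t. \<chi> i. \<chi> j. 1 / sqrt (1 + t\<^sup>2 * ?k i) * (q $ i $ j + t * x $ i $ j)"
    have "C2_curve_in UNIV (1 * q $ i $ j) (1 * x $ i $ j + 0 * q $ i $ j)
        (\<lambda>t. 1 / sqrt (1 + t\<^sup>2 * ?k i) * (q $ i $ j + t * x $ i $ j))" for i j
      by (rule C2_curve_in_mult[OF C2_curve_in_inv_sqrt C2_curve_in_linear])
    then have C2: "C2_curve_in UNIV q x ?g" by (intro C2_curve_in_vec) simp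
    have gi: "?g t $ i = (1 / sqrt (1 + t\<^sup>2 * ?k i)) *\<^sub>R (q $ i + t *\<^sub>R x $ i)" for t i
      by (simp add: vec_eq_iff)
    have pos: "1 + t\<^sup>2 * ?k i > 0" for i t by (simp add: add_pos_nonneg)
    have nrm: "norm (q $ i + t *\<^sub>R x $ i) = sqrt (1 + t\<^sup>2 * ?k i)" for i t
      unfolding norm_eq_sqrt_inner[of "q $ i + t *\<^sub>R x $ i"]
      using x sphere_configs_inner_self[of q i] q
      by (simp add: inner_add inner_commute power2_norm_eq_inner) (simp add: power2_eq_square mult_ac)
    have "norm (?g t $ i) = 1" for t i
      unfolding gi norm_scaleR nrm using pos[of t i] by simp
    then have sph: "?g t \<in> sphere_configs" for t by (simp add: sphere_configs_def)
    have "?g 0 = q" by (simp add: vec_eq_iff)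
    then have "eventually (\<lambda>t. ?g t \<notin> singular_configs) (nhds 0)"
      using q by (intro eventually_not_singular C2_curve_in_isCont[OF C2]) auto
    then have "eventually (\<lambda>t. ?g t \<in> regular_configs) (nhds 0)"
      by (rule eventually_mono) (use sph in blast)
    then have "C2_curve_in regular_configs q x ?g"
      by (rule C2_curve_in_eventually[OF C2])
    then show ?thesis by blast
  qed
  show ?thesis
  proof
    assume L: ?L
    then have q: ?q by (simp add: critical_point_on_def)
    moreover have ?R
    proof (intro allI impI)
      fix x :: "'a config" assume "\<forall>i. x $ i \<bullet> q $ i = 0"
      from curve[OF q this] obtain g where g: "C2_curve_in regular_configs q x g" ..
      then have "((\<lambda>t. U1 m (g t) - l * I1 m (g t)) has_real_derivative 0) (at 0)"
        using L by (simp add: critical_point_on_def)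
      from DERIV_unique[OF this deriv[OF g]] show "dU m q x = l * dI m q x" by simp
    qed
    ultimately show "?q \<and> ?R" ..
  next
    assume R: "?q \<and> ?R"
    show ?L unfolding critical_point_on_def
    proof (intro conjI allI impI)
      fix x g assume g: "C2_curve_in regular_configs q x g"
      then have "dU m q x = l * dI m q x"
        using R C2_curve_in_tangent_sphere[OF g] by blast
      then show "((\<lambda>t. U1 m (g t) - l * I1 m (g t)) has_real_derivative 0) (at 0)"
        using deriv[OF g] by simp
    qed (use R in blast)
  qed
qed

section \<open>Equilibria on a half circle: uniqueness\<close>

text \<open>For angles on a great circle, \<open>cot\<close> of the distance of two particles is \<open>pair_pot\<close> of the difference of
  their angles. Both functions vanish at 0 because of division by 0, which removes the diagonal of the
  double sums below.\<close>

definition pair_force :: "real \<Rightarrow> real" where "pair_force x = sin x / \<bar>sin x\<bar> ^ 3"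
definition pair_pot :: "real \<Rightarrow> real" where "pair_pot x = cos x / \<bar>sin x\<bar>"

lemma pair_force_0 [simp]: "pair_force 0 = 0" and pair_pot_0 [simp]: "pair_pot 0 = 0"
  by (simp_all add: pair_force_def pair_pot_def)

lemma pair_force_minus [simp]: "pair_force (- x) = - pair_force x"
  and pair_pot_minus [simp]: "pair_pot (- x) = pair_pot x"
  by (simp_all add: pair_force_def pair_pot_def)

lemma pair_force_swap: "pair_force (x - y) = - pair_force (y - x)"
  and pair_pot_swap: "pair_pot (x - y) = pair_pot (y - x)"
  using pair_force_minus[of "y - x"] pair_pot_minus[of "y - x"] by simp_all

lemma pair_pot_deriv:
  assumes "sin x \<noteq> 0"
  shows "(pair_pot has_real_derivative - pair_force x) (at x)"
proof -
  define u where "u = \<bar>sin x\<bar>"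
  have u: "u > 0" "u * u = sin x * sin x" using assms by (simp_all add: u_def abs_mult[symmetric])
  have "((\<lambda>x. (sin x)\<^sup>2) has_real_derivative 2 * sin x * cos x) (at x)"
    by (auto intro!: derivative_eq_intros)
  from DERIV_chain2[OF DERIV_real_sqrt this]
  have s: "((\<lambda>x. \<bar>sin x\<bar>) has_real_derivative sin x * cos x / u) (at x)"
    using assms by (simp add: u_def divide_simps)
  have "((\<lambda>x. cos x / \<bar>sin x\<bar>) has_real_derivative
      (- sin x * u - cos x * (sin x * cos x / u)) / (u * u)) (at x)"
    using DERIV_divide[OF DERIV_cos s] assms by (simp add: mult_ac u_def)
  moreover have "(- sin x * u - cos x * (sin x * cos x / u)) / (u * u) = - (sin x / u ^ 3)"
  proof -
    have "- sin x * u - cos x * (sin x * cos x / u) = - (sin x / u) * (u * u + cos x * cos x)"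
      using u(1) by (simp add: divide_simps algebra_simps)
    also have "\<dots> = - (sin x / u)" using u sin_cos_squared_add3[of x] by (simp add: add.commute)
    finally show ?thesis using u by (simp add: power3_eq_cube)
  qed
  ultimately show ?thesis unfolding pair_pot_def[abs_def] pair_force_def u_def by simp
qed

lemma pair_force_pos: "0 < x \<Longrightarrow> x < pi \<Longrightarrow> pair_force x > 0"
  using sin_gt_zero[of x] by (simp add: pair_force_def)

lemma mult_pair_force_pos: "x \<noteq> 0 \<Longrightarrow> \<bar>x\<bar> < pi \<Longrightarrow> x * pair_force x > 0"
  using pair_force_pos[of x] pair_force_pos[of "- x"]
  by (cases "x > 0") (auto simp: mult_pos_neg zero_less_mult_iff)

lemma above_tangent:
  fixes f f' :: "real \<Rightarrow> real"
  assumes d: "\<And>z. z \<in> {a<..<b} \<Longrightarrow> (f has_real_derivative f' z) (at z)"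
    and mono: "strict_mono_on {a<..<b} f'" and xy: "x \<in> {a<..<b}" "y \<in> {a<..<b}" "x \<noteq> y"
  shows "f x + f' x * (y - x) < f y"
proof (cases "x < y")
  case True
  obtain z where z: "x < z" "z < y" "f y - f x = (y - x) * f' z"
    using MVT2[OF True, of f f'] d xy by auto
  have "f' x * (y - x) < f' z * (y - x)"
    using strict_mono_onD[OF mono, of x z] z True xy by (intro mult_strict_right_mono) auto
  then show ?thesis using z by (simp add: algebra_simps)
next
  case False
  then have "y < x" using xy by simp
  obtain z where z: "y < z" "z < x" "f x - f y = (x - y) * f' z"
    using MVT2[OF \<open>y < x\<close>, of f f'] d xy by auto
  have "f' z * (x - y) < f' x * (x - y)"
    using strict_mono_onD[OF mono, of z x] z \<open>y < x\<close> xy by (intro mult_strict_right_mono) auto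
  then show ?thesis using z by (simp add: algebra_simps)
qed

text \<open>Convexity of the cotangent on \<open>(0, \<pi>/2)\<close>, in a form that is symmetric under reflection.\<close>

lemma pair_pot_above_tangent:
  assumes "x * y > 0" "\<bar>x\<bar> < pi / 2" "\<bar>y\<bar> < pi / 2"
  shows "pair_pot y \<ge> pair_pot x - pair_force x * (y - x)"
proof -
  have pos: "pair_pot y \<ge> pair_pot x - pair_force x * (y - x)"
    if x: "x \<in> {0<..<pi / 2}" and y: "y \<in> {0<..<pi / 2}" for x y
  proof (cases "x = y")
    case False
    have s: "sin z > 0" if "z \<in> {0<..<pi / 2}" for z using that by (intro sin_gt_zero) auto
    have "strict_mono_on {0<..<pi / 2} (\<lambda>z. - pair_force z)"
    proof (rule strict_mono_onI)
      fix z w assume zw: "z \<in> {0<..<pi / 2}" "w \<in> {0<..<pi / 2}" "z < w"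
      then have "sin z < sin w" by (intro sin_monotone_2pi) auto
      then have "(sin z)\<^sup>2 < (sin w)\<^sup>2" using s[OF zw(1)] by (intro power_strict_mono) auto
      then show "- pair_force z < - pair_force w"
        using s[OF zw(1)] s[OF zw(2)]
        by (simp add: pair_force_def power3_eq_cube power2_eq_square frac_less2)
    qed
    then show ?thesis
      using above_tangent[of 0 "pi / 2" pair_pot "\<lambda>z. - pair_force z" x y] pair_pot_deriv s x y False
      by (force simp: less_imp_le)
  qed simp
  show ?thesis
  proof (cases "x > 0")
    case True
    then show ?thesis using pos[of x y] assms by (auto simp: zero_less_mult_iff)
  next
    case False
    then show ?thesis using pos[of "- x" "- y"] assms by (auto simp: zero_less_mult_iff algebra_simps)
  qed
qed

lemma sin_squared_above_tangent:
  fixes x y :: real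
  assumes "\<bar>x\<bar> < pi / 4" "\<bar>y\<bar> < pi / 4" "x \<noteq> y"
  shows "(sin y)\<^sup>2 > (sin x)\<^sup>2 + 2 * sin x * cos x * (y - x)"
proof -
  have "(sin x)\<^sup>2 + sin (2 * x) * (y - x) < (sin y)\<^sup>2"
  proof (rule above_tangent[of "- (pi / 4)" "pi / 4"])
    show "strict_mono_on {- (pi / 4)<..<pi / 4} (\<lambda>x :: real. sin (2 * x))"
      by (intro strict_mono_onI sin_monotone_2pi) auto
  qed (use assms in \<open>auto intro!: derivative_eq_intros simp: sin_double\<close>)
  then show ?thesis by (simp add: sin_double)
qed

text \<open>A configuration on a half circle is given by its angles from the north pole. The line problem is
  to find the critical points of \<open>line_pot\<close> on a level of \<open>line_moment\<close>; the equation
  \<open>line_balanced\<close> below is the multiplier rule, with \<open>line_force\<close> the gradient of \<open>line_pot\<close>.\<close>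

definition line_force :: "('n::finite \<Rightarrow> real) \<Rightarrow> ('n \<Rightarrow> real) \<Rightarrow> 'n \<Rightarrow> real" where
  "line_force m th i = (\<Sum>j\<in>UNIV. m i * m j * pair_force (th j - th i))"

definition line_pot :: "('n::finite \<Rightarrow> real) \<Rightarrow> ('n \<Rightarrow> real) \<Rightarrow> real" where
  "line_pot m th = (\<Sum>i\<in>UNIV. \<Sum>j\<in>UNIV. m i * m j * pair_pot (th j - th i)) / 2"

definition line_moment :: "('n::finite \<Rightarrow> real) \<Rightarrow> ('n \<Rightarrow> real) \<Rightarrow> real" where
  "line_moment m th = (\<Sum>i\<in>UNIV. m i * (sin (th i))\<^sup>2)"

lemma member_le_line_moment:
  assumes "\<And>i. m i > 0"
  shows "m i * (sin (th i))\<^sup>2 \<le> line_moment m th"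
  unfolding line_moment_def by (rule member_le_sum) (use assms in \<open>auto simp: less_imp_le\<close>)

lemma abs_less_of_sin_squared:
  fixes x :: real
  assumes "(sin x)\<^sup>2 < (sin a)\<^sup>2" "\<bar>x\<bar> \<le> pi / 2" "0 \<le> a"
  shows "\<bar>x\<bar> < a"
proof (rule ccontr)
  assume "\<not> \<bar>x\<bar> < a"
  then have "0 \<le> sin a" "sin a \<le> sin \<bar>x\<bar>"
    using assms by (auto intro!: sin_ge_zero sin_monotone_2pi_le)
  then have "(sin a)\<^sup>2 \<le> (sin \<bar>x\<bar>)\<^sup>2" by (intro power_mono)
  also have "(sin \<bar>x\<bar>)\<^sup>2 = (sin x)\<^sup>2" by (simp add: abs_if)
  finally show False using assms by simp
qed

lemma angle_bound:
  fixes th :: "'n::finite \<Rightarrow> real"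
  assumes m: "\<And>i. m i > 0" and I: "line_moment m th \<le> c" and b: "\<bar>th i\<bar> \<le> pi / 2"
    and c: "c < m i * (sin a)\<^sup>2" and a: "0 \<le> a"
  shows "\<bar>th i\<bar> < a"
proof (rule abs_less_of_sin_squared[OF _ b a])
  have "m i * (sin (th i))\<^sup>2 < m i * (sin a)\<^sup>2"
    using member_le_line_moment[of m i th, OF m] I c by linarith
  then show "(sin (th i))\<^sup>2 < (sin a)\<^sup>2" using m[of i] by (simp only: mult_less_cancel_left_pos)
qed

definition line_balanced :: "('n::finite \<Rightarrow> real) \<Rightarrow> real \<Rightarrow> ('n \<Rightarrow> real) \<Rightarrow> bool" where
  "line_balanced m l th \<longleftrightarrow> (\<forall>i. line_force m th i = 2 * l * m i * sin (th i) * cos (th i))"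

lemma line_force_by_parts:
  "(\<Sum>i\<in>UNIV. h i * line_force m th i)
    = - (\<Sum>i\<in>UNIV. \<Sum>j\<in>UNIV. m i * m j * (pair_force (th j - th i) * (h j - h i))) / 2"
proof -
  let ?S = "\<Sum>i\<in>UNIV. \<Sum>j\<in>UNIV. h i * (m i * m j * pair_force (th j - th i))"
  have "(\<Sum>i\<in>UNIV. \<Sum>j\<in>UNIV. m i * m j * (pair_force (th j - th i) * (h j - h i)))
      = (\<Sum>i\<in>UNIV. \<Sum>j\<in>UNIV. h j * (m i * m j * pair_force (th j - th i))) - ?S"
    by (simp add: sum_subtractf[symmetric] algebra_simps)
  also have "(\<Sum>i\<in>UNIV. \<Sum>j\<in>UNIV. h j * (m i * m j * pair_force (th j - th i)))
      = (\<Sum>i\<in>UNIV. \<Sum>j\<in>UNIV. - (h i * (m i * m j * pair_force (th j - th i))))"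
    by (subst sum.swap) (intro sum.cong refl, subst pair_force_swap, simp add: mult_ac)
  finally show ?thesis unfolding line_force_def sum_distrib_left sum_negf by linarith
qed

lemma abs_diff_less_double: "\<bar>x\<bar> < a \<Longrightarrow> \<bar>y\<bar> < a \<Longrightarrow> \<bar>x - y\<bar> < 2 * a" for x y a :: real
  by linarith

lemma mult_sin_cos_pos: "x \<noteq> 0 \<Longrightarrow> \<bar>x\<bar> < pi / 2 \<Longrightarrow> x * (sin x * cos x) > 0" for x :: real
proof -
  assume x: "x \<noteq> 0" "\<bar>x\<bar> < pi / 2"
  have c: "cos x > 0" using x by (intro cos_gt_zero_pi) auto
  have "x * sin x > 0"
    using x sin_gt_zero[of x] sin_gt_zero[of "- x"] pi_gt_zero
    by (cases "x > 0") (auto simp: zero_less_mult_iff)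
  then have "(x * sin x) * cos x > 0" using c by simp
  then show ?thesis by (simp only: mult.assoc)
qed

text \<open>All interactions are repulsive, so moving outwards along the ray through \<open>th\<close> lowers the potential.\<close>

lemma line_force_virial:
  fixes th :: "'n::finite \<Rightarrow> real"
  assumes m: "\<And>i. m i > 0" and n: "CARD('n) \<ge> 2" and inj: "inj th" and b: "\<And>i. \<bar>th i\<bar> < pi / 2"
  shows "(\<Sum>i\<in>UNIV. th i * line_force m th i) < 0"
proof -
  let ?f = "\<lambda>i j. m i * m j * (pair_force (th j - th i) * (th j - th i))"
  have nn: "?f i j \<ge> 0" for i j
  proof (cases "i = j")
    case False
    then show ?thesis
      using mult_pair_force_pos[of "th j - th i"] abs_diff_less_double[OF b b, of j i] m inj
      by (auto simp: inj_eq mult_ac intro!: mult_nonneg_nonneg less_imp_le)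
  qed simp
  obtain i j :: 'n where ij: "i \<noteq> j"
    using n by (metis card_2_iff' ex_card subset_UNIV)
  have "?f i j > 0"
    using mult_pair_force_pos[of "th j - th i"] abs_diff_less_double[OF b b, of j i] m inj ij
    by (simp add: inj_eq mult.commute[of "pair_force _"])
  then have "(\<Sum>j\<in>UNIV. ?f i j) > 0"
    using nn by (intro sum_pos2[of _ j]) auto
  then have "(\<Sum>i\<in>UNIV. \<Sum>j\<in>UNIV. ?f i j) > 0"
    by (rule sum_pos2[OF finite UNIV_I]) (intro sum_nonneg nn)
  then show ?thesis unfolding line_force_by_parts by simp
qed

text \<open>Moving outwards lowers the potential and raises the moment.\<close>

lemma line_multiplier_neg:
  fixes th :: "'n::finite \<Rightarrow> real"
  assumes m: "\<And>i. m i > 0" and n: "CARD('n) \<ge> 2" and inj: "inj th" and b: "\<And>i. \<bar>th i\<bar> < pi / 2"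
    and bal: "line_balanced m l th"
  shows "l < 0"
proof -
  let ?S = "\<Sum>i\<in>UNIV. m i * (th i * (sin (th i) * cos (th i)))"
  have "m i * (th i * (sin (th i) * cos (th i))) \<ge> 0" for i
    using mult_sin_cos_pos[of "th i"] b[of i] m[of i] by (cases "th i = 0") auto
  then have nn: "?S \<ge> 0" by (intro sum_nonneg) auto
  have "(\<Sum>i\<in>UNIV. th i * line_force m th i) = 2 * l * ?S"
    using bal by (simp add: line_balanced_def sum_distrib_left mult_ac)
  then have "2 * l * ?S < 0"
    using line_force_virial[of m th, OF m n inj b] by simp
  then show ?thesis using nn by (auto simp: mult_less_0_iff)
qed

text \<open>For angles below \<open>\<pi>/4\<close> and a fixed ordering, \<open>line_pot\<close> is convex (the differences are below \<open>\<pi>/2\<close>,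
  where the cotangent is convex) and \<open>line_moment\<close> is strictly convex. As the multiplier \<open>l\<close> is negative,
  \<open>line_pot - l * line_moment\<close> is strictly convex, hence its critical point is its strict minimum. Where the
  moment is not larger, this compares the potentials themselves, again because \<open>l < 0\<close>.\<close>

lemma line_balanced_strict_min:
  fixes th et :: "'n::finite \<Rightarrow> real"
  assumes m: "\<And>i. m i > 0" and n: "CARD('n) \<ge> 2"
    and inj: "inj th" and b: "\<And>i. \<bar>th i\<bar> < pi / 4" "\<And>i. \<bar>et i\<bar> < pi / 4"
    and order: "\<And>i j. th i < th j \<longleftrightarrow> et i < et j" and bal: "line_balanced m l th"
    and I: "line_moment m et \<le> line_moment m th" and ne: "th \<noteq> et"
  shows "line_pot m th < line_pot m et"
proof -
  let ?L = "\<lambda>i. 2 * sin (th i) * cos (th i) * (et i - th i)" and ?R = "\<lambda>i. (sin (et i))\<^sup>2 - (sin (th i))\<^sup>2"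
    and ?T = "\<lambda>i j. pair_pot (th j - th i) - pair_force (th j - th i) * ((et j - th j) - (et i - th i))"
  have b2: "\<bar>th i\<bar> < pi / 2" for i using b(1)[of i] pi_gt_zero by linarith
  have l: "l < 0" using line_multiplier_neg[of m th, OF m n inj b2 bal] .
  have tangent: "m i * m j * (?T i j)
      \<le> m i * m j * pair_pot (et j - et i)" for i j
  proof (cases "i = j")
    case False
    then have "th i < th j \<or> th j < th i" using inj by (metis injD linorder_neqE)
    then have "(th j - th i) * (et j - et i) > 0"
      using order[of i j] order[of j i] by (auto simp: zero_less_mult_iff)
    then have "pair_pot (th j - th i) - pair_force (th j - th i) * ((et j - et i) - (th j - th i)) \<le> pair_pot (et j - et i)"
      using abs_diff_less_double[OF b(1) b(1), of j i] abs_diff_less_double[OF b(2) b(2), of j i]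
      by (intro pair_pot_above_tangent) auto
    then show ?thesis using m by (intro mult_left_mono) (auto simp: algebra_simps less_imp_le)
  qed simp
  have "(\<Sum>i\<in>UNIV. \<Sum>j\<in>UNIV. m i * m j * (?T i j))
     \<le> (\<Sum>i\<in>UNIV. \<Sum>j\<in>UNIV. m i * m j * pair_pot (et j - et i))"
    by (intro sum_mono tangent)
  then have "line_pot m th + (\<Sum>i\<in>UNIV. (et i - th i) * line_force m th i) \<le> line_pot m et"
    unfolding line_force_by_parts line_pot_def right_diff_distrib[of "m _ * m _"] sum_subtractf
    by (simp add: field_simps)
  moreover have "(\<Sum>i\<in>UNIV. (et i - th i) * line_force m th i)
      = l * (\<Sum>i\<in>UNIV. m i * (?L i))"
    using bal by (simp add: line_balanced_def sum_distrib_left mult_ac)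
  moreover have "(\<Sum>i\<in>UNIV. m i * (?L i)) < 0"
  proof -
    obtain k where k: "th k \<noteq> et k" using ne by auto
    have "(\<Sum>i\<in>UNIV. m i * (?L i))
        < (\<Sum>i\<in>UNIV. m i * (?R i))"
    proof (rule sum_strict_mono_ex1)
      have le: "?L i \<le> ?R i" for i
        using sin_squared_above_tangent[OF b(1)[of i] b(2)[of i]] by (cases "th i = et i") auto
      then show "\<forall>i\<in>UNIV. m i * (?L i) \<le> m i * (?R i)"
        using m by (intro ballI mult_left_mono) (auto simp: less_imp_le)
      have "m k * (?L k) < m k * (?R k)"
        using sin_squared_above_tangent[OF b(1)[of k] b(2)[of k] k] m[of k]
        by (intro mult_strict_left_mono) linarith+
      then show "\<exists>i\<in>UNIV. m i * (?L i) < m i * (?R i)"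
        by blast
    qed simp
    also have "\<dots> \<le> 0" using I unfolding line_moment_def by (simp add: right_diff_distrib sum_subtractf)
    finally show ?thesis .
  qed
  ultimately show ?thesis using mult_neg_neg[OF l] by fastforce
qed

lemma inj_of_order:
  fixes r :: "'a \<Rightarrow> 'b::linorder" and f :: "'a \<Rightarrow> 'c::order"
  assumes "inj r" "\<And>i j. r i < r j \<Longrightarrow> f i < f j"
  shows "inj f"
  by (rule injI) (metis assms injD less_irrefl linorder_less_linear)

lemma line_balanced_unique:
  fixes th et :: "'n::finite \<Rightarrow> real"
  assumes m: "\<And>i. m i > 0" and n: "CARD('n) \<ge> 2"
    and inj: "inj th" and b: "\<And>i. \<bar>th i\<bar> < pi / 4" "\<And>i. \<bar>et i\<bar> < pi / 4"
    and order: "\<And>i j. th i < th j \<longleftrightarrow> et i < et j"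
    and bal: "line_balanced m l th" "line_balanced m l' et"
    and I: "line_moment m et = line_moment m th"
  shows "th = et"
proof (rule ccontr)
  assume ne: "th \<noteq> et"
  have inj': "inj et" by (rule inj_of_order[OF inj]) (use order in blast)
  have "line_pot m th < line_pot m et"
    by (rule line_balanced_strict_min[of m th et l]) (use m n inj b order bal I ne in auto)
  moreover have "line_pot m et < line_pot m th"
    by (rule line_balanced_strict_min[of m et th l']) (use m n inj' b order bal I ne in auto)
  ultimately show False by simp
qed

section \<open>Equilibria on a half circle: existence\<close>

lemma line_pot_directional:
  fixes th h :: "real^'n::finite"
  assumes s: "\<And>i j. i \<noteq> j \<Longrightarrow> sin (th $ j - th $ i) \<noteq> 0"
  shows "((\<lambda>t. line_pot m (($) (th + t *\<^sub>R h))) has_real_derivative (\<Sum>i\<in>UNIV. h $ i * line_force m (($) th) i)) (at 0)"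
proof -
  have pair: "((\<lambda>t. m i * m j * pair_pot ((th + t *\<^sub>R h) $ j - (th + t *\<^sub>R h) $ i)) has_real_derivative
      - (m i * m j * (pair_force (th $ j - th $ i) * (h $ j - h $ i)))) (at 0)" for i j
  proof (cases "i = j")
    case False
    have "((\<lambda>t. (th + t *\<^sub>R h) $ j - (th + t *\<^sub>R h) $ i) has_real_derivative h $ j - h $ i) (at 0)"
      by (auto intro!: derivative_eq_intros)
    moreover have "sin ((th + 0 *\<^sub>R h) $ j - (th + 0 *\<^sub>R h) $ i) \<noteq> 0" using s[OF False] by simp
    ultimately show ?thesis
      using DERIV_cmult[OF DERIV_chain2[OF pair_pot_deriv], of "\<lambda>t. (th + t *\<^sub>R h) $ j - (th + t *\<^sub>R h) $ i" 0 "h $ j - h $ i" UNIV "m i * m j"]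
      by simp
  qed simp
  have "((\<lambda>t. line_pot m (($) (th + t *\<^sub>R h))) has_real_derivative
      (\<Sum>i\<in>UNIV. \<Sum>j\<in>UNIV. - (m i * m j * (pair_force (th $ j - th $ i) * (h $ j - h $ i)))) / 2) (at 0)"
    unfolding line_pot_def by (intro DERIV_cdivide DERIV_sum pair)
  then show ?thesis unfolding line_force_by_parts by (simp add: sum_negf)
qed

lemma line_moment_directional:
  fixes th h :: "real^'n::finite"
  shows "((\<lambda>t. line_moment m (($) (th + t *\<^sub>R h))) has_real_derivative
    2 * (\<Sum>i\<in>UNIV. m i * (sin (th $ i) * cos (th $ i)) * h $ i)) (at 0)"
proof -
  have "((\<lambda>t. m i * (sin ((th + t *\<^sub>R h) $ i))\<^sup>2) has_real_derivative
      2 * (m i * (sin (th $ i) * cos (th $ i)) * h $ i)) (at 0)" for i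
    by (auto intro!: derivative_eq_intros)
  then show ?thesis unfolding line_moment_def sum_distrib_left by (intro DERIV_sum) auto
qed

text \<open>The multiplier rule for one inequality constraint: take \<open>h\<close> close to minus the component of \<open>a\<close>
  orthogonal to \<open>b\<close>, tilted slightly into the half space.\<close>

lemma proportional_of_halfspace:
  fixes a b :: "'a::real_inner"
  assumes b: "b \<noteq> 0" and h: "\<And>h. b \<bullet> h < 0 \<Longrightarrow> a \<bullet> h \<ge> 0"
  shows "\<exists>l. a = l *\<^sub>R b"
proof -
  define l where "l = (a \<bullet> b) / (b \<bullet> b)"
  define v where "v = a - l *\<^sub>R b"
  have bb: "b \<bullet> b > 0" using b by simp
  have bv: "b \<bullet> v = 0" using bb by (simp add: v_def l_def inner_diff_right inner_commute)
  have av: "a \<bullet> v = v \<bullet> v" using bv by (simp add: v_def inner_diff_left)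
  have "v = 0"
  proof (rule ccontr)
    assume "v \<noteq> 0"
    then have vv: "v \<bullet> v > 0" by simp
    define e where "e = (v \<bullet> v) / (2 * (\<bar>a \<bullet> b\<bar> + 1))"
    have e: "e > 0" using vv by (simp add: e_def add_nonneg_pos)
    have "b \<bullet> (- v - e *\<^sub>R b) < 0" using bv bb e by (simp add: inner_diff_right)
    from h[OF this] have "v \<bullet> v \<le> - e * (a \<bullet> b)" by (simp add: inner_diff_right av)
    also have "\<dots> \<le> e * \<bar>a \<bullet> b\<bar>" using mult_left_mono[of "- (a \<bullet> b)" "\<bar>a \<bullet> b\<bar>" e] e by simp
    also have "\<dots> < e * (2 * (\<bar>a \<bullet> b\<bar> + 1))" using e by (intro mult_strict_left_mono) auto
    also have "\<dots> = v \<bullet> v" unfolding e_def by simp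
    finally show False by simp
  qed
  then show ?thesis by (auto simp: v_def)
qed

lemma half_less_cos: "0 \<le> x \<Longrightarrow> x < pi / 3 \<Longrightarrow> 1 / 2 < cos x"
proof -
  assume "0 \<le> x" "x < pi / 3"
  then have "cos (pi / 3) < cos x" using pi_gt_zero by (intro cos_monotone_0_pi) linarith+
  then show ?thesis by (simp only: cos_60)
qed

text \<open>The number \<open>r i\<close> is the position of particle \<open>i\<close> in the prescribed ordering. The set \<open>D\<close> below consists of the
  ordered configurations with angles below \<open>\<pi>/4\<close>.\<close>

locale line_problem =
  fixes m :: "'n::finite \<Rightarrow> real" and c :: real and r :: "'n \<Rightarrow> nat"
  assumes m: "\<And>i. m i > 0" and n: "CARD('n) \<ge> 2" and c: "0 < c" "\<And>i. c < m i / 2" and r: "inj r"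
begin

definition D :: "(real^'n) set" where
  "D = {th. (\<forall>i. \<bar>th $ i\<bar> < pi / 4) \<and> (\<forall>i j. r i < r j \<longrightarrow> th $ i < th $ j)}"

lemma moment_bound: "line_moment m th \<le> c \<Longrightarrow> \<bar>th i\<bar> \<le> pi / 2 \<Longrightarrow> \<bar>th i\<bar> < pi / 4"
  by (rule angle_bound[of m _ c]) (use m c(2) in \<open>auto simp: sin_45 power_divide\<close>)

lemma D_inj: "th \<in> D \<Longrightarrow> inj (($) th)"
  by (rule inj_of_order[OF r]) (simp add: D_def)

lemma D_sin:
  assumes "th \<in> D" "i \<noteq> j" shows "sin (th $ j - th $ i) \<noteq> 0"
proof -
  have "\<bar>th $ j\<bar> < pi / 4" "\<bar>th $ i\<bar> < pi / 4" using assms by (auto simp: D_def)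
  then have "\<bar>th $ j - th $ i\<bar> < pi" using pi_gt_zero by linarith
  moreover have "th $ j - th $ i \<noteq> 0" using D_inj[OF assms(1)] assms(2) by (simp add: inj_eq)
  ultimately show ?thesis using sin_eq_0_pi[of "th $ j - th $ i"] by (auto simp: abs_less_iff)
qed

lemma D_open: "open D"
proof -
  have "D = (\<Inter>i. {th. \<bar>th $ i\<bar> < pi / 4}) \<inter> (\<Inter>i. \<Inter>j. {th. r i < r j \<longrightarrow> th $ i < th $ j})"
    by (auto simp: D_def)
  moreover have "open {th :: real^'n. \<bar>th $ i\<bar> < pi / 4}" for i
    by (intro open_Collect_less continuous_intros)
  moreover have "open {th :: real^'n. r i < r j \<longrightarrow> th $ i < th $ j}" for i j
    by (cases "r i < r j") (auto intro!: open_Collect_less continuous_intros)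
  ultimately show ?thesis by (auto intro!: open_INT)
qed

lemma exists_in_D: "\<exists>th\<in>D. line_moment m (($) th) \<le> c"
proof -
  let ?th = "\<lambda>e::real. (\<chi> i. e * real (r i)) :: real^'n"
  have ev1: "eventually (\<lambda>e. \<bar>e * real (r i)\<bar> < pi / 4) (at_right 0)" for i
    by (rule order_tendstoD(2)[of _ 0]) (auto intro!: tendsto_eq_intros)
  have ev2: "eventually (\<lambda>e. line_moment m (\<lambda>i. e * real (r i)) < c) (at_right 0)"
    unfolding line_moment_def using c(1)
    by (intro order_tendstoD(2)[of _ 0]) (auto intro!: tendsto_eq_intros)
  have "eventually (\<lambda>e::real. e > 0) (at_right 0)" by (rule eventually_at_right_less)
  moreover have "eventually (\<lambda>e. \<forall>i. \<bar>e * real (r i)\<bar> < pi / 4) (at_right 0)"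
    using ev1 by (rule eventually_all_finite)
  ultimately have "eventually (\<lambda>e. ?th e \<in> D \<and> line_moment m (($) (?th e)) \<le> c) (at_right 0)"
    using ev2 by eventually_elim (auto simp: D_def vec_lambda_inverse)
  then show ?thesis using eventually_happens[of _ "at_right (0::real)"] trivial_limit_at_right_real by blast
qed

text \<open>All pair potentials are nonnegative on \<open>D\<close>, so one pair in near collision forces the whole
  potential to be large.\<close>

lemma pot_pair_le:
  assumes th: "th \<in> D" and ij: "i \<noteq> j"
  shows "m i * m j * pair_pot (th $ j - th $ i) \<le> line_pot m (($) th)"
proof -
  have nn: "m i * m j * pair_pot (th $ j - th $ i) \<ge> 0" for i j
  proof -
    have "\<bar>th $ j\<bar> < pi / 4" "\<bar>th $ i\<bar> < pi / 4" using th by (auto simp: D_def)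
    then have "\<bar>th $ j - th $ i\<bar> \<le> pi / 2" using pi_gt_zero by linarith
    then have "cos (th $ j - th $ i) \<ge> 0" by (intro cos_ge_zero) linarith+
    then show ?thesis using m by (auto simp: pair_pot_def less_imp_le intro!: mult_nonneg_nonneg divide_nonneg_nonneg)
  qed
  let ?f = "\<lambda>(i, j). m i * m j * pair_pot (th $ j - th $ i)"
  have "sum ?f {(i, j), (j, i)} \<le> sum ?f (UNIV \<times> UNIV)"
    by (intro sum_mono2) (use nn in auto)
  also have "\<dots> = 2 * line_pot m (($) th)"
    unfolding line_pot_def by (simp add: sum.cartesian_product)
  finally show ?thesis using ij pair_pot_swap[of "th $ i" "th $ j"] by (simp add: mult_ac)
qed

text \<open>Near a collision the potential exceeds its value \<open>N\<close> at a reference configuration. Configurations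
  with all gaps at least \<open>\<delta>\<close> form a compact set, which suffices for the minimum.\<close>

lemma exists_minimizer:
  "\<exists>th\<in>D. line_moment m (($) th) \<le> c \<and>
     (\<forall>et\<in>D. line_moment m (($) et) \<le> c \<longrightarrow> line_pot m (($) th) \<le> line_pot m (($) et))"
proof -
  obtain th0 where th0: "th0 \<in> D" "line_moment m (($) th0) \<le> c" using exists_in_D by blast
  define N where "N = line_pot m (($) th0)"
  define mm where "mm = Min (range m)"
  have mm: "mm > 0" "\<And>i. mm \<le> m i" unfolding mm_def using m by auto
  \<comment> \<open>If \<open>0 < x < \<pi>/3\<close> then \<open>cot x > 1/(2 x)\<close>; with a gap \<open>x < \<delta>\<close> one pair alone exceeds \<open>N\<close>.\<close>
  define \<delta> where "\<delta> = min (pi / 3) (mm * mm / (2 * (\<bar>N\<bar> + 1)))"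
  have \<delta>: "\<delta> > 0" "\<delta> \<le> pi / 3" "\<delta> \<le> mm * mm / (2 * (\<bar>N\<bar> + 1))"
    unfolding \<delta>_def using mm pi_gt_zero by (simp add: add_nonneg_pos, intro min.cobounded1, intro min.cobounded2)
  have gap: "th $ j - th $ i \<ge> \<delta>" if th: "th \<in> D" "line_pot m (($) th) \<le> N" and ij: "r i < r j" for th i j
  proof (rule ccontr)
    define x where "x = th $ j - th $ i"
    assume "\<not> ?thesis"
    then have x: "0 < x" "x < \<delta>" using th ij by (auto simp: D_def x_def)
    have sx: "0 < sin x" "sin x \<le> x" using x \<delta> pi_gt_zero by (auto intro!: sin_gt_zero sin_x_le_x)
    have "(\<bar>N\<bar> + 1) * (2 * x) < mm * mm"
    proof -
      have "x < mm * mm / (2 * (\<bar>N\<bar> + 1))" using x \<delta> by linarith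
      then show ?thesis by (simp add: pos_less_divide_eq add_nonneg_pos mult_ac)
    qed
    then have "(\<bar>N\<bar> + 1) * x < mm * mm * (1 / 2)" by simp
    also have "\<dots> \<le> m i * m j * cos x"
      using mm half_less_cos[of x] x \<delta> m by (intro mult_mono) (auto simp: less_imp_le)
    finally have "(\<bar>N\<bar> + 1) * x < m i * m j * cos x" .
    moreover have "(\<bar>N\<bar> + 1) * sin x \<le> (\<bar>N\<bar> + 1) * x" using sx by (intro mult_left_mono) auto
    ultimately have "\<bar>N\<bar> + 1 < m i * m j * cos x / sin x" using sx by (simp add: pos_less_divide_eq)
    also have "\<dots> = m i * m j * pair_pot x" using sx by (simp add: pair_pot_def)
    also have "\<dots> \<le> line_pot m (($) th)" unfolding x_def by (rule pot_pair_le[OF th(1)]) (use ij in auto)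
    finally show False using th by linarith
  qed
  define K where "K = {th :: real^'n. (\<forall>i. \<bar>th $ i\<bar> \<le> pi / 4) \<and> line_moment m (($) th) \<le> c
      \<and> (\<forall>i j. r i < r j \<longrightarrow> \<delta> \<le> th $ j - th $ i)}"
  have KD: "K \<subseteq> D"
  proof
    fix th assume K: "th \<in> K"
    have "\<bar>th $ i\<bar> < pi / 4" for i
    proof (rule moment_bound)
      have "\<bar>th $ i\<bar> \<le> pi / 4" using K by (simp add: K_def)
      then show "\<bar>th $ i\<bar> \<le> pi / 2" using pi_gt_zero by linarith
    qed (use K in \<open>simp add: K_def\<close>)
    moreover have "th $ i < th $ j" if "r i < r j" for i j
      using K that \<delta>(1) by (force simp: K_def)
    ultimately show "th \<in> D" by (auto simp: D_def)
  qed
  have "K = (\<Inter>i. {th. \<bar>th $ i\<bar> \<le> pi / 4}) \<inter> {th. line_moment m (($) th) \<le> c}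
      \<inter> (\<Inter>i. \<Inter>j. {th. r i < r j \<longrightarrow> \<delta> \<le> th $ j - th $ i})"
    by (auto simp: K_def)
  moreover have "closed {th :: real^'n. \<bar>th $ i\<bar> \<le> pi / 4}" for i
    by (intro closed_Collect_le continuous_intros)
  moreover have "closed {th :: real^'n. line_moment m (($) th) \<le> c}"
    unfolding line_moment_def by (intro closed_Collect_le continuous_intros)
  moreover have "closed {th :: real^'n. r i < r j \<longrightarrow> \<delta> \<le> th $ j - th $ i}" for i j
    by (cases "r i < r j") (auto intro!: closed_Collect_le continuous_intros)
  ultimately have cl: "closed K" by (auto intro!: closed_INT closed_Int)
  have "norm th \<le> CARD('n) * (pi / 4)" if "th \<in> K" for th
  proof -
    have "norm th \<le> (\<Sum>i\<in>UNIV. \<bar>th $ i\<bar>)" by (rule norm_le_l1_cart)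
    also have "\<dots> \<le> (\<Sum>i\<in>(UNIV::'n set). pi / 4)" using that by (intro sum_mono) (auto simp: K_def)
    finally show ?thesis by simp
  qed
  then have "bounded K" unfolding bounded_iff by blast
  with cl have cK: "compact K" by (simp add: compact_eq_bounded_closed)
  have "th0 \<in> K" using th0 gap[OF th0(1)] by (auto simp: K_def N_def D_def less_imp_le)
  then have ne: "K \<noteq> {}" by auto
  have "continuous_on K (\<lambda>th. line_pot m (($) th))"
    unfolding line_pot_def
  proof (intro continuous_intros)
    fix i j
    show "continuous_on K (\<lambda>th. pair_pot (th $ j - th $ i))"
    proof (cases "i = j")
      case False
      then have "\<forall>th\<in>K. sin (th $ j - th $ i) \<noteq> 0" using D_sin KD by blast
      then show ?thesis unfolding pair_pot_def by (intro continuous_intros) auto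
    qed simp
  qed simp_all
  from continuous_attains_inf[OF cK ne this] obtain th where th: "th \<in> K"
    and min: "\<And>et. et \<in> K \<Longrightarrow> line_pot m (($) th) \<le> line_pot m (($) et)" by blast
  have "line_pot m (($) th) \<le> line_pot m (($) et)" if et: "et \<in> D" "line_moment m (($) et) \<le> c" for et
  proof (cases "line_pot m (($) et) \<le> N")
    case True
    then have "et \<in> K" using et gap[OF et(1)] by (auto simp: K_def D_def less_imp_le)
    then show ?thesis by (rule min)
  next
    case False
    then show ?thesis using min[OF \<open>th0 \<in> K\<close>] by (simp add: N_def)
  qed
  moreover have "th \<in> D" "line_moment m (($) th) \<le> c" using th KD by (auto simp: K_def)
  ultimately show ?thesis by blast
qed

text \<open>The minimum is sought on \<open>line_moment \<le> c\<close> instead of on the level set, so that straight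
  variations suffice. It lies on the level \<open>c\<close> because moving outwards lowers the potential, and there every
  direction that lowers the moment cannot lower the potential.\<close>

theorem exists_balanced:
  "\<exists>th l. (\<forall>i. \<bar>th i\<bar> < pi / 4) \<and> (\<forall>i j. r i < r j \<longrightarrow> th i < th j) \<and> line_moment m th = c \<and> line_balanced m l th"
proof -
  obtain th where D: "th \<in> D" and I: "line_moment m (($) th) \<le> c"
    and min: "\<And>et. et \<in> D \<Longrightarrow> line_moment m (($) et) \<le> c \<Longrightarrow> line_pot m (($) th) \<le> line_pot m (($) et)"
    using exists_minimizer by blast
  let ?pot = "\<lambda>h t. line_pot m (($) (th + t *\<^sub>R h))" and ?mom = "\<lambda>h t. line_moment m (($) (th + t *\<^sub>R h))"
  define a :: "real^'n" where "a = (\<chi> i. line_force m (($) th) i)"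
  define b :: "real^'n" where "b = (\<chi> i. m i * (sin (th $ i) * cos (th $ i)))"
  have dpot: "((\<lambda>t. ?pot h t) has_real_derivative a \<bullet> h) (at 0)" for h
    using line_pot_directional[of th m h] D_sin[OF D] by (simp add: a_def inner_vec_def mult_ac)
  have dmom: "((\<lambda>t. ?mom h t) has_real_derivative 2 * (b \<bullet> h)) (at 0)" for h
    using line_moment_directional[of m th h] by (simp add: b_def inner_vec_def mult_ac)
  have stay: "eventually (\<lambda>t. th + t *\<^sub>R h \<in> D) (at_right 0)" for h
  proof -
    have "((\<lambda>t. th + t *\<^sub>R h) \<longlongrightarrow> th) (at_right 0)" by (auto intro!: tendsto_eq_intros)
    from topological_tendstoD[OF this D_open D] show ?thesis .
  qed
  have dec: "eventually (\<lambda>t. f t < f 0) (at_right 0)" if "(f has_real_derivative l) (at 0)" "l < 0" for f :: "real \<Rightarrow> real" and l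
    using DERIV_neg_dec_right[OF that] by (auto simp: eventually_at_right_field intro!: exI)
  have first_order: "a \<bullet> h \<ge> 0"
    if h: "eventually (\<lambda>t. ?mom h t \<le> c) (at_right 0)" for h
  proof (rule ccontr)
    assume "\<not> ?thesis"
    then have "eventually (\<lambda>t. ?pot h t < line_pot m (($) th)) (at_right 0)"
      using dec[OF dpot] by simp
    then have "eventually (\<lambda>t::real. False) (at_right 0)"
      using h stay[of h] by eventually_elim (use min in \<open>force simp: not_less[symmetric]\<close>)
    then show False by simp
  qed
  have b2: "\<bar>th $ i\<bar> < pi / 2" for i 
  proof -
    have "\<bar>th $ i\<bar> < pi / 4" using D by (simp add: D_def)
    then show ?thesis using pi_gt_zero by linarith
  qed
  have virial: "a \<bullet> th < 0"
    using line_force_virial[of m "($) th", OF m n D_inj[OF D] b2] by (simp add: a_def inner_vec_def mult_ac)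
  have Ic: "line_moment m (($) th) = c"
  proof (rule ccontr)
    assume "\<not> ?thesis"
    then have lt: "line_moment m (($) th) < c" using I by simp
    have "((\<lambda>t. ?mom th t) \<longlongrightarrow> ?mom th 0) (at_right 0)"
      using DERIV_isCont[OF dmom[of th]] by (auto simp: isCont_def filterlim_at_split)
    then have "eventually (\<lambda>t. ?mom th t < c) (at_right 0)"
      using lt by (intro order_tendstoD(2)) auto
    then have "eventually (\<lambda>t. ?mom th t \<le> c) (at_right 0)"
      by eventually_elim simp
    from first_order[OF this] virial show False by simp
  qed
  have "b \<noteq> 0"
  proof
    assume "b = 0"
    have "m i * (sin (th $ i))\<^sup>2 = 0" for i
    proof -
      have "cos (th $ i) > 0" using b2[of i] by (intro cos_gt_zero_pi) auto
      moreover have "m i * (sin (th $ i) * cos (th $ i)) = 0"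
        using \<open>b = 0\<close> by (metis b_def vec_lambda_beta zero_index)
      ultimately show ?thesis using m[of i] by auto
    qed
    then have "line_moment m (($) th) = 0" unfolding line_moment_def by (intro sum.neutral) blast
    then show False using Ic c(1) by simp
  qed
  moreover have "a \<bullet> h \<ge> 0" if "b \<bullet> h < 0" for h
  proof (rule first_order)
    have "eventually (\<lambda>t. ?mom h t < ?mom h 0) (at_right 0)"
      using that by (intro dec[OF dmom]) simp
    then show "eventually (\<lambda>t. ?mom h t \<le> c) (at_right 0)"
      by eventually_elim (simp add: Ic)
  qed
  ultimately obtain l where l: "a = l *\<^sub>R b" using proportional_of_halfspace by blast
  have "line_balanced m (l / 2) (($) th)"
    unfolding line_balanced_def
  proof
    fix i
    have "a $ i = (l *\<^sub>R b) $ i" using l by simp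
    then show "line_force m (($) th) i = 2 * (l / 2) * m i * sin (th $ i) * cos (th $ i)"
      by (simp add: a_def b_def mult_ac)
  qed
  then show ?thesis using D Ic unfolding D_def by blast
qed

end

section \<open>Geodesic central configurations are vertical\<close>

text \<open>The great circle through the north pole in direction \<open>al\<close>: \<open>line_config al th\<close> places particle \<open>i\<close> at the
  angle \<open>th i\<close> from the pole, \<open>frame_w al\<close> is the normal of its plane, and \<open>line_tangent al th a b\<close> is the
  tangent vector with components \<open>a\<close> along the circle and \<open>b\<close> normal to it.\<close>

definition frame_w :: "real \<Rightarrow> real^3" where
  "frame_w al = vector [- sin al, cos al, 0]"

definition line_config :: "real \<Rightarrow> ('n \<Rightarrow> real) \<Rightarrow> 'n::finite config" where
  "line_config al th = (\<chi> i. vector [sin (th i) * cos al, sin (th i) * sin al, cos (th i)])"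

definition line_tangent :: "real \<Rightarrow> ('n \<Rightarrow> real) \<Rightarrow> ('n \<Rightarrow> real) \<Rightarrow> ('n \<Rightarrow> real) \<Rightarrow> 'n::finite config" where
  "line_tangent al th a b = (\<chi> i. vector [a i * cos (th i) * cos al - b i * sin al,
      a i * cos (th i) * sin al + b i * cos al, - a i * sin (th i)])"

lemma line_config_nth [simp]: "line_config al th $ i $ 1 = sin (th i) * cos al"
  "line_config al th $ i $ 2 = sin (th i) * sin al" "line_config al th $ i $ 3 = cos (th i)"
  by (simp_all add: line_config_def)

lemma line_tangent_nth [simp]: "line_tangent al th a b $ i $ 1 = a i * cos (th i) * cos al - b i * sin al"
  "line_tangent al th a b $ i $ 2 = a i * cos (th i) * sin al + b i * cos al"
  "line_tangent al th a b $ i $ 3 = - a i * sin (th i)"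
  by (simp_all add: line_tangent_def)

lemma frame_w_nth [simp]: "frame_w al $ 1 = - sin al" "frame_w al $ 2 = cos al" "frame_w al $ 3 = 0"
  by (simp_all add: frame_w_def)

lemma inner_3: "(x :: real^3) \<bullet> y = x $ 1 * y $ 1 + x $ 2 * y $ 2 + x $ 3 * y $ 3"
  by (simp add: inner_vec_def sum_3)

lemma config_eq_iff: "(p :: 'n::finite config) = q \<longleftrightarrow>
    (\<forall>i. p $ i $ 1 = q $ i $ 1 \<and> p $ i $ 2 = q $ i $ 2 \<and> p $ i $ 3 = q $ i $ 3)"
  by (simp add: vec_eq_iff forall_3)

lemma polar_square: "sin al * sin al = 1 - cos al * cos al"
  "sin al * (sin al * x) = x - cos al * (cos al * x)" for x al :: real
proof -
  show s: "sin al * sin al = 1 - cos al * cos al" using sin_cos_squared_add3[of al] by linarith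
  have "sin al * (sin al * x) = sin al * sin al * x" by (simp only: mult.assoc)
  then show "sin al * (sin al * x) = x - cos al * (cos al * x)" unfolding s by (simp add: algebra_simps)
qed

lemma line_inners:
  "line_config al th $ i \<bullet> line_config al th $ j = cos (th j - th i)"
  "line_tangent al th a b $ i \<bullet> line_config al th $ j = a i * sin (th j - th i)"
  "line_config al th $ j \<bullet> line_tangent al th a b $ i = a i * sin (th j - th i)"
  "line_tangent al th a b $ i \<bullet> line_tangent al th a' b' $ j = a i * a' j * cos (th j - th i) + b i * b' j"
  "frame_w al \<bullet> line_config al th $ i = 0"
  by (simp_all add: inner_3 cos_diff sin_diff algebra_simps polar_square)

lemma tangent_is_line_tangent:
  assumes "\<And>i. x $ i \<bullet> line_config al th $ i = 0"
  shows "\<exists>a b. x = line_tangent al th a b"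
proof -
  define \<rho> where "\<rho> = (\<lambda>i. x $ i $ 1 * cos al + x $ i $ 2 * sin al)"
  define a where "a = (\<lambda>i. \<rho> i * cos (th i) - x $ i $ 3 * sin (th i))"
  define b where "b = (\<lambda>i. x $ i $ 2 * cos al - x $ i $ 1 * sin al)"
  have h: "\<rho> i * sin (th i) + x $ i $ 3 * cos (th i) = 0" for i
    using assms[of i] by (simp add: inner_3 \<rho>_def algebra_simps)
  have a1: "a i * cos (th i) = \<rho> i" for i
  proof -
    have "a i * cos (th i) = \<rho> i * cos (th i) * cos (th i) - (x $ i $ 3 * cos (th i)) * sin (th i)"
      by (simp add: a_def algebra_simps)
    also have "x $ i $ 3 * cos (th i) = - \<rho> i * sin (th i)" using h[of i] by linarith
    finally show ?thesis by (simp add: algebra_simps polar_square)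
  qed
  have a2: "a i * sin (th i) = - x $ i $ 3" for i
  proof -
    have "a i * sin (th i) = (\<rho> i * sin (th i)) * cos (th i) - x $ i $ 3 * sin (th i) * sin (th i)"
      by (simp add: a_def algebra_simps)
    also have "\<rho> i * sin (th i) = - x $ i $ 3 * cos (th i)" using h[of i] by linarith
    finally show ?thesis by (simp add: algebra_simps polar_square)
  qed
  have "x = line_tangent al th a b"
    unfolding config_eq_iff by (simp add: a1 a2, simp add: \<rho>_def b_def algebra_simps polar_square)
  then show ?thesis by blast
qed

lemma cot_arccos'_cos: "cot_arccos' (cos x) = 1 / \<bar>sin x\<bar> ^ 3"
  by (simp add: cot_arccos'_def sin_squared_eq[symmetric])

lemma dU_line: "dU m (line_config al th) (line_tangent al th a b) = (\<Sum>i\<in>UNIV. a i * line_force m th i)"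
  by (simp add: dU_def line_inners cot_arccos'_cos line_force_def pair_force_def sum_distrib_left mult_ac)

lemma dI_line: "dI m (line_config al th) (line_tangent al th a b)
    = (\<Sum>i\<in>UNIV. a i * (2 * m i * sin (th i) * cos (th i)))"
  by (simp add: dI_def sum_distrib_left sum_negf mult_ac)

lemma line_config_sphere: "line_config al th \<in> sphere_configs"
  by (simp add: sphere_configs_def norm_eq_1 line_inners)

lemma line_config_nonsingular_iff:
  fixes th :: "'n::{finite,linorder} \<Rightarrow> real"
  assumes "\<And>i. \<bar>th i\<bar> < pi / 2"
  shows "line_config al th \<in> regular_configs \<longleftrightarrow> inj th"
proof
  assume q: "line_config al th \<in> regular_configs"
  show "inj th"
  proof (rule injI, rule ccontr)
    fix i j assume "th i = th j" "i \<noteq> j"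
    then show False using nonsingular_inner[OF q \<open>i \<noteq> j\<close>] by (simp add: line_inners)
  qed
next
  assume inj: "inj th"
  have "line_config al th $ i \<noteq> line_config al th $ j \<and> line_config al th $ i \<noteq> - line_config al th $ j" if "i \<noteq> j" for i j
  proof -
    have "th j - th i \<noteq> 0" using inj that by (simp add: inj_eq)
    moreover have "\<bar>th j - th i\<bar> < pi" using abs_diff_less_double[OF assms assms, of j i] by simp
    ultimately have "sin (th j - th i) \<noteq> 0" using sin_eq_0_pi[of "th j - th i"] by (auto simp: abs_less_iff)
    then have c: "cos (th j - th i) \<noteq> 1" "cos (th j - th i) \<noteq> - 1"
      using sin_squared_eq[of "th j - th i"] by auto
    have 1: "line_config al th $ j \<bullet> line_config al th $ j = 1" by (simp add: line_inners)
    show ?thesis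
    proof (intro conjI notI)
      assume "line_config al th $ i = line_config al th $ j"
      then show False using line_inners(1)[of al th i j] 1 c by simp
    next
      assume "line_config al th $ i = - line_config al th $ j"
      then have "cos (th j - th i) = - 1" using line_inners(1)[of al th i j] 1 by simp
      then show False using c by simp
    qed
  qed
  then show "line_config al th \<in> regular_configs"
    using line_config_sphere by (auto simp: singular_configs_def)
qed

text \<open>The gradients of \<open>U1\<close> and \<open>I1\<close> at such a configuration lie in the plane of the circle, so normal
  variations give no condition.\<close>

lemma line_config_critical_iff:
  fixes th :: "'n::{finite,linorder} \<Rightarrow> real"
  assumes b: "\<And>i. \<bar>th i\<bar> < pi / 2" and inj: "inj th"
  shows "critical_point_on regular_configs (\<lambda>p. U1 m p - l * I1 m p) (line_config al th)
    \<longleftrightarrow> line_balanced m l th" (is "?L \<longleftrightarrow> ?R")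
proof
  assume L: ?L
  show ?R unfolding line_balanced_def
  proof
    fix i :: 'n
    define a :: "'n \<Rightarrow> real" where "a = (\<lambda>j. if j = i then 1 else 0)"
    have "line_tangent al th a a $ j \<bullet> line_config al th $ j = 0" for j by (simp add: line_inners)
    then have "dU m (line_config al th) (line_tangent al th a a) = l * dI m (line_config al th) (line_tangent al th a a)"
      using L unfolding critical_point_on_sphere_iff by blast
    then show "line_force m th i = 2 * l * m i * sin (th i) * cos (th i)"
      unfolding dU_line dI_line a_def by (simp add: if_distrib if_distribR mult_ac cong: if_cong)
  qed
next
  assume R: ?R
  show ?L unfolding critical_point_on_sphere_iff
  proof (intro conjI allI impI)
    fix x :: "'n config" assume "\<forall>i. x $ i \<bullet> line_config al th $ i = 0"
    then obtain a b where x: "x = line_tangent al th a b" using tangent_is_line_tangent by blast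
    show "dU m (line_config al th) x = l * dI m (line_config al th) x"
      using R unfolding x dU_line dI_line line_balanced_def by (simp add: sum_distrib_left mult_ac)
  qed (use line_config_nonsingular_iff[of th] b inj in blast)
qed

lemma line_config_M_set_iff:
  fixes th :: "'n::{finite,linorder} \<Rightarrow> real"
  assumes b: "\<And>i. \<bar>th i\<bar> < pi / 2"
  shows "line_config al th \<in> M_set m c \<longleftrightarrow> inj th \<and> line_moment m th = c"
proof -
  have "cos (th i) > 0" for i using b[of i] by (intro cos_gt_zero_pi) auto
  moreover have "I1 m (line_config al th) = line_moment m th"
    unfolding I1_sphere[OF line_config_sphere] line_moment_def by (simp add: sin_squared_eq)
  ultimately show ?thesis
    unfolding M_set_def using line_config_nonsingular_iff[of th al, OF b] by auto
qed

definition line_solutions :: "('n::finite \<Rightarrow> real) \<Rightarrow> real \<Rightarrow> ('n \<Rightarrow> real) set" where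
  "line_solutions m c = {th. (\<forall>i. \<bar>th i\<bar> < pi / 2) \<and> inj th \<and> line_moment m th = c \<and> (\<exists>l. line_balanced m l th)}"

lemma vertical_circle_line_config:
  fixes q :: "'n::finite config"
  assumes q: "q \<in> sphere_configs" and z: "\<And>i. q $ i $ 3 > 0"
    and w: "w \<noteq> 0" "w $ 3 = 0" "\<And>i. w \<bullet> q $ i = 0"
  shows "\<exists>al th. q = line_config al th \<and> (\<forall>i. \<bar>th i\<bar> < pi / 2)"
proof -
  define n where "n = sqrt ((w $ 1)\<^sup>2 + (w $ 2)\<^sup>2)"
  have "w $ 1 \<noteq> 0 \<or> w $ 2 \<noteq> 0" using w by (auto simp: vec_eq_iff forall_3)
  then have n: "n > 0" by (simp only: n_def real_sqrt_gt_0_iff sum_power2_gt_zero_iff)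
  have "(w $ 2 / n)\<^sup>2 + (- w $ 1 / n)\<^sup>2 = 1"
  proof -
    have "(w $ 2)\<^sup>2 + (w $ 1)\<^sup>2 = n\<^sup>2" by (simp add: n_def add.commute)
    then show ?thesis using n by (simp add: power_divide flip: add_divide_distrib)
  qed
  then obtain al where al: "w $ 2 / n = cos al" "- w $ 1 / n = sin al" using sincos_total_2pi by metis
  then have w12: "w $ 1 = - n * sin al" "w $ 2 = n * cos al" using n by (auto simp: field_simps)
  define \<rho> where "\<rho> = (\<lambda>i. q $ i $ 1 * cos al + q $ i $ 2 * sin al)"
  have perp: "q $ i $ 2 * cos al = q $ i $ 1 * sin al" for i
  proof -
    have "n * (q $ i $ 2 * cos al - q $ i $ 1 * sin al) = 0"
      using w(3)[of i] w(2) by (simp add: inner_3 w12 algebra_simps)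
    then show ?thesis using n by simp
  qed
  have xy: "q $ i $ 1 = \<rho> i * cos al" "q $ i $ 2 = \<rho> i * sin al" for i
  proof -
    have "\<rho> i * cos al = q $ i $ 1 * cos al * cos al + sin al * (q $ i $ 2 * cos al)"
      by (simp add: \<rho>_def algebra_simps)
    then show "q $ i $ 1 = \<rho> i * cos al" unfolding perp by (simp add: algebra_simps polar_square)
    have "\<rho> i * sin al = cos al * (q $ i $ 1 * sin al) + q $ i $ 2 * sin al * sin al"
      by (simp add: \<rho>_def algebra_simps)
    then show "q $ i $ 2 = \<rho> i * sin al" unfolding perp[symmetric] by (simp add: algebra_simps polar_square)
  qed
  have sq: "(\<rho> i)\<^sup>2 + (q $ i $ 3)\<^sup>2 = 1" for i
  proof -
    have "1 = (\<rho> i * cos al)\<^sup>2 + (\<rho> i * sin al)\<^sup>2 + (q $ i $ 3)\<^sup>2"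
      using sphere_configs_inner_self[OF q, of i] by (simp add: inner_3 xy[symmetric] power2_eq_square)
    also have "(\<rho> i * cos al)\<^sup>2 + (\<rho> i * sin al)\<^sup>2 = (\<rho> i)\<^sup>2 * ((sin al)\<^sup>2 + (cos al)\<^sup>2)"
      by (simp only: power_mult_distrib distrib_left add.commute)
    finally show ?thesis by simp
  qed
  have lt: "\<bar>\<rho> i\<bar> < 1" for i
  proof -
    have "(\<rho> i)\<^sup>2 < 1" using sq[of i] z[of i] zero_less_power[OF z[of i], of 2] by linarith
    then show ?thesis by (simp add: abs_square_less_1)
  qed
  define th where "th = (\<lambda>i. arcsin (\<rho> i))"
  have s: "sin (th i) = \<rho> i" and b: "\<bar>th i\<bar> < pi / 2" for i
    using lt[of i] arcsin_lt_bounded[of "\<rho> i"] by (auto simp: th_def abs_less_iff)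
  have "cos (th i) = q $ i $ 3" for i
  proof -
    have "cos (th i) > 0" using b[of i] by (intro cos_gt_zero_pi) auto
    moreover have "(cos (th i))\<^sup>2 = (q $ i $ 3)\<^sup>2" using sq[of i] by (simp add: cos_squared_eq s)
    ultimately show ?thesis using z[of i] by (simp add: power2_eq_iff)
  qed
  then have "q = line_config al th" by (simp add: config_eq_iff s xy)
  then show ?thesis using b by blast
qed

text \<open>Let \<open>w\<close> be the normal of the great circle. Moving a single particle in the direction \<open>w\<close> does not change
  \<open>U1\<close> to first order. As \<open>l \<noteq> 0\<close> for an ordinary central configuration, it does not change \<open>I1\<close> either,
  which means that \<open>w\<close> is horizontal.\<close>

lemma geodesic_occ_vertical:
  assumes q: "q \<in> geodesic_occs m c" and m: "\<And>i. m i > 0"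
  shows "\<exists>w. w \<noteq> 0 \<and> w $ 3 = 0 \<and> (\<forall>i. w \<bullet> q $ i = 0)"
proof -
  have M: "q \<in> sphere_configs" "\<And>i. q $ i $ 3 > 0"
    and occ: "ordinary_central_config m q" and g: "geodesic_config q"
    using q by (auto simp: geodesic_occs_def M_set_def)
  obtain w where w: "w \<noteq> 0" "\<And>i. w \<bullet> q $ i = 0"
    using g unfolding geodesic_config_def great_circle_def by auto
  obtain l where l: "critical_point_on regular_configs (\<lambda>p. U1 m p - l * I1 m p) q"
    using occ unfolding ordinary_central_config_def central_config_def by blast
  have "l \<noteq> 0"
  proof
    assume "l = 0"
    then show False using l occ unfolding ordinary_central_config_def by simp
  qed
  define k :: 'a where "k = undefined"
  define x :: "'a config" where "x = (\<chi> i. if i = k then w else 0)"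
  have "\<forall>i. x $ i \<bullet> q $ i = 0" using w by (simp add: x_def)
  then have "dU m q x = l * dI m q x" using l unfolding critical_point_on_sphere_iff by blast
  moreover have "dU m q x = 0"
    unfolding dU_def by (intro sum.neutral ballI) (use w in \<open>simp add: x_def\<close>)
  ultimately have "dI m q x = 0" using \<open>l \<noteq> 0\<close> by simp
  then have "(\<Sum>i\<in>UNIV. m i * q $ i $ 3 * x $ i $ 3) = 0" by (simp add: dI_def)
  also have "(\<Sum>i\<in>UNIV. m i * q $ i $ 3 * x $ i $ 3) = m k * q $ k $ 3 * w $ 3"
    by (simp add: x_def if_distrib if_distribR cong: if_cong)
  finally have "w $ 3 = 0" using m[of k] M(2)[of k] by simp
  then show ?thesis using w by blast
qed

theorem geodesic_occs_eq:
  fixes m :: "'n::{finite,linorder} \<Rightarrow> real"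
  assumes m: "\<And>i. m i > 0" and n: "CARD('n) \<ge> 2"
  shows "geodesic_occs m c = {line_config al th | al th. th \<in> line_solutions m c}"
proof (intro set_eqI iffI)
  fix q assume q: "q \<in> geodesic_occs m c"
  then have M: "q \<in> M_set m c" by (simp add: geodesic_occs_def)
  obtain w where "w \<noteq> 0" "w $ 3 = 0" "\<And>i. w \<bullet> q $ i = 0" using geodesic_occ_vertical[OF q m] by blast
  moreover have "q \<in> sphere_configs" "\<And>i. q $ i $ 3 > 0" using M by (auto simp: M_set_def)
  ultimately obtain al th where th: "q = line_config al th" "\<And>i. \<bar>th i\<bar> < pi / 2"
    using vertical_circle_line_config by blast
  have inj: "inj th" and I: "line_moment m th = c"
    using M line_config_M_set_iff[of th] th by blast+
  obtain l where "critical_point_on regular_configs (\<lambda>p. U1 m p - l * I1 m p) q"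
    using q unfolding geodesic_occs_def ordinary_central_config_def central_config_def by blast
  then have "line_balanced m l th" using line_config_critical_iff[of th] th inj by blast
  then have "th \<in> line_solutions m c" using th inj I by (auto simp: line_solutions_def)
  then show "q \<in> {line_config al th | al th. th \<in> line_solutions m c}" using th by blast
next
  fix q assume "q \<in> {line_config al th | al th. th \<in> line_solutions m c}"
  then obtain al th l where q: "q = line_config al th" and th: "\<And>i. \<bar>th i\<bar> < pi / 2" "inj th"
    "line_moment m th = c" "line_balanced m l th" by (auto simp: line_solutions_def)
  have "q \<in> M_set m c" using line_config_M_set_iff[of th] q th by blast
  moreover have "central_config m q"
    unfolding central_config_def q using line_config_critical_iff[of th] th by blast
  moreover have "\<not> critical_point_on regular_configs (U1 m) q"
  proof
    assume "critical_point_on regular_configs (U1 m) q"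
    then have "line_balanced m 0 th"
      using line_config_critical_iff[of th m 0 al] q th by simp
    then show False using line_multiplier_neg[of m th 0] m n th by blast
  qed
  moreover have "geodesic_config q"
  proof -
    have "frame_w al \<noteq> 0"
    proof
      assume "frame_w al = 0"
      then have "sin al = 0" "cos al = 0" using frame_w_nth[of al] by simp_all
      then show False using sin_cos_squared_add[of al] by simp
    qed
    moreover have "q $ i \<in> {p \<in> sphere 0 1. frame_w al \<bullet> p = 0}" for i
      using line_config_sphere[of al th] by (simp add: q line_inners sphere_configs_def)
    ultimately show ?thesis unfolding geodesic_config_def great_circle_def by blast
  qed
  ultimately show "q \<in> geodesic_occs m c" by (simp add: geodesic_occs_def ordinary_central_config_def)
qed

lemma rotate_line_config: "rotate_z \<beta> (line_config al th) = line_config (al + \<beta>) th"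
  by (simp add: config_eq_iff rotate_z_def cos_add sin_add algebra_simps)

lemma orbit_line_config: "orbit_z (line_config al th) = range (\<lambda>\<beta>. line_config \<beta> th)"
proof -
  have "line_config \<beta> th = rotate_z (\<beta> - al) (line_config al th)" for \<beta> by (simp add: rotate_line_config)
  then have "line_config \<beta> th \<in> orbit_z (line_config al th)" for \<beta> unfolding orbit_z_def by blast
  then show ?thesis by (auto simp: orbit_z_def rotate_line_config)
qed

section \<open>The Hessian on the quotient\<close>

lemma C2_curve_in_derivs:
  assumes "C2_curve_in M p v g"
  obtains e g' g'' where "e > 0" "g 0 = p" "g' 0 = v"
    "\<And>t. \<bar>t\<bar> < e \<Longrightarrow> g t \<in> M" "\<And>t. \<bar>t\<bar> < e \<Longrightarrow> (g has_vector_derivative g' t) (at t)"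
    "\<And>t. \<bar>t\<bar> < e \<Longrightarrow> (g' has_vector_derivative g'' t) (at t)"
proof -
  from assms obtain e g' g'' where *: "e > 0" "g 0 = p" "g' 0 = v"
    "\<forall>t\<in>{-e<..<e}. g t \<in> M \<and> (g has_vector_derivative g' t) (at t) \<and> (g' has_vector_derivative g'' t) (at t)"
    unfolding C2_curve_in_def by blast
  have "t \<in> {-e<..<e}" if "\<bar>t\<bar> < e" for t using that by auto
  with * show ?thesis by (intro that[of e g' g'']) auto
qed

lemma eventually_nhds_abs_less: "\<bar>t\<bar> < e \<Longrightarrow> (\<And>s. \<bar>s\<bar> < e \<Longrightarrow> P s) \<Longrightarrow> eventually P (nhds t)"
  for t e :: real
  using eventually_nhds_in_open[of "{-e<..<e}" t] by (auto simp: abs_less_iff elim!: eventually_mono)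

lemma C2_curve_in_M_set_dI:
  assumes g: "C2_curve_in (M_set m c) q v g"
  shows "dI m q v = 0"
proof -
  from g obtain e g' g'' where e: "e > 0" "g 0 = q" "g' 0 = v"
    and M: "\<And>t. \<bar>t\<bar> < e \<Longrightarrow> g t \<in> M_set m c"
    and D: "\<And>t. \<bar>t\<bar> < e \<Longrightarrow> (g has_vector_derivative g' t) (at t)"
    by (rule C2_curve_in_derivs) blast
  have "eventually (\<lambda>t. g t \<in> sphere_configs) (nhds 0)"
    by (rule eventually_nhds_abs_less[of 0 e]) (use e M in \<open>auto simp: M_set_def\<close>)
  from I1_has_derivative[OF D this, of m] e
  have "((\<lambda>t. I1 m (g t)) has_real_derivative dI m q v) (at 0)" by simp
  moreover have "eventually (\<lambda>t. I1 m (g t) = c) (nhds 0)"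
    by (rule eventually_nhds_abs_less[of 0 e]) (use e M in \<open>auto simp: M_set_def\<close>)
  then have "((\<lambda>t. I1 m (g t)) has_real_derivative 0) (at 0)" by (simp add: DERIV_cong_ev)
  ultimately show ?thesis by (rule DERIV_unique)
qed

text \<open>In the coordinates \<open>(x, y)\<close> of all particles, \<open>I1\<close> is a definite quadratic form, so a straight
  line orthogonal to the position becomes a curve in \<open>I1 = c\<close> when it is divided by \<open>sqrt (1 + t\<^sup>2 k)\<close>. The
  coordinate \<open>z\<close> is determined by the sphere and is \<open>sqrt (P i t)\<close> divided by the same root, with a
  quadratic polynomial \<open>P i\<close>.\<close>

lemma C2_curve_in_M_set_exists:
  assumes q: "q \<in> M_set m c" and c: "c > 0" and v: "\<And>i. v $ i \<bullet> q $ i = 0" "dI m q v = 0"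
  shows "\<exists>g. C2_curve_in (M_set m c) q v g"
proof -
  have sph: "q \<in> sphere_configs" and sing: "q \<notin> singular_configs" and I: "I1 m q = c"
    and z: "\<And>i. q $ i $ 3 > 0" using q by (auto simp: M_set_def)
  let ?q1 = "\<lambda>i. q $ i $ 1" and ?q2 = "\<lambda>i. q $ i $ 2" and ?q3 = "\<lambda>i. q $ i $ 3"
    and ?v1 = "\<lambda>i. v $ i $ 1" and ?v2 = "\<lambda>i. v $ i $ 2" and ?v3 = "\<lambda>i. v $ i $ 3"
  let ?mix = "\<Sum>i\<in>UNIV. m i * (?q1 i * ?v1 i + ?q2 i * ?v2 i)"
  have qq: "?q1 i * ?q1 i + ?q2 i * ?q2 i + ?q3 i * ?q3 i = 1" for i
    using sphere_configs_inner_self[OF sph, of i] by (simp add: inner_3)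
  have vq: "?v1 i * ?q1 i + ?v2 i * ?q2 i + ?v3 i * ?q3 i = 0" for i
    using v(1)[of i] by (simp add: inner_3)
  define k where "k = (\<Sum>i\<in>UNIV. m i * ((?v1 i)\<^sup>2 + (?v2 i)\<^sup>2)) / c"
  define R where "R = (\<lambda>t::real. 1 / sqrt (1 + t\<^sup>2 * k))"
  define P where "P = (\<lambda>i t. (?q3 i)\<^sup>2 + t * (2 * ?q3 i * ?v3 i) + t\<^sup>2 * (k - (?v1 i)\<^sup>2 - (?v2 i)\<^sup>2))"
  let ?N = "\<lambda>i t. (?q1 i + t * ?v1 i) * (?q1 i + t * ?v1 i)
          + (?q2 i + t * ?v2 i) * (?q2 i + t * ?v2 i) + P i t"
  define h :: "'a \<Rightarrow> real \<Rightarrow> real^3" where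
    "h = (\<lambda>i t. vector [?q1 i + t * ?v1 i, ?q2 i + t * ?v2 i, sqrt (P i t)])"
  define g :: "real \<Rightarrow> 'a config" where "g = (\<lambda>t. \<chi> i. \<chi> j. R t * h i t $ j)"
  have R: "C2_curve_in UNIV 1 0 R" unfolding R_def by (rule C2_curve_in_inv_sqrt)
  have P: "C2_curve_in UNIV ((?q3 i)\<^sup>2) (2 * ?q3 i * ?v3 i) (P i)" for i
    unfolding P_def by (rule C2_curve_in_polynomial)
  have h: "C2_curve_in UNIV (q $ i $ j) (v $ i $ j) (\<lambda>t. h i t $ j)" for i j
  proof -
    have "C2_curve_in UNIV (?q3 i) (?v3 i) (\<lambda>t. sqrt (P i t))"
      using C2_curve_in_sqrt[OF P[of i]] z[of i] by simp
    then have "\<forall>j. C2_curve_in UNIV (q $ i $ j) (v $ i $ j) (\<lambda>t. h i t $ j)"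
      unfolding forall_3 h_def by (simp add: C2_curve_in_linear)
    then show ?thesis ..
  qed
  have "C2_curve_in UNIV (1 * q $ i $ j) (1 * v $ i $ j + 0 * q $ i $ j) (\<lambda>t. R t * h i t $ j)" for i j
    by (rule C2_curve_in_mult[OF R h])
  then have C2: "C2_curve_in UNIV q v g" unfolding g_def by (intro C2_curve_in_vec) simp
  have tend: "(f \<longlongrightarrow> p) (nhds 0)" if "C2_curve_in UNIV p w f" for f and p w :: real
    using C2_curve_in_isCont[OF that] that unfolding C2_curve_in_def isCont_def
    by (metis tendsto_at_iff_tendsto_nhds)
  have ev1: "eventually (\<lambda>t. \<forall>i. P i t > 0) (nhds 0)"
    by (intro eventually_all_finite order_tendstoD(1)[OF tend[OF P]]) (simp add: less_imp_neq[OF z, symmetric])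
  have ev2: "eventually (\<lambda>t. 1 + t\<^sup>2 * k > 0) (nhds 0)"
    by (rule order_tendstoD(1)[OF tend[OF C2_curve_in_polynomial[of 1 0 k], simplified]]) simp
  have ev3: "eventually (\<lambda>t. g t \<notin> singular_configs) (nhds 0)"
    using sing C2 by (intro eventually_not_singular C2_curve_in_isCont[OF C2]) (simp add: C2_curve_in_def)
  have "eventually (\<lambda>t. g t \<in> M_set m c) (nhds 0)"
    using ev1 ev2 ev3
  proof eventually_elim
    case (elim t)
    have RR: "R t * R t * (1 + t\<^sup>2 * k) = 1" and Rp: "R t > 0" using elim(2) by (simp_all add: R_def)
    have g3: "g t $ i $ 1 = R t * (?q1 i + t * ?v1 i)" "g t $ i $ 2 = R t * (?q2 i + t * ?v2 i)"
      "g t $ i $ 3 = R t * sqrt (P i t)" for i by (simp_all add: g_def h_def)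
    have "g t $ i \<bullet> g t $ i = 1" for i
    proof -
      have "?N i t
        = (?q1 i * ?q1 i + ?q2 i * ?q2 i + ?q3 i * ?q3 i)
          + 2 * t * (?v1 i * ?q1 i + ?v2 i * ?q2 i + ?v3 i * ?q3 i) + t\<^sup>2 * k"
        by (simp add: P_def power2_eq_square algebra_simps)
      also have "\<dots> = 1 + t\<^sup>2 * k" unfolding qq vq by simp
      finally have s: "?N i t = 1 + t\<^sup>2 * k" .
      have "sqrt (P i t) * sqrt (P i t) = P i t" using elim(1) by (simp add: less_imp_le)
      then have "g t $ i \<bullet> g t $ i = R t * R t * (?N i t)"
        unfolding inner_3 g3 by (simp add: algebra_simps)
      then show ?thesis unfolding s RR .
    qed
    then have "g t \<in> sphere_configs" by (simp add: sphere_configs_def norm_eq_1)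
    moreover have "I1 m (g t) = c"
    proof -
      have "0 = (\<Sum>i\<in>UNIV. m i * (?q3 i * ?v3 i))" using v(2) by (simp add: dI_def mult.assoc)
      also have "\<dots> = (\<Sum>i\<in>UNIV. - (m i * (?q1 i * ?v1 i + ?q2 i * ?v2 i)))"
      proof (rule sum.cong[OF refl])
        fix i
        have "?q3 i * ?v3 i = - (?q1 i * ?v1 i + ?q2 i * ?v2 i)"
          using vq[of i] by (simp add: mult.commute)
        then show "m i * (?q3 i * ?v3 i) = - (m i * (?q1 i * ?v1 i + ?q2 i * ?v2 i))"
          by (metis mult_minus_right)
      qed
      finally have s0: "?mix = 0"
        by (simp add: sum_negf)
      have "I1 m (g t) = (\<Sum>i\<in>UNIV. R t * R t * (m i * ((?q1 i)\<^sup>2 + (?q2 i)\<^sup>2)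
          + 2 * t * (m i * (?q1 i * ?v1 i + ?q2 i * ?v2 i))
          + t\<^sup>2 * (m i * ((?v1 i)\<^sup>2 + (?v2 i)\<^sup>2))))"
        unfolding I1_def g3 by (intro sum.cong refl) (simp add: power2_eq_square algebra_simps)
      also have "\<dots> = R t * R t * (I1 m q + 2 * t * ?mix
          + t\<^sup>2 * (\<Sum>i\<in>UNIV. m i * ((?v1 i)\<^sup>2 + (?v2 i)\<^sup>2)))"
        unfolding I1_def sum_distrib_left sum.distrib[symmetric] ..
      also have "(\<Sum>i\<in>UNIV. m i * ((?v1 i)\<^sup>2 + (?v2 i)\<^sup>2)) = c * k" using c by (simp add: k_def)
      also have "R t * R t * (I1 m q + 2 * t * ?mix
          + t\<^sup>2 * (c * k)) = c * (R t * R t * (1 + t\<^sup>2 * k))"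
        unfolding s0 I by (simp add: algebra_simps)
      finally show ?thesis unfolding RR by simp
    qed
    moreover have "g t $ i $ 3 > 0" for i using elim(1) Rp unfolding g3 by simp
    ultimately show ?case using elim(3) by (auto simp: M_set_def)
  qed
  then show ?thesis using C2_curve_in_eventually[OF C2] by blast
qed

theorem tangent_space_M_set:
  assumes "q \<in> M_set m c" "c > 0"
  shows "tangent_space (M_set m c) q = {v. (\<forall>i. v $ i \<bullet> q $ i = 0) \<and> dI m q v = 0}"
  unfolding tangent_space_def
  using C2_curve_in_M_set_exists[OF assms] C2_curve_in_M_set_dI C2_curve_in_tangent_sphere[of "M_set m c"]
  by (auto simp: M_set_def)

lemma has_second_derivative_unique:
  assumes "has_second_derivative f h t" "has_second_derivative f k t"
  shows "h = k"
proof -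
  obtain f1 f2 where f1: "\<forall>\<^sub>F s in nhds t. (f has_real_derivative f1 s) (at s)" "(f1 has_real_derivative h) (at t)"
    and f2: "\<forall>\<^sub>F s in nhds t. (f has_real_derivative f2 s) (at s)" "(f2 has_real_derivative k) (at t)"
    using assms unfolding has_second_derivative_def by blast
  have "\<forall>\<^sub>F s in nhds t. f1 s = f2 s" using f1(1) f2(1) by eventually_elim (rule DERIV_unique)
  then have "(f2 has_real_derivative h) (at t)" using f1(2) by (simp add: DERIV_cong_ev)
  then show ?thesis using f2(2) DERIV_unique by blast
qed

lemma inner_rotate_z: "rotate_z a q $ i \<bullet> rotate_z a q $ j = q $ i \<bullet> q $ j"
  by (simp add: rotate_z_def inner_3 algebra_simps polar_square)

lemma induced_fun_U1: "induced_fun (U1 m) (orbit_z q) = U1 m q"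
proof -
  have "U1 m (rotate_z a q) = U1 m q" for a by (simp add: U1_def sdist_def inner_rotate_z)
  then have "U1 m ` orbit_z q = {U1 m q}" unfolding orbit_z_def image_image by simp
  then show ?thesis by (simp add: induced_fun_def)
qed

text \<open>The Hessian at a critical point with multiplier \<open>l\<close>. The acceleration of a curve in the sphere has the
  normal component \<open>- (v $ i \<bullet> v $ i)\<close>; its tangential component enters only through \<open>dI\<close>, and the second
  derivative of the constraint \<open>I1 = c\<close> eliminates it. This leaves an expression in the velocity \<open>v\<close>.\<close>

definition constrained_hessian ::
    "('n::{finite,linorder} \<Rightarrow> real) \<Rightarrow> real \<Rightarrow> 'n config \<Rightarrow> 'n config \<Rightarrow> real" where
  "constrained_hessian m l q v = d2U m q v - dU m q (\<chi> i. (v $ i \<bullet> v $ i) *\<^sub>R q $ i)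
     + l * (dI m q (\<chi> i. (v $ i \<bullet> v $ i) *\<^sub>R q $ i) + 2 * (\<Sum>i\<in>UNIV. m i * (v $ i $ 3)\<^sup>2))"

lemma dU_add: "dU m q (x + y) = dU m q x + dU m q y"
  by (simp add: dU_def inner_add_left sum.distrib[symmetric] algebra_simps)

lemma dI_add: "dI m q (x + y) = dI m q x + dI m q y"
  by (simp add: dI_def sum.distrib algebra_simps)

lemma U1_second_derivative:
  assumes crit: "\<And>x. (\<And>i. x $ i \<bullet> q $ i = 0) \<Longrightarrow> dU m q x = l * dI m q x"
    and g: "C2_curve_in (M_set m c) q v g"
  shows "has_second_derivative (\<lambda>t. U1 m (g t)) (constrained_hessian m l q v) 0"
proof -
  from g obtain e g' g'' where e: "e > 0" "g 0 = q" "g' 0 = v"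
    and M: "\<And>t. \<bar>t\<bar> < e \<Longrightarrow> g t \<in> M_set m c"
    and D: "\<And>t. \<bar>t\<bar> < e \<Longrightarrow> (g has_vector_derivative g' t) (at t)"
    and D2: "\<And>t. \<bar>t\<bar> < e \<Longrightarrow> (g' has_vector_derivative g'' t) (at t)"
    by (rule C2_curve_in_derivs) blast
  have S: "g t \<in> regular_configs" "g t \<in> sphere_configs" "I1 m (g t) = c" if "\<bar>t\<bar> < e" for t
    using M[OF that] by (auto simp: M_set_def)
  define a where "a = g'' 0"
  define nv where "nv = (\<chi> i. (v $ i \<bullet> v $ i) *\<^sub>R q $ i)"
  have qq: "q $ i \<bullet> q $ i = 1" for i using S(2)[of 0] e by (auto intro: sphere_configs_inner_self)
  have vzero: "g' t $ i \<bullet> g t $ i = 0" if t: "\<bar>t\<bar> < e" for t i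
  proof -
    have "((\<lambda>t. g t $ i \<bullet> g t $ i) has_real_derivative (g t $ i \<bullet> g' t $ i + g' t $ i \<bullet> g t $ i)) (at t)"
      by (intro has_real_derivative_inner has_vector_derivative_vec_nth D t)
    moreover have "eventually (\<lambda>t. g t $ i \<bullet> g t $ i = 1) (nhds t)"
      by (rule eventually_nhds_abs_less[OF t]) (rule sphere_configs_inner_self[OF S(2)])
    then have "((\<lambda>t. g t $ i \<bullet> g t $ i) has_real_derivative 0) (at t)" by (simp add: DERIV_cong_ev)
    ultimately have "g t $ i \<bullet> g' t $ i + g' t $ i \<bullet> g t $ i = 0" by (rule DERIV_unique)
    then show ?thesis by (simp add: inner_commute)
  qed
  have anormal: "a $ i \<bullet> q $ i = - (v $ i \<bullet> v $ i)" for i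
  proof -
    have "((\<lambda>t. g' t $ i \<bullet> g t $ i) has_real_derivative (g' 0 $ i \<bullet> g' 0 $ i + g'' 0 $ i \<bullet> g 0 $ i)) (at 0)"
      by (intro has_real_derivative_inner has_vector_derivative_vec_nth D D2) (use e in auto)
    moreover have "eventually (\<lambda>t. g' t $ i \<bullet> g t $ i = 0) (nhds 0)"
      by (rule eventually_nhds_abs_less[of 0 e]) (use e vzero in auto)
    then have "((\<lambda>t. g' t $ i \<bullet> g t $ i) has_real_derivative 0) (at 0)" by (simp add: DERIV_cong_ev)
    ultimately have "g' 0 $ i \<bullet> g' 0 $ i + g'' 0 $ i \<bullet> g 0 $ i = 0" by (rule DERIV_unique)
    then show ?thesis by (simp add: e a_def)
  qed
  have azero: "dI m q a = 2 * (\<Sum>i\<in>UNIV. m i * (v $ i $ 3)\<^sup>2)"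
  proof -
    have dIz: "dI m (g t) (g' t) = 0" if t: "\<bar>t\<bar> < e" for t
    proof -
      have "((\<lambda>t. I1 m (g t)) has_real_derivative dI m (g t) (g' t)) (at t)"
        by (rule I1_has_derivative[OF D[OF t] eventually_nhds_abs_less[OF t S(2)]])
      moreover have "((\<lambda>t. I1 m (g t)) has_real_derivative 0) (at t)"
        using eventually_nhds_abs_less[OF t, of "\<lambda>t. I1 m (g t) = c"] S(3) by (simp add: DERIV_cong_ev)
      ultimately show ?thesis by (rule DERIV_unique)
    qed
    have z: "((\<lambda>t. g t $ i $ 3) has_real_derivative v $ i $ 3) (at 0)"
      "((\<lambda>t. g' t $ i $ 3) has_real_derivative a $ i $ 3) (at 0)" for i
      using D[of 0] D2[of 0] e unfolding has_real_derivative_iff_has_vector_derivative a_def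
      by (auto intro!: has_vector_derivative_vec_nth)
    have "((\<lambda>t. m i * g t $ i $ 3 * g' t $ i $ 3) has_real_derivative
        m i * (v $ i $ 3 * v $ i $ 3 + q $ i $ 3 * a $ i $ 3)) (at 0)" for i
      using DERIV_cmult[OF DERIV_mult[OF z(1)[of i] z(2)[of i]], of "m i"] by (simp add: e mult_ac algebra_simps)
    then have "((\<lambda>t. dI m (g t) (g' t)) has_real_derivative
        - 2 * (\<Sum>i\<in>UNIV. m i * (v $ i $ 3 * v $ i $ 3 + q $ i $ 3 * a $ i $ 3))) (at 0)"
      unfolding dI_def by (intro DERIV_cmult DERIV_sum)
    moreover have "((\<lambda>t. dI m (g t) (g' t)) has_real_derivative 0) (at 0)"
      using eventually_nhds_abs_less[of 0 e "\<lambda>t. dI m (g t) (g' t) = 0"] dIz e by (simp add: DERIV_cong_ev)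
    ultimately have "- 2 * (\<Sum>i\<in>UNIV. m i * (v $ i $ 3 * v $ i $ 3 + q $ i $ 3 * a $ i $ 3)) = 0"
      by (rule DERIV_unique)
    then show ?thesis unfolding dI_def by (simp add: sum.distrib algebra_simps power2_eq_square)
  qed
  \<comment> \<open>The tangential part of the acceleration \<open>a\<close> is \<open>a + nv\<close>; criticality applies to it.\<close>
  have "(a + nv) $ i \<bullet> q $ i = 0" for i using anormal[of i] qq[of i] by (simp add: nv_def inner_add_left)
  from crit[of "a + nv", OF this] have dUa: "dU m q a = l * (dI m q a + dI m q nv) - dU m q nv"
    unfolding dU_add dI_add by simp
  have "((\<lambda>s. dU m (g s) (g' s)) has_real_derivative d2U m (g 0) (g' 0) + dU m (g 0) (g'' 0)) (at 0)"
    by (rule dU_has_derivative[where e = e]) (use D D2 S e in auto)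
  also have "d2U m (g 0) (g' 0) + dU m (g 0) (g'' 0) = constrained_hessian m l q v"
    using dUa by (simp add: e a_def[symmetric] constrained_hessian_def nv_def[symmetric] azero algebra_simps)
  finally have 2: "((\<lambda>s. dU m (g s) (g' s)) has_real_derivative constrained_hessian m l q v) (at 0)" .
  have "((\<lambda>t. U1 m (g t)) has_real_derivative dU m (g t) (g' t)) (at t)" if t: "\<bar>t\<bar> < e" for t
    by (rule U1_has_derivative[OF D[OF t] eventually_nhds_abs_less[OF t S(1)]])
  then have "\<forall>\<^sub>F t in nhds 0. ((\<lambda>t. U1 m (g t)) has_real_derivative dU m (g t) (g' t)) (at t)"
    by (intro eventually_nhds_abs_less[of 0 e]) (use e in auto)
  then show ?thesis using 2 unfolding has_second_derivative_def
    by (intro exI[of _ "\<lambda>s. dU m (g s) (g' s)"]) auto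
qed

theorem quotient_hessian_eq:
  assumes crit: "\<And>x. (\<And>i. x $ i \<bullet> q $ i = 0) \<Longrightarrow> dU m q x = l * dI m q x"
    and v: "v \<in> tangent_space (M_set m c) q"
  shows "quotient_hessian m c q v = constrained_hessian m l q v"
  unfolding quotient_hessian_def induced_fun_U1
proof (rule the_equality)
  show "\<forall>g. C2_curve_in (M_set m c) q v g \<longrightarrow>
      has_second_derivative (\<lambda>t. U1 m (g t)) (constrained_hessian m l q v) 0"
    using U1_second_derivative[OF crit] by blast
next
  fix h assume h: "\<forall>g. C2_curve_in (M_set m c) q v g \<longrightarrow> has_second_derivative (\<lambda>t. U1 m (g t)) h 0"
  obtain g where g: "C2_curve_in (M_set m c) q v g" using v unfolding tangent_space_def by blast
  from has_second_derivative_unique[OF h[rule_format, OF g] U1_second_derivative[OF crit g]]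
  show "h = constrained_hessian m l q v" .
qed

section \<open>The Hessian at a geodesic configuration\<close>

definition weight :: "('n \<Rightarrow> real) \<Rightarrow> ('n \<Rightarrow> real) \<Rightarrow> 'n \<Rightarrow> 'n \<Rightarrow> real" where
  "weight m th i j = m i * m j / \<bar>sin (th j - th i)\<bar> ^ 3"

lemma weight_diag [simp]: "weight m th i i = 0" by (simp add: weight_def)

lemma weight_commute: "weight m th i j = weight m th j i"
proof -
  have "\<bar>sin (th j - th i)\<bar> = \<bar>sin (th i - th j)\<bar>" by (metis abs_minus_cancel minus_diff_eq sin_minus)
  then show ?thesis by (simp add: weight_def mult.commute)
qed

lemma line_force_weight: "line_force m th i = (\<Sum>j\<in>UNIV. weight m th i j * sin (th j - th i))"
  by (simp add: line_force_def weight_def pair_force_def)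

lemma weight_symmetrize:
  "(\<Sum>i\<in>UNIV. \<Sum>j\<in>UNIV. weight m th i j * (cos (th j - th i) * N i))
    = (\<Sum>i\<in>UNIV. \<Sum>j\<in>UNIV. weight m th i j * (cos (th j - th i) * (N i + N j))) / 2"
  for th :: "'n::finite \<Rightarrow> real"
proof -
  have "(\<Sum>i\<in>UNIV. \<Sum>j\<in>UNIV. weight m th i j * (cos (th j - th i) * N j))
      = (\<Sum>i\<in>UNIV. \<Sum>j\<in>UNIV. weight m th i j * (cos (th j - th i) * N i))"
    by (subst sum.swap, intro sum.cong refl, subst weight_commute, subst cos_minus[symmetric]) simp
  then show ?thesis by (simp only: distrib_left sum.distrib) simp
qed

text \<open>At a configuration on a great circle the Hessian splits into a form in the tangential components
  \<open>a\<close> and a form in the normal components \<open>b\<close>; on the diagonal of the double sums \<open>weight\<close> vanishes.\<close>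

definition tangential_form ::
    "('n::finite \<Rightarrow> real) \<Rightarrow> real \<Rightarrow> ('n \<Rightarrow> real) \<Rightarrow> ('n \<Rightarrow> real) \<Rightarrow> ('n \<Rightarrow> real) \<Rightarrow> real" where
  "tangential_form m l th a a' =
     (\<Sum>i\<in>UNIV. \<Sum>j\<in>UNIV. weight m th i j * cos (th j - th i) * ((a i - a j) * (a' i - a' j)))
     - 2 * l * (\<Sum>i\<in>UNIV. m i * cos (2 * th i) * (a i * a' i))"

definition normal_form ::
    "('n::finite \<Rightarrow> real) \<Rightarrow> real \<Rightarrow> ('n \<Rightarrow> real) \<Rightarrow> ('n \<Rightarrow> real) \<Rightarrow> ('n \<Rightarrow> real) \<Rightarrow> real" where
  "normal_form m l th b b' =
     (\<Sum>i\<in>UNIV. \<Sum>j\<in>UNIV. weight m th i j * (b i * b' j - cos (th j - th i) * (b i * b' i)))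
     - 2 * l * (\<Sum>i\<in>UNIV. m i * (cos (th i))\<^sup>2 * (b i * b' i))"

lemma line_hessian:
  "constrained_hessian m l (line_config al th) (line_tangent al th a b)
    = tangential_form m l th a a + normal_form m l th b b"
proof -
  let ?W = "weight m th" and ?c = "\<lambda>i j. cos (th j - th i)" and ?n = "\<lambda>i. a i * a i + b i * b i"
  let ?Sn = "\<Sum>i\<in>UNIV. \<Sum>j\<in>UNIV. ?W i j * (?c i j * (?n i + ?n j))"
    and ?S1 = "\<Sum>i\<in>UNIV. \<Sum>j\<in>UNIV. ?W i j * (3 * ?c i j * (a i - a j)\<^sup>2 + 2 * (a i * a j * ?c i j + b i * b j))"
    and ?S2 = "\<Sum>i\<in>UNIV. \<Sum>j\<in>UNIV. ?W i j * (?c i j * ((a i - a j) * (a i - a j)))"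
    and ?S3 = "\<Sum>i\<in>UNIV. \<Sum>j\<in>UNIV. ?W i j * (?c i j * (b i * b i + b j * b j))"
    and ?S4 = "\<Sum>i\<in>UNIV. m i * (cos (2 * th i) * (a i * a i))"
    and ?S5 = "\<Sum>i\<in>UNIV. m i * ((cos (th i))\<^sup>2 * (b i * b i))"
    and ?S6 = "\<Sum>i\<in>UNIV. m i * ((cos (th i))\<^sup>2 * ?n i)"
  have w: "m i * m j * (cot_arccos'' (?c i j) * (a i * sin (th j - th i) + a j * sin (th i - th j))\<^sup>2
      + 2 * cot_arccos' (?c i j) * X)
    = ?W i j * (3 * ?c i j * (a i - a j)\<^sup>2 + 2 * X)" for i j X
  proof -
    define s where "s = sin (th j - th i)"
    have s': "sin (th i - th j) = - s" unfolding s_def by (metis minus_diff_eq sin_minus)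
    have "cot_arccos'' (?c i j) = 3 * ?c i j / \<bar>s\<bar> ^ 5"
      by (simp add: cot_arccos''_def s_def sin_squared_eq[symmetric])
    moreover have "(a i * s + a j * (- s))\<^sup>2 = \<bar>s\<bar>\<^sup>2 * (a i - a j)\<^sup>2"
      by (simp add: power2_eq_square algebra_simps)
    moreover have "3 * ?c i j / \<bar>s\<bar> ^ 5 * (\<bar>s\<bar>\<^sup>2 * (a i - a j)\<^sup>2) = 3 * ?c i j * (a i - a j)\<^sup>2 / \<bar>s\<bar> ^ 3"
    proof (cases "s = 0")
      case False
      have "\<bar>s\<bar> ^ 5 = \<bar>s\<bar>\<^sup>2 * \<bar>s\<bar> ^ 3" by (simp only: power_add[symmetric]) simp
      then show ?thesis using False by simp
    qed simp
    ultimately show ?thesis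
      unfolding s' weight_def s_def[symmetric] cot_arccos'_cos by (simp add: s_def[symmetric] algebra_simps add_divide_distrib)
  qed
  have "d2U m (line_config al th) (line_tangent al th a b)
      = ?S1 / 2"
    unfolding d2U_def line_inners w ..
  moreover have "dU m (line_config al th) (\<chi> i. ?n i *\<^sub>R line_config al th $ i)
      = ?Sn / 2"
    unfolding weight_symmetrize[of m th ?n, symmetric]
    by (simp add: dU_def line_inners cot_arccos'_cos weight_def mult_ac)
  moreover have "dI m (line_config al th) (\<chi> i. ?n i *\<^sub>R line_config al th $ i)
      = - 2 * ?S6"
    by (simp add: dI_def power2_eq_square mult_ac)
  ultimately have "constrained_hessian m l (line_config al th) (line_tangent al th a b) =
     ?S1 / 2
     - ?Sn / 2
     + l * (- 2 * ?S6 + 2 * (\<Sum>i\<in>UNIV. m i * (a i * sin (th i))\<^sup>2))"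
    unfolding constrained_hessian_def by (simp add: line_inners)
  also have "\<dots> = ?S2
     + ((\<Sum>i\<in>UNIV. \<Sum>j\<in>UNIV. ?W i j * (b i * b j)) - ?S3 / 2)
     - 2 * l * (?S4 + ?S5)"
  proof -
    have "?S1 / 2
     - ?Sn / 2
     = ?S2
     + ((\<Sum>i\<in>UNIV. \<Sum>j\<in>UNIV. ?W i j * (b i * b j)) - ?S3 / 2)"
      unfolding sum_divide_distrib sum_subtractf[symmetric] sum.distrib[symmetric]
      by (intro sum.cong refl) (simp add: power2_eq_square field_simps)
    moreover have "- 2 * ?S6 + 2 * (\<Sum>i\<in>UNIV. m i * (a i * sin (th i))\<^sup>2)
      = - 2 * (?S4 + ?S5)"
      unfolding sum_distrib_left sum.distrib[symmetric] cos_double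
      by (intro sum.cong refl) (simp add: power2_eq_square algebra_simps)
    ultimately show ?thesis by (simp only: mult.assoc mult_minus_left mult_minus_right)
  qed
  also have "?S3 / 2
      = (\<Sum>i\<in>UNIV. \<Sum>j\<in>UNIV. ?W i j * (?c i j * (b i * b i)))"
    by (rule weight_symmetrize[symmetric])
  finally show ?thesis
    unfolding tangential_form_def normal_form_def
    by (simp add: right_diff_distrib distrib_left sum_subtractf mult.assoc)
qed

lemma tangential_form_pos:
  fixes th :: "'n::finite \<Rightarrow> real"
  assumes m: "\<And>i. m i > 0" and l: "l < 0" and b: "\<And>i. \<bar>th i\<bar> < pi / 4" and a: "a \<noteq> (\<lambda>_. 0)"
  shows "tangential_form m l th a a > 0"
proof -
  have "weight m th i j * cos (th j - th i) * ((a i - a j) * (a i - a j)) \<ge> 0" for i j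
  proof -
    have "\<bar>th j - th i\<bar> < pi / 2" using abs_diff_less_double[OF b b, of j i] by simp
    then have "cos (th j - th i) > 0" by (intro cos_gt_zero_pi) linarith+
    then show ?thesis using m by (simp add: weight_def less_imp_le)
  qed
  then have 1: "(\<Sum>i\<in>UNIV. \<Sum>j\<in>UNIV. weight m th i j * cos (th j - th i) * ((a i - a j) * (a i - a j))) \<ge> 0"
    by (intro sum_nonneg)
  have c: "cos (2 * th i) > 0" for i using b[of i] by (intro cos_gt_zero_pi) auto
  obtain k where k: "a k \<noteq> 0" using a by auto
  have "a k * a k > 0" using k not_real_square_gt_zero by blast
  then have k: "m k * cos (2 * th k) * (a k * a k) > 0" using m[of k] c[of k] by simp
  have "(\<Sum>i\<in>UNIV. m i * cos (2 * th i) * (a i * a i)) > 0"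
    using k m c by (intro sum_pos2[of _ k]) (simp_all add: less_imp_le)
  then have "l * (\<Sum>i\<in>UNIV. m i * cos (2 * th i) * (a i * a i)) < 0" using l by (simp add: mult_neg_pos)
  then show ?thesis using 1 unfolding tangential_form_def by linarith
qed

text \<open>Up to constants, \<open>1 / (cos x * \<bar>sin (z - x)\<bar> ^ 3)\<close> is the influence of a particle at \<open>z\<close> on one at \<open>x\<close> in
  the Laplacian below; it must grow as \<open>x\<close> approaches \<open>z\<close>. Angles below \<open>\<pi>/6\<close>, as they
  occur for \<open>c < m i / 4\<close>, make \<open>cos (t - d) + 2 * cos t * cos d\<close> positive, where \<open>d = z - t\<close>.\<close>

lemma cos_sin_cubed_mono:
  assumes "x < y" "y < z" "- (pi / 6) < x" "z < pi / 6"
  shows "cos x * sin (z - x) ^ 3 > cos y * sin (z - y) ^ 3"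
proof (rule DERIV_neg_imp_decreasing[OF assms(1)])
  fix t assume t: "x \<le> t" "t \<le> y"
  define d where "d = z - t"
  have d: "0 < d" "d < pi / 3" "\<bar>t\<bar> < pi / 6" using assms t by (auto simp: d_def)
  have s: "sin d > 0" using d pi_gt_zero by (intro sin_gt_zero) linarith+
  have c: "cos d > 0" "cos t > 0" "cos (t - d) > 0"
    using d pi_gt_zero by (intro cos_gt_zero_pi; linarith)+
  have "((\<lambda>t. cos t * sin (z - t) ^ 3) has_real_derivative
      - (sin d)\<^sup>2 * (cos (t - d) + 2 * (cos t * cos d))) (at t)"
    by (auto intro!: derivative_eq_intros simp: d_def[symmetric] cos_diff[of t d] power2_eq_square power3_eq_cube algebra_simps)
  moreover have "- (sin d)\<^sup>2 * (cos (t - d) + 2 * (cos t * cos d)) < 0"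
    using s c by (simp add: mult_pos_pos add_pos_pos)
  ultimately show "\<exists>D. ((\<lambda>t. cos t * sin (z - t) ^ 3) has_real_derivative D) (at t) \<and> D < 0" by blast
qed

lemma cos_sin_cubed_mono_right:
  assumes "z < x" "x < y" "- (pi / 6) < z" "y < pi / 6"
  shows "cos x * sin (x - z) ^ 3 < cos y * sin (y - z) ^ 3"
  using cos_sin_cubed_mono[of "- y" "- x" "- z"] assms by (simp add: add.commute)

locale line_equilibrium =
  fixes m :: "'n::finite \<Rightarrow> real" and l :: real and th :: "'n \<Rightarrow> real"
  assumes m: "\<And>i. m i > 0" and n: "CARD('n) \<ge> 2"
    and inj: "inj th" and bound: "\<And>i. \<bar>th i\<bar> < pi / 6" and balanced: "line_balanced m l th"
begin

lemma bounds: "\<bar>th i\<bar> < pi / 2" "\<bar>th i\<bar> < pi / 4" using bound[of i] pi_gt_zero by linarith+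

lemma cos_pos: "cos (th i) > 0" using bounds(1)[of i] by (intro cos_gt_zero_pi) auto

lemma multiplier_neg: "l < 0" using line_multiplier_neg[of m th l] m n inj bounds balanced by blast

lemma tan_less_iff: "tan (th i) < tan (th j) \<longleftrightarrow> th i < th j"
  by (rule tan_mono_lt_eq) (use bounds(1)[of i] bounds(1)[of j] in auto)

lemma tan_minus_tan: "cos (th i) * cos (th j) * (tan (th i) - tan (th j)) = sin (th i - th j)"
  using cos_pos[of i] cos_pos[of j] by (simp add: tan_def sin_diff field_simps)

lemma weight_over_mass:
  "weight m th i j * cos (th i) * cos (th j) / (m i * (cos (th i))\<^sup>2)
    = m j * cos (th j) / (cos (th i) * \<bar>sin (th j - th i)\<bar> ^ 3)"
  using m[of i] cos_pos[of i] by (simp add: weight_def power2_eq_square divide_simps)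

text \<open>Gnomonic projection: with positions \<open>tan (th i)\<close> on the tangent line at the pole, masses
  \<open>m i * (cos (th i))\<^sup>2\<close> and \<open>b i = cos (th i) * u i\<close>, the normal form becomes
  \<open>- dirichlet u u - 2 * l * ip u u\<close>, and the equilibrium condition says that the positions are an
  eigenvector for \<open>\<kappa> = - 2 * l\<close>.\<close>

sublocale gnomonic: monotone_laplacian "\<lambda>i j. weight m th i j * cos (th i) * cos (th j)"
  "\<lambda>i. m i * (cos (th i))\<^sup>2" "\<lambda>i. tan (th i)" "- 2 * l"
proof
  show "m i * (cos (th i))\<^sup>2 > 0" for i using m[of i] cos_pos[of i] by simp
  show "weight m th i j * cos (th i) * cos (th j) = weight m th j i * cos (th j) * cos (th i)" for i j
    using weight_commute[of m th i j] by simp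
  show "inj (\<lambda>i. tan (th i))"
    using inj tan_less_iff unfolding inj_def by (metis linorder_neqE less_irrefl)
  show "- 2 * l > 0" using multiplier_neg by simp
  show "(\<Sum>j\<in>UNIV. weight m th i j * cos (th i) * cos (th j) * (tan (th i) - tan (th j)))
      = - 2 * l * (m i * (cos (th i))\<^sup>2) * tan (th i)" for i
  proof -
    have "(\<Sum>j\<in>UNIV. weight m th i j * cos (th i) * cos (th j) * (tan (th i) - tan (th j)))
        = (\<Sum>j\<in>UNIV. weight m th i j * - sin (th j - th i))"
      by (intro sum.cong refl) (simp only: mult.assoc[of "weight m th _ _"] tan_minus_tan flip: sin_minus, simp)
    also have "\<dots> = - line_force m th i" by (simp add: line_force_weight sum_negf)
    also have "\<dots> = - 2 * l * (m i * (cos (th i))\<^sup>2) * tan (th i)"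
      using balanced cos_pos[of i] by (simp add: line_balanced_def tan_def power2_eq_square)
    finally show ?thesis .
  qed
  have frac: "A / x < A / y" if "0 < y" "y < x" "A > 0" for A x y :: real
    using that by (intro divide_strict_left_mono) auto
  have bd: "- (pi / 6) < th i" "th i < pi / 6" for i using bound[of i] by auto
  have sp: "sin (th j - th i) > 0" if "th i < th j" for i j
    using that bd[of i] bd[of j] pi_gt_zero by (intro sin_gt_zero) linarith+
  have abs_sin: "\<bar>sin (th j - th i)\<bar> = sin (th i - th j)" if "th j < th i" for i j
    using sp[OF that] by (metis abs_minus_cancel abs_of_pos minus_diff_eq sin_minus)
  show "weight m th i k * cos (th i) * cos (th k) / (m i * (cos (th i))\<^sup>2)
      < weight m th j k * cos (th j) * cos (th k) / (m j * (cos (th j))\<^sup>2)"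
    if "tan (th i) < tan (th j)" "tan (th j) < tan (th k)" for i j k
  proof -
    have ijk: "th i < th j" "th j < th k" using that tan_less_iff by auto
    then have ik: "th i < th k" by simp
    show ?thesis unfolding weight_over_mass
      using cos_sin_cubed_mono[OF ijk bd] sp[OF ik] sp[OF ijk(2)] cos_pos m[of k]
      by (intro frac) auto
  qed
  show "weight m th j k * cos (th j) * cos (th k) / (m j * (cos (th j))\<^sup>2)
      < weight m th i k * cos (th i) * cos (th k) / (m i * (cos (th i))\<^sup>2)"
    if "tan (th k) < tan (th i)" "tan (th i) < tan (th j)" for i j k
  proof -
    have ijk: "th k < th i" "th i < th j" using that tan_less_iff by auto
    then have kj: "th k < th j" by simp
    show ?thesis unfolding weight_over_mass abs_sin[OF ijk(1)] abs_sin[OF kj]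
      using cos_sin_cubed_mono_right[OF ijk bd] sp[OF kj] sp[OF ijk(1)] cos_pos m[of k]
      by (intro frac) auto
  qed
qed

lemma normal_form_gnomonic:
  "normal_form m l th (\<lambda>i. cos (th i) * u i) (\<lambda>i. cos (th i) * u' i)
    = - gnomonic.dirichlet u u' - 2 * l * gnomonic.ip u u'"
proof -
  let ?F = "\<Sum>i\<in>UNIV. u i * u' i * (cos (th i) * sin (th i)) * line_force m th i"
    and ?G = "\<Sum>i\<in>UNIV. m i * (cos (th i))\<^sup>2 * (cos (th i) * u i * (cos (th i) * u' i))"
  let ?W = "\<lambda>i j. weight m th i j * cos (th i) * cos (th j)"
  have summand: "weight m th i j * (cos (th i) * u i * (cos (th j) * u' j) - cos (th j - th i) * (cos (th i) * u i * (cos (th i) * u' i)))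
     = u i * (- (?W i j * (u' i - u' j))) - u i * u' i * (cos (th i) * sin (th i)) * (weight m th i j * sin (th j - th i))" for i j
  proof -
    have "cos (th j) = cos ((th j - th i) + th i)" by simp
    then have "cos (th j) = cos (th j - th i) * cos (th i) - sin (th j - th i) * sin (th i)" by (simp only: cos_add)
    \<comment> \<open>This identity turns the diagonal terms of the normal form into forces, which the equilibrium removes.\<close>
    then have c: "cos (th j - th i) * cos (th i) = cos (th j) + sin (th j - th i) * sin (th i)" by simp
    have "cos (th j - th i) * (cos (th i) * u i * (cos (th i) * u' i)) = cos (th j - th i) * cos (th i) * (u i * (cos (th i) * u' i))"
      by (simp only: mult_ac)
    then show ?thesis unfolding c by (simp add: algebra_simps)
  qed
  have "normal_form m l th (\<lambda>i. cos (th i) * u i) (\<lambda>i. cos (th i) * u' i)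
    = - (\<Sum>i\<in>UNIV. u i * (\<Sum>j\<in>UNIV. ?W i j * (u' i - u' j)))
      - ?F
      - 2 * l * ?G"
    unfolding normal_form_def summand line_force_weight
    by (simp add: sum_subtractf sum_distrib_left sum_negf)
  also have "(\<Sum>i\<in>UNIV. u i * (\<Sum>j\<in>UNIV. ?W i j * (u' i - u' j))) = gnomonic.dirichlet u u'"
    using gnomonic.dirichlet_by_parts[of u' u] by (simp add: gnomonic.dirichlet_commute)
  also have "- gnomonic.dirichlet u u' - ?F
      - 2 * l * ?G
     = - gnomonic.dirichlet u u' - 2 * l * gnomonic.ip u u'"
  proof -
    have "?F
      + 2 * l * ?G
      = 2 * l * gnomonic.ip u u'"
      unfolding gnomonic.ip_def sum_distrib_left sum.distrib[symmetric]
    proof (intro sum.cong refl)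
      fix i
      have "u i * u' i * (cos (th i) * sin (th i)) * line_force m th i
          + 2 * l * (m i * (cos (th i))\<^sup>2 * (cos (th i) * u i * (cos (th i) * u' i)))
        = 2 * l * (m i * (cos (th i))\<^sup>2 * u i * u' i) * ((sin (th i))\<^sup>2 + (cos (th i))\<^sup>2)"
        unfolding balanced[unfolded line_balanced_def, rule_format] by algebra
      then show "u i * u' i * (cos (th i) * sin (th i)) * line_force m th i
          + 2 * l * (m i * (cos (th i))\<^sup>2 * (cos (th i) * u i * (cos (th i) * u' i)))
        = 2 * l * (m i * (cos (th i))\<^sup>2 * u i * u' i)" by simp
    qed
    then show ?thesis by linarith
  qed
  finally show ?thesis .
qed

end

section \<open>Inertia of the Hessian\<close>

context line_equilibrium
begin

lemma sum_sin_cos: "(\<Sum>i\<in>UNIV. m i * cos (th i) * sin (th i)) = 0"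
proof -
  have "gnomonic.ip (\<lambda>i. tan (th i)) (\<lambda>_. 1) = (\<Sum>i\<in>UNIV. m i * cos (th i) * sin (th i))"
    unfolding gnomonic.ip_def
    by (intro sum.cong refl) (use cos_pos in \<open>simp add: tan_def power2_eq_square less_imp_neq[symmetric]\<close>)
  then show ?thesis using gnomonic.ip_t_const by simp
qed

lemma cos_neq: "cos (th i) \<noteq> 0" using cos_pos[of i] by simp

text \<open>The vectors \<open>sin (th i)\<close> and \<open>cos (th i)\<close> correspond to the positions and to the constants in the
  gnomonic picture. The first spans the kernel (it is the rotation), the second is the positive direction.\<close>

lemma normal_form_sin_cos:
  "normal_form m l th (\<lambda>i. x * sin (th i) + y * cos (th i)) b
    = - 2 * l * y * (\<Sum>i\<in>UNIV. m i * cos (th i) * b i)"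
proof -
  define u where "u = (\<lambda>i. b i / cos (th i))"
  have b: "b = (\<lambda>i. cos (th i) * u i)" by (simp add: u_def cos_neq)
  have v: "(\<lambda>i. x * sin (th i) + y * cos (th i)) = (\<lambda>i. cos (th i) * (x * tan (th i) + y * 1))"
    by (simp add: fun_eq_iff tan_def cos_neq algebra_simps)
  have "(\<Sum>i\<in>UNIV. m i * cos (th i) * b i) = gnomonic.ip (\<lambda>_. 1) u"
    unfolding b gnomonic.ip_def by (simp add: power2_eq_square mult_ac)
  moreover have "normal_form m l th (\<lambda>i. x * sin (th i) + y * cos (th i)) b
      = - 2 * l * y * gnomonic.ip (\<lambda>_. 1) u"
    unfolding v b normal_form_gnomonic
    unfolding gnomonic.linear_left gnomonic.dirichlet_t gnomonic.dirichlet_const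
    by (simp add: algebra_simps)
  ultimately show ?thesis by simp
qed

lemma ip_tan_pos: "gnomonic.ip (\<lambda>i. tan (th i)) (\<lambda>i. tan (th i)) > 0"
proof (rule gnomonic.ip_pos, rule notI)
  assume z: "(\<lambda>i. tan (th i)) = (\<lambda>_. 0)"
  obtain i j :: 'n where "i \<noteq> j" using n by (metis card_2_iff' ex_card subset_UNIV)
  moreover have "tan (th i) = tan (th j)" using z by metis
  ultimately show False using gnomonic.inj_t by (simp add: inj_def)
qed

text \<open>Without its constant component, a vector splits into a multiple of the positions, on which the form
  vanishes, and a remainder to which the spectral gap applies.\<close>

lemma normal_form_neg:
  assumes b: "(\<Sum>i\<in>UNIV. m i * cos (th i) * b i) = 0" and ne: "\<And>x. b \<noteq> (\<lambda>i. x * sin (th i))"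
  shows "normal_form m l th b b < 0"
proof -
  let ?t = "\<lambda>i. tan (th i)"
  define u where "u = (\<lambda>i. b i / cos (th i))"
  have bu: "b = (\<lambda>i. cos (th i) * u i)" by (simp add: u_def cos_neq)
  have u1: "gnomonic.ip u (\<lambda>_. 1) = 0"
    using b unfolding bu gnomonic.ip_def by (simp add: power2_eq_square mult_ac)
  define x where "x = gnomonic.ip u ?t / gnomonic.ip ?t ?t"
  define e where "e = (\<lambda>i. u i + (- x) * ?t i)"
  have e1: "gnomonic.ip e (\<lambda>_. 1) = 0"
    unfolding e_def gnomonic.linear_left u1 gnomonic.ip_t_const by simp
  have e2: "gnomonic.ip e ?t = 0"
    unfolding e_def gnomonic.linear_left using ip_tan_pos by (simp add: x_def)
  have "e \<noteq> (\<lambda>_. 0)"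
  proof
    assume "e = (\<lambda>_. 0)"
    then have "u i = x * tan (th i)" for i unfolding e_def fun_eq_iff by simp
    then have "b = (\<lambda>i. x * sin (th i))" unfolding bu by (simp add: tan_def cos_neq)
    then show False using ne by blast
  qed
  from gnomonic.spectral_gap[OF this e1 e2]
  have gap: "- gnomonic.dirichlet e e - 2 * l * gnomonic.ip e e < 0" by simp
  have ue: "u = (\<lambda>i. e i + x * ?t i)" by (simp add: e_def)
  have "normal_form m l th b b = - gnomonic.dirichlet u u - 2 * l * gnomonic.ip u u"
    unfolding bu by (rule normal_form_gnomonic)
  also have "\<dots> = - gnomonic.dirichlet e e - 2 * l * gnomonic.ip e e"
    unfolding ue gnomonic.linear_left gnomonic.linear_right gnomonic.dirichlet_t
      gnomonic.dirichlet_commute[of e ?t] gnomonic.ip_commute[of ?t e] e2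
    by (simp add: algebra_simps)
  finally show ?thesis using gap by simp
qed

end

lemma tangential_form_commute: "tangential_form m l th a a' = tangential_form m l th a' a"
  by (simp add: tangential_form_def mult.commute)

lemma normal_form_commute: "normal_form m l th b b' = normal_form m l th b' b"
proof -
  have "(\<Sum>i\<in>UNIV. \<Sum>j\<in>UNIV. weight m th i j * (b i * b' j)) = (\<Sum>i\<in>UNIV. \<Sum>j\<in>UNIV. weight m th i j * (b' i * b j))"
    by (subst sum.swap, intro sum.cong refl, subst weight_commute) (simp add: mult.commute)
  then show ?thesis
    unfolding normal_form_def right_diff_distrib sum_subtractf by (simp add: mult.commute[of "b _"])
qed

lemma tangential_form_linear:
  "tangential_form m l th (\<lambda>i. a i + a2 i) a' = tangential_form m l th a a' + tangential_form m l th a2 a'"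
  "tangential_form m l th (\<lambda>i. x * a i) a' = x * tangential_form m l th a a'"
proof -
  show "tangential_form m l th (\<lambda>i. a i + a2 i) a' = tangential_form m l th a a' + tangential_form m l th a2 a'"
    unfolding tangential_form_def by (simp add: algebra_simps sum.distrib sum_subtractf)
  show "tangential_form m l th (\<lambda>i. x * a i) a' = x * tangential_form m l th a a'"
    unfolding tangential_form_def by (simp add: algebra_simps sum_distrib_left)
qed

lemma normal_form_linear:
  "normal_form m l th (\<lambda>i. b i + b2 i) b' = normal_form m l th b b' + normal_form m l th b2 b'"
  "normal_form m l th (\<lambda>i. x * b i) b' = x * normal_form m l th b b'"
proof -
  show "normal_form m l th (\<lambda>i. b i + b2 i) b' = normal_form m l th b b' + normal_form m l th b2 b'"
    unfolding normal_form_def by (simp add: algebra_simps sum.distrib sum_subtractf)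
  show "normal_form m l th (\<lambda>i. x * b i) b' = x * normal_form m l th b b'"
    unfolding normal_form_def by (simp add: algebra_simps sum_distrib_left)
qed

definition frame_tau :: "real \<Rightarrow> real \<Rightarrow> real^3" where
  "frame_tau al x = vector [cos x * cos al, cos x * sin al, - sin x]"

lemma line_tangent_components:
  "line_tangent al th a b $ i \<bullet> frame_tau al (th i) = a i" "line_tangent al th a b $ i \<bullet> frame_w al = b i"
  by (simp_all add: inner_3 frame_tau_def algebra_simps polar_square)

lemma line_tangent_inject: "line_tangent al th a b = line_tangent al th a' b' \<longleftrightarrow> a = a' \<and> b = b'"
proof
  assume e: "line_tangent al th a b = line_tangent al th a' b'"
  have "a i = a' i" "b i = b' i" for i
    using line_tangent_components[of al th a b i] line_tangent_components[of al th a' b' i] unfolding e by simp_all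
  then show "a = a' \<and> b = b'" by auto
qed simp

lemma line_tangent_add: "line_tangent al th a b + line_tangent al th a' b' = line_tangent al th (\<lambda>i. a i + a' i) (\<lambda>i. b i + b' i)"
  by (simp add: config_eq_iff algebra_simps)

lemma line_tangent_scale: "r *\<^sub>R line_tangent al th a b = line_tangent al th (\<lambda>i. r * a i) (\<lambda>i. r * b i)"
  by (simp add: config_eq_iff algebra_simps)

lemma line_tangent_zero: "line_tangent al th (\<lambda>_. 0) (\<lambda>_. 0) = 0"
  by (simp add: config_eq_iff)

lemma orbit_tangent_line: "orbit_tangent (line_config al th) = span {line_tangent al th (\<lambda>_. 0) (\<lambda>i. sin (th i))}"
proof -
  have "((\<lambda>a. line_config (al + a) th) has_vector_derivative line_tangent al th (\<lambda>_. 0) (\<lambda>i. sin (th i))) (at 0)"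
  proof (intro has_vector_derivative_vec)
    fix i j
    have "\<forall>j. ((\<lambda>a. line_config (al + a) th $ i $ j) has_vector_derivative
        line_tangent al th (\<lambda>_. 0) (\<lambda>i. sin (th i)) $ i $ j) (at 0)"
      unfolding forall_3 has_real_derivative_iff_has_vector_derivative[symmetric]
      by (auto intro!: derivative_eq_intros)
    then show "((\<lambda>a. line_config (al + a) th $ i $ j) has_vector_derivative
        line_tangent al th (\<lambda>_. 0) (\<lambda>i. sin (th i)) $ i $ j) (at 0)" ..
  qed
  then show ?thesis unfolding orbit_tangent_def rotate_line_config by (simp add: vector_derivative_at)
qed

text \<open>On the quotient, \<open>P\<close> has dimension \<open>n\<close>: the tangential components, \<open>n - 1\<close> of them because of
  \<open>I1 = c\<close>, and the normal direction \<open>cos (th i)\<close>. The summand \<open>N\<close> consists of the normal variations without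
  component along \<open>cos (th i)\<close> and has dimension \<open>n - 2\<close>. Both contain the rotation direction \<open>L\<close>.\<close>

theorem line_hessian_inertia:
  fixes m :: "'n::{finite,linorder} \<Rightarrow> real"
  assumes eq: "line_equilibrium m l th" and I: "line_moment m th = c" and c: "c > 0"
  shows "hessian_inertia m c (line_config al th) = (0, CARD('n), CARD('n) - 2)"
proof -
  interpret line_equilibrium m l th by (rule eq)
  let ?K = "\<lambda>a. \<Sum>i\<in>UNIV. m i * cos (th i) * sin (th i) * a i"
    and ?C = "\<lambda>b. \<Sum>i\<in>UNIV. m i * cos (th i) * b i"
    and ?CC = "\<Sum>i\<in>UNIV. m i * cos (th i) * cos (th i)"
    and ?sc = "\<lambda>x y i. x * sin (th i) + y * cos (th i)"
  define q where "q = line_config al th"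
  define T where "T = line_tangent al th"
  define L where "L = orbit_tangent q"
  define V where "V = tangent_space (M_set m c) q"
  define A where "A = (\<lambda>(v :: 'n config) i. v $ i \<bullet> frame_tau al (th i))"
  define E where "E = (\<lambda>(v :: 'n config) i. v $ i \<bullet> frame_w al)"
  define B where "B = (\<lambda>v w. tangential_form m l th (A v) (A w) + normal_form m l th (E v) (E w))"
  have AT: "A (T a b) = a" "E (T a b) = b" for a b
    by (simp_all add: A_def E_def T_def line_tangent_components)
  have qM: "q \<in> M_set m c"
    unfolding q_def using line_config_M_set_iff[of th] bounds(1) inj I by blast
  have "critical_point_on regular_configs (\<lambda>p. U1 m p - l * I1 m p) q"
    unfolding q_def using line_config_critical_iff[of th] bounds(1) inj balanced by blast
  then have crit: "dU m q x = l * dI m q x" if "\<And>i. x $ i \<bullet> q $ i = 0" for x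
    using that unfolding critical_point_on_sphere_iff by blast
  have VT: "V = {T a b | a b. ?K a = 0}"
  proof -
    have dI: "dI m q (T a b) = 2 * ?K a" for a b
      unfolding q_def T_def dI_line sum_distrib_left by (intro sum.cong refl) (simp add: mult_ac)
    have perp: "T a b $ i \<bullet> q $ i = 0" for a b i by (simp add: T_def q_def line_inners)
    have "\<exists>a b. v = T a b" if "\<forall>i. v $ i \<bullet> q $ i = 0" for v
      using that unfolding q_def T_def by (intro tangent_is_line_tangent) simp
    then show ?thesis unfolding V_def tangent_space_M_set[OF qM c] using dI perp by fastforce
  qed
  have LT: "L = {T (\<lambda>_. 0) (\<lambda>i. x * sin (th i)) | x. True}"
    unfolding L_def q_def T_def orbit_tangent_line span_singleton by (auto simp: line_tangent_scale)
  define P where "P = {T a (?sc x y) | a x y.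
    ?K a = 0}"
  define N where "N = {T (\<lambda>_. 0) b | b. ?C b = 0}"
  obtain i0 j0 :: 'n where ij0: "i0 \<noteq> j0" using n by (metis card_2_iff' ex_card subset_UNIV)
  have sincos_indep: "x = 0 \<and> y = 0" if h: "\<And>i. x * sin (th i) + y * cos (th i) = 0" for x y
  proof -
    have t: "x * tan (th i) = - y" for i using h[of i] cos_neq[of i] by (simp add: tan_def field_simps)
    have "x * (tan (th i0) - tan (th j0)) = 0" using t[of i0] t[of j0] by (simp add: algebra_simps)
    moreover have "tan (th i0) \<noteq> tan (th j0)" using gnomonic.inj_t ij0 by (auto simp: inj_def)
    ultimately have "x = 0" by simp
    then show ?thesis using t[of i0] by simp
  qed

  define F where "F = (\<lambda>(z :: (real, 'n) vec, x, y). T (($) z) (?sc x y))"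
  define k :: "(real, 'n) vec" where "k = (\<chi> i. m i * cos (th i) * sin (th i))"
  have vec_fun: "($) (z + z') = (\<lambda>i. z $ i + z' $ i)" "($) (r *\<^sub>R z) = (\<lambda>i. r * z $ i)"
    for z z' :: "(real, 'n) vec" and r by (simp_all add: fun_eq_iff)
  have linF: "linear F"
    by (rule linearI) (auto simp: F_def T_def line_tangent_add line_tangent_scale vec_fun algebra_simps)
  have injF: "inj F"
  proof (subst linear_injective_0[OF linF], intro allI impI)
    fix p assume "F p = 0"
    obtain z x y where p: "p = (z, x, y)" by (cases p)
    have "T (($) z) (?sc x y) = T (\<lambda>_. 0) (\<lambda>_. 0)"
      using \<open>F p = 0\<close> by (simp add: F_def p T_def line_tangent_zero)
    then have "($) z = (\<lambda>_. 0)" "\<And>i. x * sin (th i) + y * cos (th i) = 0"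
      unfolding T_def line_tangent_inject by (auto dest: fun_cong)
    then show "p = 0" using sincos_indep[of x y] by (auto simp: p vec_eq_iff zero_prod_def)
  qed
  have "k \<noteq> 0"
  proof
    assume "k = 0"
    have "sin (th i) = 0" for i
    proof -
      have "k $ i = 0" using \<open>k = 0\<close> by simp
      then show ?thesis using m[of i] cos_neq[of i] by (auto simp: k_def)
    qed
    then show False using sincos_indep[of 1 0] by simp
  qed
  have PF: "P = F ` {p. (k, 0, 0) \<bullet> p = 0}"
  proof (intro set_eqI iffI)
    fix v assume "v \<in> P"
    then obtain a x y where v: "v = T a (?sc x y)"
      and a: "?K a = 0" unfolding P_def by blast
    have "v = F (\<chi> i. a i, x, y)" by (simp add: v F_def vec_lambda_inverse)
    moreover have "(k, 0, 0) \<bullet> ((\<chi> i. a i) :: (real, 'n) vec, x, y) = 0" using a by (simp add: inner_vec_def k_def)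
    ultimately show "v \<in> F ` {p. (k, 0, 0) \<bullet> p = 0}" by blast
  next
    fix v assume "v \<in> F ` {p. (k, 0, 0) \<bullet> p = 0}"
    then show "v \<in> P" unfolding P_def by (force simp: F_def inner_vec_def k_def)
  qed
  have sP: "subspace P" unfolding PF by (intro linear_subspace_image linF subspace_hyperplane)
  have dP: "dim P = CARD('n) + 1"
  proof -
    have "dim P = dim {p :: ((real, 'n) vec) \<times> real \<times> real. (k, 0, 0) \<bullet> p = 0}"
      unfolding PF by (intro dim_image_eq linF inj_on_subset[OF injF]) auto
    also have "\<dots> = DIM(((real, 'n) vec) \<times> real \<times> real) - 1"
      by (rule dim_hyperplane) (use \<open>k \<noteq> 0\<close> in \<open>simp add: zero_prod_def\<close>)
    finally show ?thesis by simp
  qed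
  define G where "G = (\<lambda>z :: (real, 'n) vec. T (\<lambda>_. 0) (($) z))"
  define w :: "(real, 'n) vec" where "w = (\<chi> i. m i * cos (th i))"
  have linG: "linear G"
    by (rule linearI) (auto simp: G_def T_def line_tangent_add line_tangent_scale vec_fun)
  have injG: "inj G"
    by (rule injI) (simp add: G_def T_def line_tangent_inject vec_nth_inject)
  have "w \<noteq> 0"
  proof
    assume "w = 0"
    then have "w $ i0 = 0" by simp
    then show False using m[of i0] cos_neq[of i0] by (auto simp: w_def)
  qed
  have NG: "N = G ` {z. w \<bullet> z = 0}"
  proof (intro set_eqI iffI)
    fix v assume "v \<in> N"
    then obtain b where v: "v = T (\<lambda>_. 0) b" and b: "?C b = 0" unfolding N_def by blast
    have "v = G (\<chi> i. b i)" by (simp add: v G_def vec_lambda_inverse)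
    moreover have "w \<bullet> (\<chi> i. b i) = 0" using b by (simp add: inner_vec_def w_def)
    ultimately show "v \<in> G ` {z. w \<bullet> z = 0}" by blast
  next
    fix v assume "v \<in> G ` {z. w \<bullet> z = 0}"
    then show "v \<in> N" unfolding N_def by (force simp: G_def inner_vec_def w_def)
  qed
  have sN: "subspace N" unfolding NG by (intro linear_subspace_image linG subspace_hyperplane)
  have dN: "dim N = CARD('n) - 1"
  proof -
    have "dim N = dim {z. w \<bullet> z = 0}"
      unfolding NG by (intro dim_image_eq linG inj_on_subset[OF injG]) auto
    also have "\<dots> = DIM((real, 'n) vec) - 1" by (rule dim_hyperplane[OF \<open>w \<noteq> 0\<close>])
    finally show ?thesis by simp
  qed
  have dL: "dim L = 1"
  proof -
    have "T (\<lambda>_. 0) (\<lambda>i. sin (th i)) \<noteq> 0"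
    proof
      assume "T (\<lambda>_. 0) (\<lambda>i. sin (th i)) = 0"
      then have "(\<lambda>i. sin (th i)) = (\<lambda>_. 0)"
        unfolding T_def line_tangent_zero[of al th, symmetric] line_tangent_inject by blast
      then show False using sincos_indep[of 1 0] by (auto dest: fun_cong)
    qed
    then show ?thesis unfolding L_def q_def orbit_tangent_line T_def[symmetric] by (simp add: dim_singleton)
  qed

  have cc: "?C (?sc x y) = y * ?CC" for x y
  proof -
    have "?C (?sc x y)
      = x * (\<Sum>i\<in>UNIV. m i * cos (th i) * sin (th i)) + y * ?CC"
      unfolding sum_distrib_left sum.distrib[symmetric] by (intro sum.cong refl) (simp add: algebra_simps)
    then show ?thesis unfolding sum_sin_cos by simp
  qed
  have Cpos: "?CC > 0"
    by (intro sum_pos) (use m cos_pos in auto)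

  have PN: "P \<inter> N = L"
  proof (intro set_eqI iffI)
    fix v assume "v \<in> P \<inter> N"
    then obtain a x y b where v: "v = T a (?sc x y)" "v = T (\<lambda>_. 0) b"
      and b: "?C b = 0" unfolding P_def N_def by blast
    from v have ab: "a = (\<lambda>_. 0)" "b = (?sc x y)"
      unfolding T_def line_tangent_inject by (metis T_def line_tangent_inject)+
    have "y = 0" using b Cpos unfolding ab(2) cc by simp
    then show "v \<in> L" using v(1) ab(1) unfolding LT by auto
  next
    fix v assume "v \<in> L"
    then obtain x where v: "v = T (\<lambda>_. 0) (\<lambda>i. x * sin (th i))" unfolding LT by blast
    have "v \<in> P" unfolding P_def v by (intro CollectI exI[of _ "\<lambda>_. 0"] exI[of _ x] exI[of _ 0]) simp
    moreover have "v \<in> N" unfolding N_def v using cc[of x 0] by auto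
    ultimately show "v \<in> P \<inter> N" ..
  qed
  have VPN: "V = {p + r | p r. p \<in> P \<and> r \<in> N}"
  proof (intro set_eqI iffI)
    fix v assume "v \<in> V"
    then obtain a b where v: "v = T a b" and a: "?K a = 0"
      unfolding VT by blast
    define y where "y = ?C b / ?CC"
    have "v = T a (\<lambda>i. 0 * sin (th i) + y * cos (th i)) + T (\<lambda>_. 0) (\<lambda>i. b i - y * cos (th i))"
      by (simp add: v T_def line_tangent_add)
    moreover have "T a (\<lambda>i. 0 * sin (th i) + y * cos (th i)) \<in> P" unfolding P_def using a by blast
    moreover have "(\<Sum>i\<in>UNIV. m i * cos (th i) * (b i - y * cos (th i)))
        = ?C b - y * ?CC"
      by (simp add: right_diff_distrib sum_subtractf sum_distrib_left mult_ac)
    then have "T (\<lambda>_. 0) (\<lambda>i. b i - y * cos (th i)) \<in> N" unfolding N_def using Cpos by (auto simp: y_def)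
    ultimately show "v \<in> {p + r | p r. p \<in> P \<and> r \<in> N}" by blast
  next
    fix v assume "v \<in> {p + r | p r. p \<in> P \<and> r \<in> N}"
    then obtain a x y b where v: "v = T a (?sc x y) + T (\<lambda>_. 0) b"
      and a: "?K a = 0" unfolding P_def N_def by blast
    have "v = T a (\<lambda>i. x * sin (th i) + y * cos (th i) + b i)" unfolding v by (simp add: T_def line_tangent_add)
    then show "v \<in> V" unfolding VT using a by blast
  qed

  have Bsym: "B v u = B u v" for u v
    unfolding B_def by (simp only: tangential_form_commute normal_form_commute)
  have Badd: "B (u + v) y = B u y + B v y" and Bscale: "B (r *\<^sub>R u) y = r *\<^sub>R B u y" for u v y r
  proof -
    have "A (u + v) = (\<lambda>i. A u i + A v i)" "E (u + v) = (\<lambda>i. E u i + E v i)"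
      "A (r *\<^sub>R u) = (\<lambda>i. r * A u i)" "E (r *\<^sub>R u) = (\<lambda>i. r * E u i)"
      by (simp_all add: A_def E_def inner_add_left)
    then show "B (u + v) y = B u y + B v y" "B (r *\<^sub>R u) y = r *\<^sub>R B u y"
      unfolding B_def by (simp_all add: tangential_form_linear normal_form_linear algebra_simps)
  qed
  have Badd': "B y (u + v) = B y u + B y v" and Bscale': "B y (r *\<^sub>R u) = r *\<^sub>R B y u" for u v y r
    by (metis Badd Bsym, metis Bscale Bsym)
  have bil: "bilinear B"
    unfolding bilinear_def by (intro conjI allI linearI Badd Bscale Badd' Bscale')
  have QB: "quotient_hessian m c q v = B v v" if v: "v \<in> V" for v
  proof -
    obtain a b where vT: "v = T a b" using v unfolding VT by blast
    have "quotient_hessian m c q v = constrained_hessian m l q v"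
      using quotient_hessian_eq[OF crit] v unfolding V_def by blast
    also have "\<dots> = B v v" unfolding vT B_def AT unfolding q_def T_def by (rule line_hessian)
    finally show ?thesis .
  qed
  have orth: "B p r = 0" if "p \<in> P" "r \<in> N" for p r
  proof -
    obtain a x y where p: "p = T a (?sc x y)" using \<open>p \<in> P\<close> unfolding P_def by blast
    obtain b where r: "r = T (\<lambda>_. 0) b" and b: "?C b = 0"
      using \<open>r \<in> N\<close> unfolding N_def by blast
    show ?thesis unfolding B_def p r AT normal_form_sin_cos b by (simp add: tangential_form_def)
  qed
  have pos: "B p p > 0" if pPL: "p \<in> P - L" for p
  proof -
    obtain a x y where p: "p = T a (?sc x y)" using pPL unfolding P_def by blast
    have nf: "normal_form m l th (?sc x y) (?sc x y)
        = - 2 * l * y\<^sup>2 * ?CC"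
      unfolding normal_form_sin_cos cc by (simp add: power2_eq_square)
    have l2: "- 2 * l * ?CC > 0"
      using mult_pos_pos[OF _ Cpos, of "- 2 * l"] multiplier_neg by simp
    have nfn: "- 2 * l * y\<^sup>2 * ?CC = y\<^sup>2 * (- 2 * l * ?CC)"
      by (simp add: mult_ac)
    show ?thesis
    proof (cases "a = (\<lambda>_. 0)")
      case True
      have "y \<noteq> 0"
      proof
        assume "y = 0"
        then have "p \<in> L" unfolding LT p True by auto
        then show False using pPL by simp
      qed
      then have "y\<^sup>2 > 0" by simp
      then have "y\<^sup>2 * (- 2 * l * ?CC) > 0" using l2 by (rule mult_pos_pos)
      then show ?thesis unfolding B_def p AT nf nfn True by (simp add: tangential_form_def)
    next
      case False
      have "tangential_form m l th a a > 0"
        by (rule tangential_form_pos[OF _ multiplier_neg _ False]) (use m bounds in auto)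
      moreover have "y\<^sup>2 * (- 2 * l * ?CC) \<ge> 0"
        by (rule mult_nonneg_nonneg[OF zero_le_power2 less_imp_le[OF l2]])
      ultimately show ?thesis unfolding B_def p AT nf nfn by linarith
    qed
  qed
  have neg: "B r r < 0" if rNL: "r \<in> N - L" for r
  proof -
    obtain b where r: "r = T (\<lambda>_. 0) b" and b: "?C b = 0"
      using rNL unfolding N_def by blast
    have "b \<noteq> (\<lambda>i. x * sin (th i))" for x using rNL unfolding LT r by blast
    from normal_form_neg[OF b this] show ?thesis unfolding B_def r AT by (simp add: tangential_form_def)
  qed
  have "quotient_inertia V L (quotient_hessian m c q) = (0, dim P - dim L, dim N - dim L)"
    by (rule quotient_inertia_orthogonal_splitting[OF sP sN VPN PN bil Bsym QB orth pos neg])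
  then show ?thesis unfolding hessian_inertia_def V_def L_def[symmetric] q_def[symmetric] dP dN dL by simp
qed

section \<open>Counting orderings\<close>

definition lists_increasing :: "('n \<Rightarrow> real) \<Rightarrow> 'n list \<Rightarrow> bool" where
  "lists_increasing th xs \<longleftrightarrow> sorted_wrt (\<lambda>i j. th i < th j) xs"

lemma lists_increasing_minus: "lists_increasing (\<lambda>i. - th i) xs \<longleftrightarrow> lists_increasing th (rev xs)"
  by (simp add: lists_increasing_def sorted_wrt_rev)

lemma lists_increasing_less_iff:
  assumes "lists_increasing th xs" "set xs = UNIV"
  shows "th i < th j \<longleftrightarrow> (\<exists>a b. a < b \<and> b < length xs \<and> xs ! a = i \<and> xs ! b = j)"
proof
  assume "th i < th j"
  obtain a b where ab: "a < length xs" "b < length xs" "xs ! a = i" "xs ! b = j"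
    using assms(2) by (metis UNIV_I in_set_conv_nth)
  moreover have "a < b"
    using assms(1) \<open>th i < th j\<close> ab unfolding lists_increasing_def sorted_wrt_iff_nth_less
    by (metis linorder_neqE_nat less_asym less_irrefl)
  ultimately show "\<exists>a b. a < b \<and> b < length xs \<and> xs ! a = i \<and> xs ! b = j" by blast
qed (use assms(1) in \<open>auto simp: lists_increasing_def sorted_wrt_iff_nth_less\<close>)

lemma lists_increasing_unique:
  fixes th :: "'n::finite \<Rightarrow> real"
  assumes "lists_increasing th xs" "lists_increasing th ys" "set xs = UNIV" "set ys = UNIV" and inj: "inj th"
  shows "xs = ys"
proof -
  have "map th xs = map th ys"
    by (rule strict_sorted_equal) (use assms in \<open>auto simp: lists_increasing_def sorted_wrt_map\<close>)
  then show ?thesis using inj by (rule map_injective)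
qed

lemma lists_increasing_exists:
  fixes th :: "'n::finite \<Rightarrow> real"
  assumes inj: "inj th"
  shows "\<exists>xs\<in>permutations_of_set UNIV. lists_increasing th xs"
proof -
  define xs where "xs = map (inv th) (sorted_list_of_set (range th))"
  have "map th xs = map id (sorted_list_of_set (range th))"
    unfolding xs_def map_map by (rule map_cong) (auto simp: f_inv_into_f)
  then have m: "map th xs = sorted_list_of_set (range th)" by simp
  have "sorted_wrt (<) (map th xs)" unfolding m by simp
  then have inc: "lists_increasing th xs" by (simp add: lists_increasing_def sorted_wrt_map)
  have "set xs = inv th ` range th" unfolding xs_def by simp
  then have "set xs = UNIV" using inj by (simp add: image_comp)
  moreover have "distinct xs"
    using distinct_sorted_list_of_set[of "range th"] unfolding m[symmetric] by (simp add: distinct_map)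
  ultimately show ?thesis using inc by (auto simp: permutations_of_set_def)
qed

text \<open>Double counting of the pairs related by \<open>R\<close>.\<close>

lemma card_two_to_one:
  assumes fin: "finite A" and two: "\<And>y. y \<in> B \<Longrightarrow> card {x \<in> A. R x y} = 2"
    and one: "\<And>x. x \<in> A \<Longrightarrow> \<exists>!y. y \<in> B \<and> R x y"
  shows "card A = 2 * card B"
proof -
  define f where "f = (\<lambda>x. THE y. y \<in> B \<and> R x y)"
  have f: "f x \<in> B \<and> R x (f x)" if "x \<in> A" for x unfolding f_def by (rule theI'[OF one[OF that]])
  have fy: "f x = y \<longleftrightarrow> R x y" if "x \<in> A" "y \<in> B" for x y using f[OF that(1)] one[OF that(1)] that(2) by blast
  have ne: "\<exists>x\<in>A. R x y" if "y \<in> B" for y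
  proof (rule ccontr)
    assume "\<not> ?thesis"
    then have "{x \<in> A. R x y} = {}" by blast
    then show False using two[OF that] by (metis card.empty zero_neq_numeral)
  qed
  have B: "B = f ` A" using f fy ne by (auto simp: image_iff) metis
  have "card A = (\<Sum>y\<in>B. card {x \<in> A. f x = y})"
    using sum.group[OF fin finite_imageI[OF fin, of f], of f "\<lambda>_. 1 :: nat"] by (simp add: B)
  also have "\<dots> = (\<Sum>y\<in>B. 2)"
  proof (rule sum.cong[OF refl])
    fix y assume y: "y \<in> B"
    then have "{x \<in> A. f x = y} = {x \<in> A. R x y}" using fy by blast
    then show "card {x \<in> A. f x = y} = 2" using two[OF y] by simp
  qed
  finally show ?thesis by simp
qed

lemma sin_less_iff: "\<bar>x\<bar> < pi / 2 \<Longrightarrow> \<bar>y\<bar> < pi / 2 \<Longrightarrow> sin x < sin y \<longleftrightarrow> x < y" for x y :: real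
  by (rule sin_mono_less_eq) auto

locale geodesic_problem =
  fixes m :: "'n::{finite,linorder} \<Rightarrow> real" and c :: real
  assumes m: "\<And>i. m i > 0" and n: "CARD('n) \<ge> 2" and c: "0 < c" "\<And>i. c < m i / 2"
begin

abbreviation "Sol \<equiv> line_solutions m c"

definition orbit_of :: "('n \<Rightarrow> real) \<Rightarrow> 'n config set" where
  "orbit_of th = range (\<lambda>\<beta>. line_config \<beta> th)"

lemma orbits: "orbit_z ` geodesic_occs m c = orbit_of ` Sol"
proof -
  have "orbit_z (line_config al th) = orbit_of th" for al and th :: "'n \<Rightarrow> real"
    unfolding orbit_of_def by (rule orbit_line_config)
  then show ?thesis unfolding geodesic_occs_eq[of m, OF m n] by blast
qed

lemma Sol_bound: "th \<in> Sol \<Longrightarrow> \<bar>th i\<bar> < pi / 2" and Sol_inj: "th \<in> Sol \<Longrightarrow> inj th"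
  by (auto simp: line_solutions_def)

lemma Sol_bound_4: "th \<in> Sol \<Longrightarrow> \<bar>th i\<bar> < pi / 4"
  by (rule angle_bound[of m _ c])
     (use m c(2) Sol_bound[of th i] in \<open>auto simp: sin_45 power_divide line_solutions_def less_imp_le\<close>)

lemma Sol_minus: assumes "th \<in> Sol" shows "(\<lambda>i. - th i) \<in> Sol"
proof -
  have "pair_force (- th j - - th i) = - pair_force (th j - th i)" for i j
    using pair_force_swap[of "th i" "th j"] by simp
  then have "line_force m (\<lambda>i. - th i) i = - line_force m th i" for i
    unfolding line_force_def by (simp only: mult_minus_right sum_negf)
  then show ?thesis
    using assms by (auto simp: line_solutions_def line_balanced_def line_moment_def inj_def)
qed

lemma orbit_of_minus: "orbit_of (\<lambda>i. - th i) = orbit_of th"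
proof -
  have e: "line_config \<beta> (\<lambda>i. - th i) = line_config (\<beta> + pi) th" for \<beta> by (simp add: config_eq_iff)
  have "line_config \<beta> th = line_config (\<beta> - pi) (\<lambda>i. - th i)" for \<beta> unfolding e by simp
  with e show ?thesis unfolding orbit_of_def by blast
qed

text \<open>An orbit meets the circle \<open>y = 0\<close> exactly in the angles \<open>0\<close> and \<open>\<pi>\<close> of rotation, because some
  particle is not at the pole; the second one reverses the order of the \<open>x\<close> coordinates.\<close>

lemma orbit_has_ordering_iff:
  assumes th: "th \<in> Sol"
  shows "orbit_has_ordering (orbit_of th) xs \<longleftrightarrow> lists_increasing th xs \<or> lists_increasing th (rev xs)"
proof -
  let ?sorted = "\<lambda>\<beta>. sorted_wrt (\<lambda>i j. sin (th i) * cos \<beta> < sin (th j) * cos \<beta>) xs"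
  let ?P = "\<lambda>\<beta>. (\<forall>i. sin (th i) * sin \<beta> = 0) \<and> ?sorted \<beta>"
  obtain k where k: "sin (th k) \<noteq> 0"
  proof -
    have "\<exists>k. m k * (sin (th k))\<^sup>2 \<noteq> 0"
    proof (rule ccontr)
      assume "\<not> ?thesis"
      then have "line_moment m th = 0" unfolding line_moment_def by (intro sum.neutral) blast
      then show False using th c by (simp add: line_solutions_def)
    qed
    then show ?thesis using that by auto
  qed
  have less: "sin (th i) < sin (th j) \<longleftrightarrow> th i < th j" for i j using Sol_bound[OF th] by (intro sin_less_iff)
  have "orbit_has_ordering (orbit_of th) xs
    \<longleftrightarrow> (\<exists>\<beta>. ?P \<beta>)"
    unfolding orbit_has_ordering_def orbit_of_def by simp
  also have "\<dots> \<longleftrightarrow> lists_increasing th xs \<or> lists_increasing (\<lambda>i. - th i) xs"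
  proof
    assume "\<exists>\<beta>. ?P \<beta>"
    then obtain \<beta> where b: "sin (th k) * sin \<beta> = 0" "?sorted \<beta>" by blast
    from b(1) k have "sin \<beta> = 0" by simp
    then have "cos \<beta> = 1 \<or> cos \<beta> = - 1" using sin_zero_abs_cos_one[of \<beta>] by linarith
    then show "lists_increasing th xs \<or> lists_increasing (\<lambda>i. - th i) xs"
      using b(2) by (auto simp: lists_increasing_def less)
  next
    assume "lists_increasing th xs \<or> lists_increasing (\<lambda>i. - th i) xs"
    then show "\<exists>\<beta>. ?P \<beta>"
    proof
      assume "lists_increasing th xs"
      then show ?thesis by (intro exI[of _ 0]) (simp add: lists_increasing_def less)
    next
      assume "lists_increasing (\<lambda>i. - th i) xs"
      then show ?thesis by (intro exI[of _ pi]) (simp add: lists_increasing_def less)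
    qed
  qed
  finally show ?thesis unfolding lists_increasing_minus .
qed

lemma Sol_exists:
  assumes xs: "xs \<in> permutations_of_set UNIV"
  shows "\<exists>th\<in>Sol. lists_increasing th xs"
proof -
  have dx: "distinct xs" "set xs = UNIV" using xs by (auto simp: permutations_of_set_def)
  define r where "r = (\<lambda>i. THE a. a < length xs \<and> xs ! a = i)"
  have r_nth: "r (xs ! a) = a" if "a < length xs" for a
    unfolding r_def using that dx(1) by (intro the_equality) (auto simp: nth_eq_iff_index_eq)
  have nth_r: "\<exists>a<length xs. i = xs ! a" for i using dx(2) by (metis UNIV_I in_set_conv_nth)
  have "inj r" by (rule injI) (metis nth_r r_nth)
  then interpret line_problem m c r using m n c by unfold_locales
  obtain th l where th: "\<And>i. \<bar>th i\<bar> < pi / 4" "\<And>i j. r i < r j \<Longrightarrow> th i < th j" "line_moment m th = c" "line_balanced m l th"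
    using exists_balanced by blast
  have "inj th" by (rule inj_of_order[OF \<open>inj r\<close>]) (rule th(2))
  moreover have "\<bar>th i\<bar> < pi / 2" for i using th(1)[of i] pi_gt_zero by linarith
  ultimately have "th \<in> Sol" using th by (auto simp: line_solutions_def)
  moreover have "lists_increasing th xs"
    unfolding lists_increasing_def sorted_wrt_iff_nth_less using th(2) r_nth by simp
  ultimately show ?thesis by blast
qed

lemma Sol_unique:
  assumes th: "th \<in> Sol" "lists_increasing th xs" and et: "et \<in> Sol" "lists_increasing et xs"
    and xs: "set xs = UNIV"
  shows "th = et"
proof -
  obtain l where l: "line_balanced m l th" using th by (auto simp: line_solutions_def)
  obtain l' where l': "line_balanced m l' et" using et by (auto simp: line_solutions_def)
  have "th i < th j \<longleftrightarrow> et i < et j" for i j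
    unfolding lists_increasing_less_iff[OF th(2) xs] lists_increasing_less_iff[OF et(2) xs] ..
  then show ?thesis
    using line_balanced_unique[of m th et l l'] m n Sol_bound_4[OF th(1)] Sol_bound_4[OF et(1)] Sol_inj[OF th(1)] l l' th(1) et(1)
    by (simp add: line_solutions_def)
qed

lemma orbit_unique:
  assumes xs: "xs \<in> permutations_of_set UNIV"
  shows "\<exists>!X. X \<in> orbit_of ` Sol \<and> orbit_has_ordering X xs"
proof -
  have sx: "set xs = UNIV" using xs by (auto simp: permutations_of_set_def)
  obtain th where th: "th \<in> Sol" "lists_increasing th xs" using Sol_exists[OF xs] by blast
  show ?thesis
  proof (rule ex1I[of _ "orbit_of th"])
    show "orbit_of th \<in> orbit_of ` Sol \<and> orbit_has_ordering (orbit_of th) xs"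
      using th orbit_has_ordering_iff by blast
    fix X assume X: "X \<in> orbit_of ` Sol \<and> orbit_has_ordering X xs"
    then obtain et where et: "et \<in> Sol" "X = orbit_of et" by blast
    have "lists_increasing et xs \<or> lists_increasing (\<lambda>i. - et i) xs"
      using X orbit_has_ordering_iff[OF et(1), of xs] unfolding et(2) lists_increasing_minus by simp
    then show "X = orbit_of th"
    proof
      assume "lists_increasing et xs"
      then show ?thesis using Sol_unique[OF th et(1) _ sx] et(2) by simp
    next
      assume "lists_increasing (\<lambda>i. - et i) xs"
      then have "th = (\<lambda>i. - et i)" by (rule Sol_unique[OF th Sol_minus[OF et(1)] _ sx])
      then show ?thesis using et(2) orbit_of_minus[of et] by simp
    qed
  qed
qed

lemma orbit_orderings:
  assumes "X \<in> orbit_of ` Sol"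
  shows "\<exists>xs\<in>permutations_of_set UNIV. {ys \<in> permutations_of_set UNIV. orbit_has_ordering X ys} = {xs, rev xs}"
proof -
  obtain th where th: "th \<in> Sol" "X = orbit_of th" using assms by blast
  obtain xs where xs: "xs \<in> permutations_of_set UNIV" "lists_increasing th xs"
    using lists_increasing_exists[OF Sol_inj[OF th(1)]] by blast
  have set: "set ys = UNIV" if "ys \<in> permutations_of_set UNIV" for ys :: "'n list"
    using that by (simp add: permutations_of_set_def)
  have uniq: "lists_increasing th ys \<longleftrightarrow> ys = xs" if "set ys = UNIV" for ys
    using lists_increasing_unique[OF _ xs(2) that set[OF xs(1)] Sol_inj[OF th(1)]] xs(2) by blast
  have "{ys \<in> permutations_of_set UNIV. orbit_has_ordering X ys}
      = {ys \<in> permutations_of_set UNIV. ys = xs \<or> rev ys = xs}"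
    using orbit_has_ordering_iff[OF th(1)] uniq set unfolding th(2) by (auto simp del: rev_swap)
  also have "\<dots> = {xs, rev xs}" using xs(1) by (auto simp: permutations_of_set_def)
  finally show ?thesis using xs(1) by blast
qed

lemma card_orbits: "card (orbit_of ` Sol) = fact CARD('n) div 2"
proof -
  have "card (permutations_of_set (UNIV :: 'n set)) = 2 * card (orbit_of ` Sol)"
  proof (rule card_two_to_one[of _ _ "\<lambda>xs X. orbit_has_ordering X xs"])
    fix X assume "X \<in> orbit_of ` Sol"
    then obtain xs where xs: "xs \<in> permutations_of_set UNIV"
      "{ys \<in> permutations_of_set UNIV. orbit_has_ordering X ys} = {xs, rev xs}" using orbit_orderings by blast
    have "xs \<noteq> rev xs"
    proof
      assume e: "xs = rev xs"
      have d: "distinct xs" "length xs = CARD('n)"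
        using xs(1) by (auto simp: permutations_of_set_def distinct_card[symmetric])
      have "xs ! 0 = rev xs ! 0" using e by simp
      also have "\<dots> = xs ! (length xs - 1)" using d n by (simp add: rev_nth)
      finally show False using d n nth_eq_iff_index_eq[OF d(1), of 0 "length xs - 1"] by simp
    qed
    then show "card {ys \<in> permutations_of_set UNIV. orbit_has_ordering X ys} = 2" unfolding xs(2) by simp
  qed (use orbit_unique in auto)
  moreover have "card (permutations_of_set (UNIV :: 'n set)) = fact CARD('n)" by (simp add: card_permutations_of_set)
  ultimately show ?thesis by simp
qed

end

theorem theorem14:
  fixes m :: "'n::{finite,linorder} \<Rightarrow> real" and i1 :: 'n and c :: real
  assumes "CARD('n) \<ge> 2"
    and "\<And>i. m i > 0"
    and "\<And>i. m i1 \<le> m i"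
    and "0 < c" and "c < m i1 / 2"
  shows "card (orbit_z ` geodesic_occs m c) = fact CARD('n) div 2
    \<and> (\<forall>xs\<in>permutations_of_set (UNIV :: 'n set).
          \<exists>!X. X \<in> orbit_z ` geodesic_occs m c \<and> orbit_has_ordering X xs)
    \<and> (\<forall>X\<in>orbit_z ` geodesic_occs m c. \<exists>xs\<in>permutations_of_set (UNIV :: 'n set).
          {ys \<in> permutations_of_set UNIV. orbit_has_ordering X ys} = {xs, rev xs})
    \<and> (c < m i1 / 4 \<longrightarrow>
          (\<forall>q\<in>geodesic_occs m c. hessian_inertia m c q = (0, CARD('n), CARD('n) - 2)))"
proof -
  have c: "c < m i / 2" for i using assms(3)[of i] assms(5) by linarith
  interpret geodesic_problem m c
    using assms(1,2,4) c by unfold_locales auto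
  have inertia: "hessian_inertia m c q = (0, CARD('n), CARD('n) - 2)"
    if c4: "c < m i1 / 4" and q: "q \<in> geodesic_occs m c" for q
  proof -
    obtain al th where th: "q = line_config al th" "th \<in> line_solutions m c"
      using q unfolding geodesic_occs_eq[of m, OF assms(2,1)] by blast
    obtain l where l: "line_balanced m l th" using th(2) by (auto simp: line_solutions_def)
    have "\<bar>th i\<bar> < pi / 6" for i
    proof (rule angle_bound[of m _ c])
      show "c < m i * (sin (pi / 6))\<^sup>2" using c4 assms(3)[of i] by (simp add: sin_30 power_divide)
      show "\<bar>th i\<bar> \<le> pi / 2" using Sol_bound[OF th(2), of i] by simp
    qed (use assms(2) th(2) in \<open>auto simp: line_solutions_def\<close>)
    then have "line_equilibrium m l th"
      using assms(1,2) l Sol_inj[OF th(2)] by unfold_locales auto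
    then show ?thesis
      using line_hessian_inertia[of m l th c al] th assms(4) by (simp add: line_solutions_def)
  qed
  show ?thesis
    unfolding orbits by (intro conjI ballI impI card_orbits orbit_unique orbit_orderings inertia)
qed

end
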